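(* Let $\mu:\mathbb R^d\times\mathbb R^d\to\mathbb R$ be measurable, $\mathbb Z^d$-periodic in each variable, symmetric, $\mu(\xi,\eta)=\mu(\eta,\xi)$, with $0<\alpha_1\le\mu\le\alpha_2<\infty$. Let $a_{\rm sym}$ be an admissible kernel (see context) with $a_{\rm sym}(-z)=a_{\rm sym}(z)$. Let $c=(c^1,\dots,c^d):\mathbb R^d\to\mathbb R^d$ be such that $c^i(-z)=-c^i(z)$, $\int_{\mathbb R^d}|c(z)|\,dz<\infty$, $\int_{\mathbb R^d}|z|^2|c(z)|\,dz<\infty$, and such that for all $\boldsymbol\ell\in\mathbb R^d$ of sufficiently small norm the kernel $$a(z)=a_{\rm sym}(z)+\boldsymbol\ell\cdot c(z)$$ is admissible. Let $b(\boldsymbol\ell)\in\mathbb R^d$ be the effective drift corresponding to this kernel $a$ and to $\mu$. Then, for small $\boldsymbol\ell$ (with summation over repeated indices), $$b^i(\boldsymbol\ell)=\ell^j\int_{\mathbb R^d}\int_{\mathbb T^d}z^i c^j(z)\,\mu(\xi,\xi-z)\,d\xi\,dz+\ell^j\int_{\mathbb R^d}\int_{\mathbb T^d}z^i a_{\rm sym}(z)\,\mu(\xi,\xi-z)\,\tilde\varphi_0^j(\xi)\,d\xi\,dz+O(|\boldsymbol\ell|^2),\qquad(\mathrm A)$$ where $\tilde\varphi_0=\{\tilde\varphi_0^i\}\in(L^2(\mathbb T^d))^d$ is the solution of $$\int_{\mathbb R^d}a_{\rm sym}(\xi-q)\,\mu(\xi,q)\big(\tilde\varphi_0^i(q)-\tilde\varphi_0^i(\xi)\big)\,dq=2\int_{\mathbb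 R^d}c^i(\xi-q)\,\mu(\xi,q)\,dq,\qquad i=1,\dots,d,\qquad(\mathrm B)$$ with $\int_{\mathbb T^d}\tilde\varphi_0^i(\eta)\,d\eta=0$. In the special case when $c$ is taken to be the $\boldsymbol\ell$-dependent function $c_{\boldsymbol\ell}(z)=z\,a_{\rm sym}(z)\,\omega_{\boldsymbol\ell}(z)$, i.e. $a(z)=a_{\rm sym}(z)+\boldsymbol\ell\cdot c_{\boldsymbol\ell}(z)$ and $b(\boldsymbol\ell)$ is given by (A)–(B) with $c=c_{\boldsymbol\ell}$, the Einstein relation holds: $$\frac{\partial b^i(\boldsymbol\ell)}{\partial\ell^j}\Big|_{\boldsymbol\ell=0}=2\,\Theta^{ij}_{\rm sym},$$ where $\Theta_{\rm sym}$ is the effective matrix corresponding to the symmetric kernel $a_{\rm sym}(x-y)\mu(x,y)$.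
   Context: $\mathbb T^d=\mathbb R^d/\mathbb Z^d$; functions on $\mathbb T^d$ are identified with $\mathbb Z^d$-periodic functions on $\mathbb R^d$. Admissible kernel: a function $a:\mathbb R^d\to\mathbb R$ with $a\in L^1(\mathbb R^d)$, $a\ge0$, $\hat a(\eta):=\sum_{k\in\mathbb Z^d}a(\eta+k)\in L^2(\mathbb T^d)$, $\int_{\mathbb R^d}a(z)\,dz>0$ and $\int_{\mathbb R^d}|z|^2a(z)\,dz<\infty$. Effective drift and effective matrix. For an admissible kernel $a$ and for $\mu$ as in the claim, let $v_0\in L^2(\mathbb T^d)$ be the unique function with $\int_{\mathbb T^d}v_0\,d\xi=1$ and $$\int_{\mathbb R^d}a(q-\xi)\mu(q,\xi)v_0(q)\,dq=v_0(\xi)\int_{\mathbb R^d}a(\xi-q)\mu(\xi,q)\,dq .$$ The effective drift is $$b=\int_{\mathbb T^d}\int_{\mathbb R^d}a(\xi-q)\mu(\xi,q)(\xi-q)\,v_0(\xi)\,dq\,d\xi\in\mathbb R^d,$$ the first corrector $\varkappa_1\in(L^2(\mathbb T^d))^d$ is the solution (unique up to an additive constant vector) of $$\int_{\mathbb R^d}a(\xi-q)\mu(\xi,q)(\varkappa_1(q)-\varkappa_1(\xi))\,dq=\int_{\mathbb R^d}a(\xi-q)\mu(\xi,q)(\xi-q)\,dq-b,$$ and the effective matrix is $$\Theta^{ij}=\int_{\mathbb T^d}\int_{\mathbb R^d}a(\xi-q)\mu(\xi,q)\Big(\tfrac12(\xi-q)^i(\xi-q)^j-(\xi-q)^i\varkappa_1^j(q)\Big)v_0(\xi)\,dq\,d\xi+b^i\int_{\mathbb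 T^d}\varkappa_1^j(\xi)v_0(\xi)\,d\xi$$ (independent of the choice of the additive constant in $\varkappa_1$). $\Theta_{\rm sym}$ is this matrix for $a=a_{\rm sym}$ (in which case $v_0\equiv1$ and $b=0$). Cut-off: $\omega_{\boldsymbol\ell}(z)=\omega(|\boldsymbol\ell|\,|z|)$, where $\omega\in C_0^\infty(\mathbb R)$, $0\le\omega\le1$, $\omega(s)=1$ for $s\in[0,\frac14]$, $\omega(s)=0$ for $s\ge\frac12$. *)

theory Defs
  imports "HOL-Analysis.Analysis" "HOL-Library.Landau_Symbols"
begin

text \<open>
  Functions on the torus \<open>\<real>\<^sup>d / \<int>\<^sup>d\<close> are \<open>\<int>\<^sup>d\<close>-periodic functions on \<open>\<real>\<^sup>d\<close>, with \<open>\<real>\<^sup>d\<close> rendered as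
  \<open>real ^ 'n\<close>; integrals over the torus are integrals over the unit cell.  Elements of \<open>L\<^sup>p\<close> are
  represented by Borel functions, and identities between them hold almost everywhere.
\<close>

definition int_lattice :: "(real ^ 'n) set" where
  "int_lattice = {k. \<forall>i. k $ i \<in> \<int>}"

definition lattice_periodic :: "(real ^ 'n \<Rightarrow> 'b) \<Rightarrow> bool" where
  "lattice_periodic f \<longleftrightarrow> (\<forall>k\<in>int_lattice. \<forall>x. f (x + k) = f x)"

definition torus_integral :: "(real ^ 'n \<Rightarrow> 'b :: {banach, second_countable_topology}) \<Rightarrow> 'b" where
  "torus_integral f = (LINT x:cbox 0 1|lborel. f x)"

definition torus_L2 :: "(real ^ 'n \<Rightarrow> real) \<Rightarrow> bool" where
  "torus_L2 f \<longleftrightarrow> lattice_periodic f \<and> f \<in> borel_measurable borel \<and>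
     set_integrable lborel (cbox 0 1) (\<lambda>x. (f x)\<^sup>2)"

text \<open>
  For \<open>a \<ge> 0\<close> in \<open>L\<^sup>1\<close> the lattice sum below converges at almost every point, so the convention
  that \<open>infsum\<close> is 0 for a divergent sum only affects a null set.
\<close>

definition admissible :: "(real ^ 'n \<Rightarrow> real) \<Rightarrow> bool" where
  "admissible a \<longleftrightarrow>
     integrable lborel a \<and> (\<forall>z. 0 \<le> a z) \<and>
     torus_L2 (\<lambda>\<eta>. \<Sum>\<^sub>\<infinity>k\<in>int_lattice. a (\<eta> + k)) \<and>
     (\<integral>z. a z \<partial>lborel) > 0 \<and>
     integrable lborel (\<lambda>z. (norm z)\<^sup>2 * a z)"

definition is_invariant_density ::
  "(real ^ 'n \<Rightarrow> real) \<Rightarrow> (real ^ 'n \<Rightarrow> real ^ 'n \<Rightarrow> real) \<Rightarrow> (real ^ 'n \<Rightarrow> real) \<Rightarrow> bool" where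
  "is_invariant_density a \<mu> v \<longleftrightarrow>
     torus_L2 v \<and> torus_integral v = 1 \<and>
     (AE \<xi> in lborel. (\<integral>q. a (q - \<xi>) * \<mu> q \<xi> * v q \<partial>lborel)
        = v \<xi> * (\<integral>q. a (\<xi> - q) * \<mu> \<xi> q \<partial>lborel))"

text \<open>
  The density is unique only up to null sets, so a representative is chosen; the drift does not
  depend on the choice.
\<close>

definition invariant_density ::
  "(real ^ 'n \<Rightarrow> real) \<Rightarrow> (real ^ 'n \<Rightarrow> real ^ 'n \<Rightarrow> real) \<Rightarrow> real ^ 'n \<Rightarrow> real" where
  "invariant_density a \<mu> = (SOME v. is_invariant_density a \<mu> v)"

definition effective_drift ::
  "(real ^ 'n \<Rightarrow> real) \<Rightarrow> (real ^ 'n \<Rightarrow> real ^ 'n \<Rightarrow> real) \<Rightarrow> real ^ 'n" where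
  "effective_drift a \<mu> = torus_integral (\<lambda>\<xi>.
     \<integral>q. (a (\<xi> - q) * \<mu> \<xi> q * invariant_density a \<mu> \<xi>) *\<^sub>R (\<xi> - q) \<partial>lborel)"

definition is_first_corrector ::
  "(real ^ 'n \<Rightarrow> real) \<Rightarrow> (real ^ 'n \<Rightarrow> real ^ 'n \<Rightarrow> real) \<Rightarrow> (real ^ 'n \<Rightarrow> real ^ 'n) \<Rightarrow> bool" where
  "is_first_corrector a \<mu> \<kappa> \<longleftrightarrow>
     (\<forall>i. torus_L2 (\<lambda>\<xi>. \<kappa> \<xi> $ i)) \<and>
     (AE \<xi> in lborel. (\<integral>q. (a (\<xi> - q) * \<mu> \<xi> q) *\<^sub>R (\<kappa> q - \<kappa> \<xi>) \<partial>lborel)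
        = (\<integral>q. (a (\<xi> - q) * \<mu> \<xi> q) *\<^sub>R (\<xi> - q) \<partial>lborel) - effective_drift a \<mu>)"

text \<open>
  The corrector is unique up to null sets and an additive constant vector; neither affects the
  effective matrix.
\<close>

definition first_corrector ::
  "(real ^ 'n \<Rightarrow> real) \<Rightarrow> (real ^ 'n \<Rightarrow> real ^ 'n \<Rightarrow> real) \<Rightarrow> real ^ 'n \<Rightarrow> real ^ 'n" where
  "first_corrector a \<mu> = (SOME \<kappa>. is_first_corrector a \<mu> \<kappa>)"

definition effective_matrix ::
  "(real ^ 'n \<Rightarrow> real) \<Rightarrow> (real ^ 'n \<Rightarrow> real ^ 'n \<Rightarrow> real) \<Rightarrow> real ^ 'n ^ 'n" where
  "effective_matrix a \<mu> = (\<chi> i j.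
     torus_integral (\<lambda>\<xi>. \<integral>q. a (\<xi> - q) * \<mu> \<xi> q *
        (1 / 2 * (\<xi> - q) $ i * (\<xi> - q) $ j - (\<xi> - q) $ i * first_corrector a \<mu> q $ j) *
        invariant_density a \<mu> \<xi> \<partial>lborel)
     + effective_drift a \<mu> $ i *
        torus_integral (\<lambda>\<xi>. first_corrector a \<mu> \<xi> $ j * invariant_density a \<mu> \<xi>))"

definition is_density_correction ::
  "(real ^ 'n \<Rightarrow> real) \<Rightarrow> (real ^ 'n \<Rightarrow> real ^ 'n \<Rightarrow> real) \<Rightarrow> (real ^ 'n \<Rightarrow> real ^ 'n) \<Rightarrow>
   (real ^ 'n \<Rightarrow> real ^ 'n) \<Rightarrow> bool" where
  "is_density_correction a \<mu> c \<phi> \<longleftrightarrow>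
     (\<forall>i. torus_L2 (\<lambda>\<xi>. \<phi> \<xi> $ i) \<and>
       (AE \<xi> in lborel. (\<integral>q. a (\<xi> - q) * \<mu> \<xi> q * (\<phi> q $ i - \<phi> \<xi> $ i) \<partial>lborel)
          = 2 * (\<integral>q. c (\<xi> - q) $ i * \<mu> \<xi> q \<partial>lborel)) \<and>
       torus_integral (\<lambda>\<eta>. \<phi> \<eta> $ i) = 0)"

definition drift_linear_part ::
  "(real ^ 'n \<Rightarrow> real) \<Rightarrow> (real ^ 'n \<Rightarrow> real ^ 'n \<Rightarrow> real) \<Rightarrow> (real ^ 'n \<Rightarrow> real ^ 'n) \<Rightarrow>
   (real ^ 'n \<Rightarrow> real ^ 'n) \<Rightarrow> real ^ 'n \<Rightarrow> real ^ 'n" where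
  "drift_linear_part a \<mu> c \<phi> l = (\<chi> i.
     (\<Sum>j\<in>UNIV. l $ j *
        (\<integral>z. torus_integral (\<lambda>\<xi>. z $ i * c z $ j * \<mu> \<xi> (\<xi> - z)) \<partial>lborel)) +
     (\<Sum>j\<in>UNIV. l $ j *
        (\<integral>z. torus_integral (\<lambda>\<xi>. z $ i * a z * \<mu> \<xi> (\<xi> - z) * \<phi> \<xi> $ j) \<partial>lborel)))"

definition cutoff :: "(real \<Rightarrow> real) \<Rightarrow> bool" where
  "cutoff \<omega> \<longleftrightarrow>
     (\<forall>k s. ((deriv ^^ k) \<omega>) differentiable (at s)) \<and>
     compact (closure {s. \<omega> s \<noteq> 0}) \<and>
     (\<forall>s. 0 \<le> \<omega> s \<and> \<omega> s \<le> 1) \<and>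
     (\<forall>s\<in>{0..1/4}. \<omega> s = 1) \<and> (\<forall>s\<ge>1/2. \<omega> s = 0)"

definition einstein_perturbation ::
  "(real ^ 'n \<Rightarrow> real) \<Rightarrow> (real \<Rightarrow> real) \<Rightarrow> real ^ 'n \<Rightarrow> real ^ 'n \<Rightarrow> real ^ 'n" where
  "einstein_perturbation a \<omega> l z = (a z * \<omega> (norm l * norm z)) *\<^sub>R z"

end

theory Submission
  imports Defs
begin

text \<open>
  The operator \<open>gen p\<close> below is minus the adjoint of the nonlocal operator with kernel \<open>p\<close>, and
  \<open>p = a\<close> is the self-adjoint case.  Since \<open>a \<ge> \<delta>\<close> on a compact set \<open>K\<close> of positive measure, the
  energy controls the mean square increments of \<open>v\<close> along \<open>K\<close>, hence along \<open>K - K\<close>, which contains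
  a ball (Steinhaus), hence along all of the torus.  This is a Poincare inequality, so \<open>gen a\<close> is
  coercive on mean-zero functions, and so is \<open>gen (a + e)\<close> for every \<open>e\<close> of small \<open>L\<^sup>1\<close> norm; square
  integrability of the periodised kernel plays no role.  Coercivity yields both solvability and the
  estimates.

  Write the invariant density of \<open>a + e\<close>, with \<open>e\<close> odd, as \<open>1 + w\<close>, and let \<open>\<psi>\<close> be the density
  correction for \<open>e\<close>.  Then \<open>gen (a + e) w = - 2 \<integral> e \<mu>\<close> gives \<open>w = O(|e|)\<close>, and
  \<open>gen a (w - \<psi>) = - gen e w\<close> gives \<open>w - \<psi> = O(|e|\<^sup>2)\<close>; all constants depend only on \<open>L\<^sup>1\<close> norms of
  \<open>e\<close>, so that \<open>e = l \<bullet> c\<close> may have \<open>c\<close> depending on \<open>l\<close>.  For \<open>c(z) = z a(z)\<close> the correction is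
  twice the first corrector up to constants, and the reflection \<open>(\<xi>, z) \<mapsto> (\<xi> - z, - z)\<close> turns the
  corrector term of the effective matrix into that of the drift.
\<close>

section \<open>Integration over the torus\<close>

text \<open>\<open>torus\<close> is a probability measure on the whole space, concentrated on the
  unit cube, so periodic functions can be shifted by any vector without reduction modulo the
  lattice, and the reflection becomes a measure-preserving change of variables on a product with
  \<open>lborel\<close>. Two obstacles shape the proof. First, the perturbed operator is not
  self-adjoint, so solvability is drawn from coercivity alone, by a relaxation iteration. Coercivity
  survives because \<open>gen e\<close> has norm at most 2 \<alpha>2 times the L1 norm of
  \<open>e\<close>; the recurring condition that 4 \<alpha>2 times this norm is at most
  \<open>gap\<close> leaves half of the gap. Second, a quadratic remainder does not by itself give
  the derivative: the cut-off kernel varies with l, so the linear part is not linear in l. Along an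
  axis it is \<open>t * g t\<close>, and \<open>g t\<close> must be shown to tend to
  \<open>g 0\<close>. The zeroth order drops out because the local drift of an even kernel has mean
  zero over the torus.\<close>

definition torus :: "(real ^ 'n) measure" where
  "torus = density lborel (indicator (cbox 0 1))"

lemma sets_torus [simp, measurable_cong]: "sets torus = sets borel"
  and space_torus [simp]: "space torus = UNIV"
  by (simp_all add: torus_def)

lemma emeasure_torus_UNIV: "emeasure (torus :: (real ^ 'n) measure) UNIV = 1"
  by (simp add: torus_def emeasure_density emeasure_lborel_cbox_eq Basis_vec_def inner_axis prod.neutral)

interpretation torus: finite_measure "torus :: (real ^ 'n) measure"
  by standard (simp add: emeasure_torus_UNIV)

interpretation torus_lborel: pair_sigma_finite "torus :: (real ^ 'n) measure" "lborel :: (real ^ 'n) measure" ..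

lemma measure_torus_UNIV [simp]: "measure (torus :: (real ^ 'n) measure) UNIV = 1"
  by (simp add: measure_def emeasure_torus_UNIV)

lemma torus_integral_eq:
  assumes "f \<in> borel_measurable borel"
  shows "torus_integral f = (\<integral>x. f x \<partial>torus)"
  using integral_density[of f lborel "indicator (cbox 0 1)"] assms
  by (simp add: torus_integral_def set_lebesgue_integral_def torus_def ennreal_indicator)

lemma set_integrable_torus_iff:
  fixes f :: "real ^ 'n \<Rightarrow> 'b :: {banach, second_countable_topology}"
  assumes "f \<in> borel_measurable borel"
  shows "set_integrable lborel (cbox 0 1) f \<longleftrightarrow> integrable torus f"
  using integrable_density[of f lborel "indicator (cbox 0 1)"] assms
  by (simp add: set_integrable_def torus_def ennreal_indicator)

lemma torus_L2_iff:
  "torus_L2 f \<longleftrightarrow> lattice_periodic f \<and> f \<in> borel_measurable borel \<and> integrable torus (\<lambda>x. (f x)\<^sup>2)"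
  unfolding torus_L2_def using set_integrable_torus_iff[of "\<lambda>x. (f x)\<^sup>2"] by auto

section \<open>The integer lattice and its fundamental domain\<close>

lemma int_lattice_uminus: "k \<in> int_lattice \<Longrightarrow> - k \<in> int_lattice"
  by (simp add: int_lattice_def)

lemma countable_int_lattice: "countable (int_lattice :: (real ^ 'n) set)"
proof -
  have "int_lattice = range (\<lambda>f. \<chi> i. real_of_int (f i) :: real ^ 'n)"
  proof (intro equalityI subsetI)
    fix k :: "real ^ 'n" assume "k \<in> int_lattice"
    hence "\<forall>i. \<exists>n. k $ i = real_of_int n" by (auto simp: int_lattice_def Ints_def)
    then obtain f where "\<forall>i. k $ i = real_of_int (f i)" by metis
    hence "k = (\<chi> i. real_of_int (f i))" by (simp add: vec_eq_iff)
    thus "k \<in> range (\<lambda>f. \<chi> i. real_of_int (f i) :: real ^ 'n)" by blast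
  qed (auto simp: int_lattice_def)
  moreover have "countable (range (\<lambda>f. \<chi> i. real_of_int (f i) :: real ^ 'n))"
    by (intro countable_image countableI_type)
  ultimately show ?thesis by simp
qed

text \<open>The half-open cube meets every lattice orbit in exactly one point, which the closed cube
  underlying \<open>torus\<close> does not; the two differ by a null set.\<close>

definition unit_cell :: "(real ^ 'n) set" where
  "unit_cell = {x. \<forall>i. 0 \<le> x $ i \<and> x $ i < 1}"

lemma unit_cell_borel [measurable]: "unit_cell \<in> sets borel"
  unfolding unit_cell_def by measurable

definition vec_floor :: "real ^ 'n \<Rightarrow> real ^ 'n" where
  "vec_floor x = (\<chi> i. of_int \<lfloor>x $ i\<rfloor>)"

lemma vec_floor_lattice: "vec_floor x \<in> int_lattice"
  by (simp add: vec_floor_def int_lattice_def)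

lemma diff_mem_unit_cell_iff:
  assumes "k \<in> int_lattice"
  shows "x - k \<in> unit_cell \<longleftrightarrow> k = vec_floor x"
proof -
  have "(0 \<le> x $ i - k $ i \<and> x $ i - k $ i < 1) \<longleftrightarrow> k $ i = of_int \<lfloor>x $ i\<rfloor>" for i
  proof -
    obtain n where n: "k $ i = of_int n" using assms by (auto simp: int_lattice_def Ints_def)
    have "\<lfloor>x $ i\<rfloor> = n \<longleftrightarrow> of_int n \<le> x $ i \<and> x $ i < of_int n + 1"
      by (simp add: floor_eq_iff)
    thus ?thesis unfolding n of_int_eq_iff by linarith
  qed
  thus ?thesis by (simp add: unit_cell_def vec_floor_def vec_eq_iff)
qed

lemma unit_cell_subset: "unit_cell \<subseteq> cbox 0 (1 :: real ^ 'n)"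
  by (auto simp: unit_cell_def mem_box_cart less_imp_le)

lemma AE_unit_cell: "AE x in lborel. x \<in> cbox 0 1 \<longleftrightarrow> x \<in> (unit_cell :: (real ^ 'n) set)"
proof -
  have "cbox 0 1 - box 0 1 \<in> null_sets (lborel :: (real ^ 'n) measure)"
    unfolding null_sets_def
    by (auto simp: emeasure_Diff emeasure_lborel_cbox_eq emeasure_lborel_box_eq box_subset_cbox)
  hence "AE x in lborel. x \<notin> cbox 0 1 - box 0 (1 :: real ^ 'n)" by (rule AE_not_in)
  thus ?thesis
  proof eventually_elim
    case (elim x)
    thus ?case using unit_cell_subset by (auto simp: unit_cell_def mem_box_cart less_imp_le)
  qed
qed

section \<open>Translations and reflections of Lebesgue measure, and translations of the
  torus\<close>

lemma lborel_distr_plus_right: "distr lborel borel (\<lambda>x. x + c) = (lborel :: 'a :: euclidean_space measure)"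
proof -
  have "(\<lambda>x. x + c) = (+) c" by (simp add: fun_eq_iff add.commute)
  thus ?thesis using lborel_distr_plus[of c] by simp
qed

lemma lborel_distr_minus_left: "distr lborel borel (\<lambda>x. c - x) = (lborel :: 'a :: euclidean_space measure)"
  using lborel_affine[of "-1" c] by (simp add: density_1)

lemma AE_lborel_plus:
  assumes "AE x in lborel. P (x :: 'a :: euclidean_space)"
  shows "AE x in lborel. P (x + c)"
proof (rule AE_distrD[of "\<lambda>x. x + c" lborel borel P])
  show "AE x in distr lborel borel (\<lambda>x. x + c). P x"
    unfolding lborel_distr_plus_right by (rule assms)
qed simp

lemma nn_integral_lborel_plus:
  fixes f :: "'a :: euclidean_space \<Rightarrow> ennreal"
  assumes [measurable]: "f \<in> borel_measurable borel"
  shows "(\<integral>\<^sup>+x. f (x + c) \<partial>lborel) = (\<integral>\<^sup>+x. f x \<partial>lborel)"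
  by (subst (2) lborel_distr_plus_right[of c, symmetric], subst nn_integral_distr) auto

lemma nn_integral_lborel_reflect:
  fixes f :: "'a :: euclidean_space \<Rightarrow> ennreal"
  assumes [measurable]: "f \<in> borel_measurable borel"
  shows "(\<integral>\<^sup>+x. f (c - x) \<partial>lborel) = (\<integral>\<^sup>+x. f x \<partial>lborel)"
  by (subst (2) lborel_distr_minus_left[of c, symmetric], subst nn_integral_distr) auto

lemma lborel_integral_reflect:
  fixes f :: "'a :: euclidean_space \<Rightarrow> 'b :: {banach, second_countable_topology}"
  assumes [measurable]: "f \<in> borel_measurable borel"
  shows "(\<integral>x. f (c - x) \<partial>lborel) = (\<integral>x. f x \<partial>lborel)"
  by (subst (2) lborel_distr_minus_left[of c, symmetric], subst integral_distr) auto

lemma lborel_integrable_reflect_iff: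
  fixes f :: "'a :: euclidean_space \<Rightarrow> 'b :: {banach, second_countable_topology}"
  assumes [measurable]: "f \<in> borel_measurable borel"
  shows "integrable lborel (\<lambda>x. f (c - x)) \<longleftrightarrow> integrable lborel f"
  by (subst (2) lborel_distr_minus_left[of c, symmetric], subst integrable_distr_eq) auto

text \<open>Only the translate by \<open>vec_floor x\<close> contains \<open>x\<close>. The lattice
  sum is written as an integral over \<open>count_space\<close>, so that it can be exchanged with a
  Lebesgue integral by Tonelli's theorem.\<close>

lemma nn_integral_lattice_indicator:
  "(\<integral>\<^sup>+k. indicator unit_cell (x - k) \<partial>count_space int_lattice) = 1"
proof -
  have "(\<integral>\<^sup>+k. indicator unit_cell (x - k) \<partial>count_space int_lattice)
      = (\<integral>\<^sup>+k. indicator {vec_floor x} k \<partial>count_space int_lattice)"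
    by (intro nn_integral_cong) (auto simp: diff_mem_unit_cell_iff split: split_indicator)
  also have "\<dots> = 1" by (simp add: vec_floor_lattice)
  finally show ?thesis .
qed

lemma nn_integral_lattice_indicator':
  "(\<integral>\<^sup>+k. indicator unit_cell (x + k) \<partial>count_space int_lattice) = 1"
proof -
  have "bij_betw uminus int_lattice (int_lattice :: (real ^ 'n) set)"
    by (rule bij_betwI[of _ _ _ uminus]) (auto simp: int_lattice_uminus)
  from nn_integral_bij_count_space[OF this, of "\<lambda>k. indicator unit_cell (x - k)"]
  show ?thesis by (simp add: nn_integral_lattice_indicator)
qed

lemma nn_integral_torus:
  fixes h :: "real ^ 'n \<Rightarrow> ennreal"
  assumes [measurable]: "h \<in> borel_measurable borel"
  shows "(\<integral>\<^sup>+x. h x \<partial>torus) = (\<integral>\<^sup>+x. indicator unit_cell x * h x \<partial>lborel)"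
  unfolding torus_def
  by (subst nn_integral_density, simp, simp, rule nn_integral_cong_AE)
    (use AE_unit_cell in eventually_elim, simp split: split_indicator)

text \<open>
  Unfolding \<open>1 = \<Sum>\<^sub>k 1\<^sub>Q(x - k)\<close> over the lattice and shifting each summand by \<open>k\<close> moves the
  translate \<open>Q + z\<close> of the unit cell back to \<open>Q\<close>.
\<close>
lemma nn_integral_torus_translate:
  fixes h :: "real ^ 'n \<Rightarrow> ennreal"
  assumes [measurable]: "h \<in> borel_measurable borel" and per: "lattice_periodic h"
  shows "(\<integral>\<^sup>+x. h (x + z) \<partial>torus) = (\<integral>\<^sup>+x. h x \<partial>torus)"
proof -
  let ?Q = "unit_cell :: (real ^ 'n) set"
  note sum_swap = nn_integral_count_space_nn_integral[OF countable_int_lattice]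
  have "(\<integral>\<^sup>+x. h (x + z) \<partial>torus) = (\<integral>\<^sup>+x. indicator ?Q ((x + z) - z) * h (x + z) \<partial>lborel)"
    by (subst nn_integral_torus) auto
  also have "\<dots> = (\<integral>\<^sup>+x. indicator ?Q (x - z) * h x \<partial>lborel)"
    by (subst nn_integral_lborel_plus[of "\<lambda>x. indicator ?Q (x - z) * h x"]) auto
  also have "\<dots> = (\<integral>\<^sup>+x. (\<integral>\<^sup>+k. indicator ?Q (x - z) * h x * indicator ?Q (x - k) \<partial>count_space int_lattice) \<partial>lborel)"
    by (subst nn_integral_cmult) (auto simp: nn_integral_lattice_indicator)
  also have "\<dots> = (\<integral>\<^sup>+k. (\<integral>\<^sup>+x. indicator ?Q (x - z) * h x * indicator ?Q (x - k) \<partial>lborel) \<partial>count_space int_lattice)"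
    by (subst sum_swap) auto
  also have "\<dots> = (\<integral>\<^sup>+k. (\<integral>\<^sup>+x. indicator ?Q x * h x * indicator ?Q ((x - z) + k) \<partial>lborel) \<partial>count_space int_lattice)"
  proof (rule nn_integral_cong)
    fix k :: "real ^ 'n" assume "k \<in> space (count_space int_lattice)"
    hence k: "h (x + k) = h x" for x using per by (simp add: lattice_periodic_def)
    have "(\<integral>\<^sup>+x. indicator ?Q (x - z) * h x * indicator ?Q (x - k) \<partial>lborel)
      = (\<integral>\<^sup>+x. indicator ?Q ((x + k) - z) * h (x + k) * indicator ?Q ((x + k) - k) \<partial>lborel)"
      by (subst nn_integral_lborel_plus[of "\<lambda>x. indicator ?Q (x - z) * h x * indicator ?Q (x - k)" k]) auto
    thus "(\<integral>\<^sup>+x. indicator ?Q (x - z) * h x * indicator ?Q (x - k) \<partial>lborel)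
      = (\<integral>\<^sup>+x. indicator ?Q x * h x * indicator ?Q ((x - z) + k) \<partial>lborel)"
      by (simp add: k algebra_simps)
  qed
  also have "\<dots> = (\<integral>\<^sup>+x. (\<integral>\<^sup>+k. indicator ?Q x * h x * indicator ?Q ((x - z) + k) \<partial>count_space int_lattice) \<partial>lborel)"
    by (subst sum_swap[symmetric]) auto
  also have "\<dots> = (\<integral>\<^sup>+x. indicator ?Q x * h x \<partial>lborel)"
    by (subst nn_integral_cmult) (auto simp: nn_integral_lattice_indicator')
  also have "\<dots> = (\<integral>\<^sup>+x. h x \<partial>torus)" by (subst nn_integral_torus) auto
  finally show ?thesis .
qed

text \<open>Changes of variables are proved for nonnegative integrands; this carries them over to
  signed ones through positive and negative parts. The equality of integrals needs no integrability,
  because both sides are 0 when it fails.\<close>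

lemma integrable_integral_eqI:
  fixes f :: "'a \<Rightarrow> real" and g :: "'b \<Rightarrow> real"
  assumes [measurable]: "f \<in> borel_measurable M" "g \<in> borel_measurable N"
    and "(\<integral>\<^sup>+x. ennreal (f x) \<partial>M) = (\<integral>\<^sup>+x. ennreal (g x) \<partial>N)"
    and "(\<integral>\<^sup>+x. ennreal (- f x) \<partial>M) = (\<integral>\<^sup>+x. ennreal (- g x) \<partial>N)"
  shows "integrable M f \<longleftrightarrow> integrable N g" "(\<integral>x. f x \<partial>M) = (\<integral>x. g x \<partial>N)"
proof -
  show *: "integrable M f \<longleftrightarrow> integrable N g"
    using assms by (simp add: real_integrable_def)
  show "(\<integral>x. f x \<partial>M) = (\<integral>x. g x \<partial>N)"
  proof (cases "integrable M f")
    case True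
    with * show ?thesis using assms by (simp add: real_lebesgue_integral_def)
  next
    case False
    with * show ?thesis by (simp add: not_integrable_integral_eq)
  qed
qed

lemma lattice_periodic_compose: "lattice_periodic f \<Longrightarrow> lattice_periodic (\<lambda>x. g (f x))"
  by (simp add: lattice_periodic_def)

lemma torus_translate:
  fixes h :: "real ^ 'n \<Rightarrow> real"
  assumes [measurable]: "h \<in> borel_measurable borel" and per: "lattice_periodic h"
  shows integrable_torus_translate_iff: "integrable torus (\<lambda>x. h (x + z)) \<longleftrightarrow> integrable torus h"
    and integral_torus_translate: "(\<integral>x. h (x + z) \<partial>torus) = (\<integral>x. h x \<partial>torus)"
proof -
  have "lattice_periodic (\<lambda>x. ennreal (h x))" "lattice_periodic (\<lambda>x. ennreal (- h x))"
    using per by (simp_all add: lattice_periodic_def)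
  note * = nn_integral_torus_translate[OF _ this(1)] nn_integral_torus_translate[OF _ this(2)]
  show "integrable torus (\<lambda>x. h (x + z)) \<longleftrightarrow> integrable torus h"
    and "(\<integral>x. h (x + z) \<partial>torus) = (\<integral>x. h x \<partial>torus)"
    by (rule integrable_integral_eqI; simp add: *)+
qed

text \<open>The lattice is countable, so the translates of the exceptional set still form a null
  set, and every point has a translate in the unit cell.\<close>

lemma AE_lborel_if_AE_torus:
  assumes "AE x in torus. P (x :: real ^ 'n)" and per: "\<And>k x. k \<in> int_lattice \<Longrightarrow> P (x + k) \<Longrightarrow> P x"
  shows "AE x in lborel. P x"
proof -
  have "AE x in lborel. x \<in> cbox 0 1 \<longrightarrow> P x"
    using assms(1) unfolding torus_def by (subst (asm) AE_density) (auto elim!: AE_mp)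
  hence "AE x in lborel. \<forall>k\<in>int_lattice. x + k \<in> cbox 0 1 \<longrightarrow> P (x + k)"
    by (intro AE_ball_countable'[OF _ countable_int_lattice] AE_lborel_plus)
  thus ?thesis
  proof eventually_elim
    case (elim x)
    have "x - vec_floor x \<in> unit_cell" by (simp add: diff_mem_unit_cell_iff vec_floor_lattice)
    hence "x + (- vec_floor x) \<in> cbox 0 1" using unit_cell_subset by auto
    with elim show ?case using per int_lattice_uminus vec_floor_lattice by blast
  qed
qed

lemma AE_torus_if_AE_lborel: "AE x in lborel. P x \<Longrightarrow> AE x in torus. P x"
  unfolding torus_def by (subst AE_density) auto

section \<open>Square-integrable functions on the torus\<close>

text \<open>For fixed \<open>z\<close> the first variable is translated over the torus, which is
  harmless by periodicity; afterwards \<open>z\<close> is reflected. This is the symmetry that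
  exchanges the two endpoints of a jump.\<close>

lemma torus_shear:
  fixes H :: "real ^ 'n \<Rightarrow> real ^ 'n \<Rightarrow> real"
  assumes H[measurable]: "(\<lambda>(x, z). H x z) \<in> borel_measurable (borel \<Otimes>\<^sub>M borel)"
    and per: "\<And>z. lattice_periodic (\<lambda>x. H x z)"
  shows integrable_torus_shear_iff:
      "integrable (torus \<Otimes>\<^sub>M lborel) (\<lambda>(x, z). H (x - z) (- z)) \<longleftrightarrow>
       integrable (torus \<Otimes>\<^sub>M lborel) (\<lambda>(x, z). H x z)"
    and integral_torus_shear:
      "(\<integral>(x, z). H (x - z) (- z) \<partial>(torus \<Otimes>\<^sub>M lborel)) = (\<integral>(x, z). H x z \<partial>(torus \<Otimes>\<^sub>M lborel))"
proof -
  have nn: "(\<integral>\<^sup>+(x, z). ennreal (F (x - z) (- z)) \<partial>(torus \<Otimes>\<^sub>M lborel)) =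
            (\<integral>\<^sup>+(x, z). ennreal (F x z) \<partial>(torus \<Otimes>\<^sub>M lborel))"
    if [measurable]: "(\<lambda>(x, z). F x z) \<in> borel_measurable (borel \<Otimes>\<^sub>M borel)"
      and per: "\<And>z. lattice_periodic (\<lambda>x. F x z)" for F :: "real ^ 'n \<Rightarrow> real ^ 'n \<Rightarrow> real"
  proof -
    have "(\<integral>\<^sup>+(x, z). ennreal (F (x - z) (- z)) \<partial>(torus \<Otimes>\<^sub>M lborel)) =
          (\<integral>\<^sup>+z. \<integral>\<^sup>+x. ennreal (F (x + - z) (- z)) \<partial>torus \<partial>lborel)"
      by (subst torus_lborel.nn_integral_snd[symmetric]) (auto simp: case_prod_unfold)
    also have "\<dots> = (\<integral>\<^sup>+z. \<integral>\<^sup>+x. ennreal (F x (- z)) \<partial>torus \<partial>lborel)"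
      by (intro nn_integral_cong nn_integral_torus_translate[of "\<lambda>x. ennreal (F x _)"])
         (auto intro: lattice_periodic_compose[OF per])
    also have "\<dots> = (\<integral>\<^sup>+x. \<integral>\<^sup>+z. ennreal (F x (0 - z)) \<partial>lborel \<partial>torus)"
      by (subst torus_lborel.Fubini') auto
    also have "\<dots> = (\<integral>\<^sup>+x. \<integral>\<^sup>+z. ennreal (F x z) \<partial>lborel \<partial>torus)"
      by (intro nn_integral_cong nn_integral_lborel_reflect[of "\<lambda>z. ennreal (F _ z)"]) auto
    also have "\<dots> = (\<integral>\<^sup>+(x, z). ennreal (F x z) \<partial>(torus \<Otimes>\<^sub>M lborel))"
      by (subst lborel.nn_integral_fst[symmetric]) (auto simp: case_prod_unfold)
    finally show ?thesis .
  qed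
  have "lattice_periodic (\<lambda>x. - H x z)" for z using per by (rule lattice_periodic_compose)
  note nns = nn[OF H per] nn[of "\<lambda>x z. - H x z", OF _ this]
  show "integrable (torus \<Otimes>\<^sub>M lborel) (\<lambda>(x, z). H (x - z) (- z)) \<longleftrightarrow>
        integrable (torus \<Otimes>\<^sub>M lborel) (\<lambda>(x, z). H x z)"
    and "(\<integral>(x, z). H (x - z) (- z) \<partial>(torus \<Otimes>\<^sub>M lborel)) = (\<integral>(x, z). H x z \<partial>(torus \<Otimes>\<^sub>M lborel))"
    by (rule integrable_integral_eqI; use nns in \<open>simp add: case_prod_unfold\<close>)+
qed

lemma (in pair_sigma_finite) integrable_mult_product:
  fixes f :: "'a \<Rightarrow> real" and g :: "'b \<Rightarrow> real"
  assumes [measurable]: "integrable M1 f" "integrable M2 g"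
  shows "integrable (M1 \<Otimes>\<^sub>M M2) (\<lambda>(x, y). f x * g y)"
  by (rule Fubini_integrable) (use assms in \<open>auto simp: abs_mult\<close>)

text \<open>The weighted integral of the square of \<open>f - t\<close> is a nonnegative quadratic
  in \<open>t\<close>, evaluated at its minimum \<open>B / C\<close>. The weight later is the jump
  kernel at a fixed point.\<close>

lemma weighted_Cauchy_Schwarz:
  fixes f w :: "'a \<Rightarrow> real"
  assumes w: "integrable M w" "\<And>x. 0 \<le> w x"
    and f: "integrable M (\<lambda>x. w x * f x)" and f2: "integrable M (\<lambda>x. w x * (f x)\<^sup>2)"
  shows "(\<integral>x. w x * f x \<partial>M)\<^sup>2 \<le> (\<integral>x. w x \<partial>M) * (\<integral>x. w x * (f x)\<^sup>2 \<partial>M)"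
proof -
  define A B C where "A = (\<integral>x. w x * (f x)\<^sup>2 \<partial>M)" and "B = (\<integral>x. w x * f x \<partial>M)" and "C = (\<integral>x. w x \<partial>M)"
  have quad: "0 \<le> A - 2 * t * B + t\<^sup>2 * C" for t
  proof -
    have "0 \<le> (\<integral>x. w x * (f x - t)\<^sup>2 \<partial>M)" using w(2) by (intro integral_nonneg_AE) auto
    also have "\<dots> = (\<integral>x. w x * (f x)\<^sup>2 - 2 * t * (w x * f x) + t\<^sup>2 * w x \<partial>M)"
      by (intro Bochner_Integration.integral_cong) (auto simp: power2_eq_square algebra_simps)
    also have "\<dots> = A - 2 * t * B + t\<^sup>2 * C" using w f f2 by (simp add: A_def B_def C_def)
    finally show ?thesis .
  qed
  show ?thesis
  \<comment> \<open>Without mass there is no minimiser \<open>B / C\<close>, but then the weight,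
    and with it \<open>B\<close>, vanishes.\<close>
  proof (cases "C = 0")
    case True
    hence "AE x in M. w x = 0" using w by (simp add: C_def integral_nonneg_eq_0_iff_AE)
    hence "B = 0" unfolding B_def by (intro integral_eq_zero_AE) auto
    thus ?thesis using True by (simp add: B_def C_def)
  next
    case False
    have "C \<ge> 0" using w by (simp add: C_def)
    with False have "C > 0" by simp
    with quad[of "B / C"] have "B\<^sup>2 \<le> C * A" by (simp add: power2_eq_square field_simps)
    thus ?thesis by (simp add: A_def B_def C_def)
  qed
qed

lemma torus_L2_measurable: "torus_L2 f \<Longrightarrow> f \<in> borel_measurable borel"
  and torus_L2_periodic: "torus_L2 f \<Longrightarrow> lattice_periodic f"
  and torus_L2_square: "torus_L2 f \<Longrightarrow> integrable torus (\<lambda>x. (f x)\<^sup>2)"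
  by (simp_all add: torus_L2_iff)

lemma torus_L2_mult:
  assumes "torus_L2 f" "torus_L2 g"
  shows "integrable torus (\<lambda>x. f x * g x)"
proof (rule Bochner_Integration.integrable_bound)
  note [measurable] = assms[THEN torus_L2_measurable]
  show "integrable torus (\<lambda>x. (f x)\<^sup>2 + (g x)\<^sup>2)"
    using assms by (simp add: torus_L2_square)
  show "(\<lambda>x. f x * g x) \<in> borel_measurable torus" by measurable
  have "\<bar>a * b\<bar> \<le> a\<^sup>2 + b\<^sup>2" for a b :: real
    using zero_le_power2[of "\<bar>a\<bar> - \<bar>b\<bar>"] mult_nonneg_nonneg[of "\<bar>a\<bar>" "\<bar>b\<bar>"]
    unfolding power2_diff abs_mult power2_abs by linarith
  thus "AE x in torus. norm (f x * g x) \<le> norm ((f x)\<^sup>2 + (g x)\<^sup>2)" by simp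
qed

lemma torus_L2_const [simp]: "torus_L2 (\<lambda>_. c)"
  by (simp add: torus_L2_iff lattice_periodic_def)

lemma torus_L2_integrable: "torus_L2 f \<Longrightarrow> integrable torus f"
  using torus_L2_mult[of f "\<lambda>_. 1"] by simp

lemma torus_L2_cmult: "torus_L2 f \<Longrightarrow> torus_L2 (\<lambda>x. c * f x)"
  unfolding torus_L2_iff lattice_periodic_def
  by (intro conjI borel_measurable_times) (simp_all add: power_mult_distrib)

lemma torus_L2_add:
  assumes "torus_L2 f" "torus_L2 g"
  shows "torus_L2 (\<lambda>x. f x + g x)"
  using assms torus_L2_mult[OF assms] unfolding torus_L2_iff lattice_periodic_def
  by (intro conjI borel_measurable_add) (simp_all add: power2_sum mult.assoc)

lemma torus_L2_diff: "torus_L2 f \<Longrightarrow> torus_L2 g \<Longrightarrow> torus_L2 (\<lambda>x. f x - g x)"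
  using torus_L2_add[of f "\<lambda>x. (-1) * g x"] torus_L2_cmult[of g "-1"] by simp

lemma torus_L2_uminus: "torus_L2 f \<Longrightarrow> torus_L2 (\<lambda>x. - f x)"
  using torus_L2_cmult[of f "-1"] by simp

lemma torus_L2_bounded_mult:
  assumes "torus_L2 f" and [measurable]: "g \<in> borel_measurable borel" and "lattice_periodic g"
    and bd: "\<And>x. \<bar>g x\<bar> \<le> C"
  shows "torus_L2 (\<lambda>x. g x * f x)"
proof -
  note [measurable] = torus_L2_measurable[OF assms(1)]
  have "integrable torus (\<lambda>x. (g x * f x)\<^sup>2)"
  proof (rule Bochner_Integration.integrable_bound)
    show "integrable torus (\<lambda>x. C\<^sup>2 * (f x)\<^sup>2)" using assms by (simp add: torus_L2_square)
    have "(g x)\<^sup>2 \<le> C\<^sup>2" for x using bd[of x] by (metis abs_ge_zero power2_abs power_mono)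
    thus "AE x in torus. norm ((g x * f x)\<^sup>2) \<le> norm (C\<^sup>2 * (f x)\<^sup>2)"
      by (simp add: power_mult_distrib mult_right_mono)
  qed measurable
  thus ?thesis using assms by (simp add: torus_L2_iff lattice_periodic_def)
qed

lemma torus_L2_translate:
  assumes "torus_L2 f" shows "torus_L2 (\<lambda>x. f (x - z))"
proof -
  note [measurable] = torus_L2_measurable[OF assms]
  have "lattice_periodic (\<lambda>x. (f x)\<^sup>2)" using torus_L2_periodic[OF assms] by (rule lattice_periodic_compose)
  hence "integrable torus (\<lambda>x. (f (x + - z))\<^sup>2)"
    using torus_L2_square[OF assms] by (subst integrable_torus_translate_iff[of "\<lambda>x. (f x)\<^sup>2"]) auto
  moreover have "f (x + k - z) = f (x - z)" if "k \<in> int_lattice" for x k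
    using torus_L2_periodic[OF assms] that by (metis lattice_periodic_def diff_add_eq)
  ultimately show ?thesis by (simp add: torus_L2_iff lattice_periodic_def)
qed

lemma torus_L1_le_L2:
  assumes "torus_L2 f"
  shows "(\<integral>x. \<bar>f x\<bar> \<partial>torus)\<^sup>2 \<le> (\<integral>x. (f x)\<^sup>2 \<partial>torus)"
  using weighted_Cauchy_Schwarz[of torus "\<lambda>_. 1" "\<lambda>x. \<bar>f x\<bar>"] torus_L2_integrable[OF assms]
    torus_L2_square[OF assms] by simp

lemma torus_L2_Cauchy_Schwarz:
  assumes "torus_L2 f" "torus_L2 g"
  shows "(\<integral>x. f x * g x \<partial>torus)\<^sup>2 \<le> (\<integral>x. (f x)\<^sup>2 \<partial>torus) * (\<integral>x. (g x)\<^sup>2 \<partial>torus)"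
proof -
  define A B C where "A = (\<integral>x. (f x)\<^sup>2 \<partial>torus)" and "B = (\<integral>x. f x * g x \<partial>torus)" and "C = (\<integral>x. (g x)\<^sup>2 \<partial>torus)"
  have quad: "0 \<le> A - 2 * t * B + t\<^sup>2 * C" for t
  proof -
    have "0 \<le> (\<integral>x. (f x - t * g x)\<^sup>2 \<partial>torus)" by simp
    also have "\<dots> = (\<integral>x. (f x)\<^sup>2 - 2 * t * (f x * g x) + t\<^sup>2 * (g x)\<^sup>2 \<partial>torus)"
      by (intro Bochner_Integration.integral_cong) (auto simp: power2_eq_square algebra_simps)
    also have "\<dots> = A - 2 * t * B + t\<^sup>2 * C"
      using assms by (simp add: A_def B_def C_def torus_L2_square torus_L2_mult)
    finally show ?thesis .
  qed
  have C0: "C \<ge> 0" by (simp add: C_def)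
  show ?thesis
  proof (cases "C = 0")
    case True
    hence "AE x in torus. (g x)\<^sup>2 = 0"
      using torus_L2_square[OF assms(2)] by (simp add: C_def integral_nonneg_eq_0_iff_AE)
    hence "AE x in torus. f x * g x = 0" by eventually_elim simp
    hence "B = 0" unfolding B_def by (rule integral_eq_zero_AE)
    thus ?thesis using True by (simp add: B_def C_def)
  next
    case False
    with C0 quad[of "B / C"] have "B\<^sup>2 \<le> A * C" by (simp add: power2_eq_square field_simps)
    thus ?thesis by (simp add: A_def B_def C_def)
  qed
qed

section \<open>The seminorm of square-integrable functions\<close>

definition torus_norm :: "(real ^ 'n \<Rightarrow> real) \<Rightarrow> real" where
  "torus_norm f = sqrt (\<integral>x. (f x)\<^sup>2 \<partial>torus)"

lemma torus_norm_nonneg [simp]: "torus_norm f \<ge> 0"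
  by (simp add: torus_norm_def)

lemma torus_norm_square: "(torus_norm f)\<^sup>2 = (\<integral>x. (f x)\<^sup>2 \<partial>torus)"
  by (simp add: torus_norm_def)

lemma torus_norm_cmult: "torus_norm (\<lambda>x. c * f x) = \<bar>c\<bar> * torus_norm f"
  by (simp add: torus_norm_def power_mult_distrib real_sqrt_mult)

lemma torus_inner_le_norm:
  assumes "torus_L2 f" "torus_L2 g"
  shows "\<bar>\<integral>x. f x * g x \<partial>torus\<bar> \<le> torus_norm f * torus_norm g"
  using torus_L2_Cauchy_Schwarz[OF assms]
  by (rule_tac power2_le_imp_le) (auto simp: power_mult_distrib torus_norm_square)

lemma torus_norm_add:
  assumes "torus_L2 f" "torus_L2 g"
  shows "torus_norm (\<lambda>x. f x + g x) \<le> torus_norm f + torus_norm g"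
proof (rule power2_le_imp_le)
  have "(torus_norm (\<lambda>x. f x + g x))\<^sup>2 = (\<integral>x. (f x)\<^sup>2 + (g x)\<^sup>2 + 2 * (f x * g x) \<partial>torus)"
    unfolding torus_norm_square by (simp add: power2_sum mult.assoc)
  also have "\<dots> = (torus_norm f)\<^sup>2 + (torus_norm g)\<^sup>2 + 2 * (\<integral>x. f x * g x \<partial>torus)"
    using assms by (simp add: torus_norm_square torus_L2_square torus_L2_mult)
  also have "\<dots> \<le> (torus_norm f + torus_norm g)\<^sup>2"
    using torus_inner_le_norm[OF assms] by (simp add: power2_sum)
  finally show "(torus_norm (\<lambda>x. f x + g x))\<^sup>2 \<le> (torus_norm f + torus_norm g)\<^sup>2" .
qed simp

lemma torus_norm_diff:
  assumes "torus_L2 f" "torus_L2 g"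
  shows "torus_norm (\<lambda>x. f x - g x) \<le> torus_norm f + torus_norm g"
  using torus_norm_add[OF assms(1) torus_L2_uminus[OF assms(2)]] by (simp add: torus_norm_def)

lemma torus_norm_cong_AE:
  assumes "torus_L2 f" "torus_L2 g" "AE x in torus. f x = g x"
  shows "torus_norm f = torus_norm g"
proof -
  note [measurable] = assms(1,2)[THEN torus_L2_measurable]
  show ?thesis unfolding torus_norm_def
    by (intro arg_cong[of _ _ sqrt] integral_cong_AE) (use assms(3) in auto)
qed

lemma torus_norm_eq_0_iff:
  assumes "torus_L2 f"
  shows "torus_norm f = 0 \<longleftrightarrow> (AE x in torus. f x = 0)"
  using torus_L2_square[OF assms] by (simp add: torus_norm_def integral_nonneg_eq_0_iff_AE)

section \<open>The nonlocal operator and its energy\<close>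

locale periodic_coefficient =
  fixes \<mu> :: "real ^ 'n \<Rightarrow> real ^ 'n \<Rightarrow> real" and \<alpha>1 \<alpha>2 :: real
  assumes mu_borel: "case_prod \<mu> \<in> borel_measurable borel"
    and mu_periodic_fst: "lattice_periodic (\<lambda>\<xi>. \<mu> \<xi> \<eta>)"
    and mu_periodic_snd: "lattice_periodic (\<lambda>\<eta>. \<mu> \<xi> \<eta>)"
    and mu_sym: "\<mu> \<xi> \<eta> = \<mu> \<eta> \<xi>"
    and alpha1_pos: "0 < \<alpha>1" and mu_ge: "\<alpha>1 \<le> \<mu> \<xi> \<eta>" and mu_le: "\<mu> \<xi> \<eta> \<le> \<alpha>2"
begin

lemma borel_measurable_mu [measurable (raw)]:
  assumes [measurable]: "f \<in> M \<rightarrow>\<^sub>M borel" "g \<in> M \<rightarrow>\<^sub>M borel"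
  shows "(\<lambda>x. \<mu> (f x) (g x)) \<in> borel_measurable M"
proof -
  have [measurable]: "case_prod \<mu> \<in> borel_measurable (borel \<Otimes>\<^sub>M borel)"
    using mu_borel by (simp add: borel_prod)
  have "(\<lambda>x. case_prod \<mu> (f x, g x)) \<in> borel_measurable M" by measurable
  thus ?thesis by simp
qed

lemma mu_pos: "0 < \<mu> \<xi> \<eta>" and abs_mu: "\<bar>\<mu> \<xi> \<eta>\<bar> = \<mu> \<xi> \<eta>" and alpha2_pos: "0 < \<alpha>2"
  using alpha1_pos mu_ge[of \<xi> \<eta>] mu_le[of \<xi> \<eta>] by auto

lemma mu_mult_le: "0 \<le> c \<Longrightarrow> c * \<mu> \<xi> \<eta> \<le> \<alpha>2 * c"
  using mult_left_mono[OF mu_le, of c \<xi> \<eta>] by (simp add: mult.commute)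

lemma mu_shift: "k \<in> int_lattice \<Longrightarrow> \<mu> (x + k) (y + k) = \<mu> x y"
  using mu_periodic_fst[of "y + k"] mu_periodic_snd[of x] by (simp add: lattice_periodic_def)

text \<open>The shear exchanges the points \<open>x\<close> and \<open>x - z\<close> and flips the
  argument of \<open>p\<close>; \<mu> is unchanged because it is symmetric. Every adjoint in the
  development comes from this identity.\<close>

lemma kernel_swap:
  fixes G :: "real ^ 'n \<Rightarrow> real ^ 'n \<Rightarrow> real"
  assumes [measurable]: "p \<in> borel_measurable borel" "(\<lambda>(x, y). G x y) \<in> borel_measurable (borel \<Otimes>\<^sub>M borel)"
    and G: "\<And>k x y. k \<in> int_lattice \<Longrightarrow> G (x + k) (y + k) = G x y"
  shows integrable_kernel_swap_iff:
      "integrable (torus \<Otimes>\<^sub>M lborel) (\<lambda>(x, z). p (- z) * \<mu> x (x - z) * G (x - z) x) \<longleftrightarrow>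
       integrable (torus \<Otimes>\<^sub>M lborel) (\<lambda>(x, z). p z * \<mu> x (x - z) * G x (x - z))"
    and integral_kernel_swap:
      "(\<integral>(x, z). p (- z) * \<mu> x (x - z) * G (x - z) x \<partial>(torus \<Otimes>\<^sub>M lborel)) =
       (\<integral>(x, z). p z * \<mu> x (x - z) * G x (x - z) \<partial>(torus \<Otimes>\<^sub>M lborel))"
proof -
  define H where "H = (\<lambda>x z. p z * \<mu> x (x - z) * G x (x - z))"
  have H: "(\<lambda>(x, z). H x z) \<in> borel_measurable (borel \<Otimes>\<^sub>M borel)"
    unfolding H_def by measurable
  have per: "lattice_periodic (\<lambda>x. H x z)" for z
    using mu_shift[of _ _ "_ - z"] G[of _ _ "_ - z"]
    by (simp add: H_def lattice_periodic_def diff_add_eq[symmetric])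
  have eq: "H (x - z) (- z) = p (- z) * \<mu> x (x - z) * G (x - z) x" for x z
    by (simp add: H_def mu_sym)
  show "integrable (torus \<Otimes>\<^sub>M lborel) (\<lambda>(x, z). p (- z) * \<mu> x (x - z) * G (x - z) x) \<longleftrightarrow>
       integrable (torus \<Otimes>\<^sub>M lborel) (\<lambda>(x, z). p z * \<mu> x (x - z) * G x (x - z))"
    using integrable_torus_shear_iff[OF H per] unfolding eq unfolding H_def .
  show "(\<integral>(x, z). p (- z) * \<mu> x (x - z) * G (x - z) x \<partial>(torus \<Otimes>\<^sub>M lborel)) =
       (\<integral>(x, z). p z * \<mu> x (x - z) * G x (x - z) \<partial>(torus \<Otimes>\<^sub>M lborel))"
    using integral_torus_shear[OF H per] unfolding eq unfolding H_def .
qed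

section \<open>The integral operator with kernel \<open>p\<close> and its bounds\<close>

lemma integrable_kernel_fst:
  assumes p: "integrable lborel p" and f: "integrable torus f"
  shows "integrable (torus \<Otimes>\<^sub>M lborel) (\<lambda>(x, z). p z * \<mu> x (x - z) * f x)"
proof (rule Bochner_Integration.integrable_bound)
  have [measurable]: "p \<in> borel_measurable borel" "f \<in> borel_measurable borel"
    using p f by (auto dest: borel_measurable_integrable)
  show "integrable (torus \<Otimes>\<^sub>M lborel) (\<lambda>(x, z). \<alpha>2 * (f x * p z))"
    using torus_lborel.integrable_mult_product[OF f p] by (simp add: case_prod_unfold)
  show "(\<lambda>(x, z). p z * \<mu> x (x - z) * f x) \<in> borel_measurable (torus \<Otimes>\<^sub>M lborel)" by measurable
  have "\<bar>p z\<bar> * \<mu> x (x - z) * \<bar>f x\<bar> \<le> \<alpha>2 * \<bar>p z\<bar> * \<bar>f x\<bar>" for x z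
    by (intro mult_right_mono mu_mult_le) auto
  thus "AE w in torus \<Otimes>\<^sub>M lborel. norm (case w of (x, z) \<Rightarrow> p z * \<mu> x (x - z) * f x)
      \<le> norm (case w of (x, z) \<Rightarrow> \<alpha>2 * (f x * p z))"
    using alpha2_pos by (auto simp: abs_mult abs_mu mult_ac)
qed

text \<open>With \<open>f\<close> evaluated at \<open>x - z\<close> there is no product majorant;
  the swap moves \<open>f\<close> to the point \<open>x\<close>, where there is one.\<close>

lemma integrable_kernel_snd:
  assumes p: "integrable lborel p" and f: "integrable torus f" "lattice_periodic f"
  shows "integrable (torus \<Otimes>\<^sub>M lborel) (\<lambda>(x, z). p z * \<mu> x (x - z) * f (x - z))"
proof -
  have [measurable]: "p \<in> borel_measurable borel" "f \<in> borel_measurable borel"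
    using p f by (auto dest: borel_measurable_integrable)
  have "integrable lborel (\<lambda>z. p (- z))"
    using lborel_integrable_reflect_iff[of p 0] p by simp
  from integrable_kernel_fst[OF this f(1)] show ?thesis
    using integrable_kernel_swap_iff[of "\<lambda>z. p (- z)" "\<lambda>x y. f x"] f(2)
    by (simp add: lattice_periodic_def)
qed

text \<open>With \<open>q = x - z\<close> this is the integral operator with kernel
  \<open>p (x - q) * \<mu> x q\<close>. Applied to the constant 1 it gives the total jump rate at
  \<open>x\<close>, and with \<open>z $ i * p z\<close> in place of \<open>p z\<close> the local
  drift at \<open>x\<close>.\<close>

definition conv :: "(real ^ 'n \<Rightarrow> real) \<Rightarrow> (real ^ 'n \<Rightarrow> real) \<Rightarrow> real ^ 'n \<Rightarrow> real" where
  "conv p f x = (\<integral>z. p z * \<mu> x (x - z) * f (x - z) \<partial>lborel)"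

lemma conv_measurable [measurable]:
  assumes [measurable]: "p \<in> borel_measurable borel" "f \<in> borel_measurable borel"
  shows "conv p f \<in> borel_measurable borel"
  unfolding conv_def by measurable

lemma conv_periodic: "lattice_periodic f \<Longrightarrow> lattice_periodic (conv p f)"
  using mu_shift[of _ _ "_ - _"]
  by (auto simp: conv_def lattice_periodic_def diff_add_eq[symmetric])

lemma AE_integrable_conv:
  assumes "integrable lborel p" "integrable torus f" "lattice_periodic f"
  shows "AE x in torus. integrable lborel (\<lambda>z. p z * \<mu> x (x - z) * f (x - z))"
  using torus_lborel.AE_integrable_fst[of "\<lambda>x z. p z * \<mu> x (x - z) * f (x - z)"] integrable_kernel_snd[OF assms] by simp

lemma integrable_kernel:
  assumes "integrable lborel p"
  shows "integrable lborel (\<lambda>z. p z * \<mu> x (x - z))"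
proof (rule Bochner_Integration.integrable_bound)
  have [measurable]: "p \<in> borel_measurable borel"
    using assms by (auto dest: borel_measurable_integrable)
  show "integrable lborel (\<lambda>z. \<alpha>2 * p z)" using assms by simp
  show "(\<lambda>z. p z * \<mu> x (x - z)) \<in> borel_measurable lborel" by measurable
  show "AE z in lborel. norm (p z * \<mu> x (x - z)) \<le> norm (\<alpha>2 * p z)"
    using alpha2_pos by (simp add: abs_mult abs_mu mu_mult_le)
qed

lemma abs_conv_1_le:
  assumes p: "integrable lborel p"
  shows "\<bar>conv p (\<lambda>_. 1) x\<bar> \<le> \<alpha>2 * (\<integral>z. \<bar>p z\<bar> \<partial>lborel)"
proof -
  have "\<bar>conv p (\<lambda>_. 1) x\<bar> \<le> (\<integral>z. \<bar>p z * \<mu> x (x - z)\<bar> \<partial>lborel)"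
    by (simp add: conv_def)
  also have "\<dots> \<le> (\<integral>z. \<alpha>2 * \<bar>p z\<bar> \<partial>lborel)"
    using integrable_abs[OF integrable_kernel[OF p, of x]] p
    by (intro integral_mono) (auto simp: abs_mult abs_mu mu_mult_le)
  finally show ?thesis by simp
qed

text \<open>This holds at every \<open>x\<close>, since against the constant 1 the integrand is
  dominated by \<alpha>2 times the kernel. For general functions \<open>conv_add_kernel\<close>
  gives only an almost everywhere statement.\<close>

lemma conv_add_kernel_1:
  assumes "integrable lborel p" "integrable lborel q"
  shows "conv (\<lambda>z. p z + q z) (\<lambda>_. 1) x = conv p (\<lambda>_. 1) x + conv q (\<lambda>_. 1) x"
  using integrable_kernel[OF assms(1), of x] integrable_kernel[OF assms(2), of x]
  by (simp add: conv_def distrib_right)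

lemma conv_cmult_kernel: "conv (\<lambda>z. c * p z) f x = c * conv p f x"
  by (simp add: conv_def mult.assoc)

lemma conv_uminus_kernel: "conv (\<lambda>z. - p z) f x = - conv p f x"
  by (simp add: conv_def)

lemma torus_L2_conv_1:
  assumes p: "integrable lborel p"
  shows "torus_L2 (conv p (\<lambda>_. 1))"
proof -
  have [measurable]: "p \<in> borel_measurable borel"
    using p by (auto dest: borel_measurable_integrable)
  have "lattice_periodic (conv p (\<lambda>_. 1))" by (rule conv_periodic) (simp add: lattice_periodic_def)
  from torus_L2_bounded_mult[of "\<lambda>_. 1", OF _ _ this abs_conv_1_le[OF p]] show ?thesis by simp
qed

text \<open>Where one of the integrands is not integrable its integral is 0 by convention and
  linearity can fail. The almost everywhere form is inherited by \<open>gen\<close> and explains the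
  form of linearity assumed in \<open>coercive_imp_solvable\<close>.\<close>

lemma conv_add_cmult:
  assumes p: "integrable lborel p" and f: "integrable torus f" "lattice_periodic f"
    and g: "integrable torus g" "lattice_periodic g"
  shows "AE x in torus. conv p (\<lambda>x. f x + c * g x) x = conv p f x + c * conv p g x"
  using AE_integrable_conv[OF p f] AE_integrable_conv[OF p g]
proof eventually_elim
  case (elim x)
  have "conv p (\<lambda>x. f x + c * g x) x =
     (\<integral>z. p z * \<mu> x (x - z) * f (x - z) + c * (p z * \<mu> x (x - z) * g (x - z)) \<partial>lborel)"
    unfolding conv_def by (intro Bochner_Integration.integral_cong) (auto simp: algebra_simps)
  thus ?case using elim by (simp add: conv_def)
qed

lemma conv_add_kernel:
  assumes p: "integrable lborel p" and q: "integrable lborel q" and f: "integrable torus f" "lattice_periodic f"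
  shows "AE x in torus. conv (\<lambda>z. p z + q z) f x = conv p f x + conv q f x"
  using AE_integrable_conv[OF p f] AE_integrable_conv[OF q f]
proof eventually_elim
  case (elim x)
  thus ?case by (simp add: conv_def distrib_right)
qed

text \<open>First half of a Schur test: Cauchy-Schwarz with the weight
  \<open>\<bar>p z\<bar> * \<mu> x (x - z)\<close>, whose mass is at most the constant in
  front.\<close>

lemma conv_square_le:
  assumes p: "integrable lborel p" and f: "torus_L2 f"
  shows "AE x in torus. (conv p f x)\<^sup>2 \<le> (\<alpha>2 * (\<integral>z. \<bar>p z\<bar> \<partial>lborel)) * conv (\<lambda>z. \<bar>p z\<bar>) (\<lambda>x. (f x)\<^sup>2) x"
proof -
  have p': "integrable lborel (\<lambda>z. \<bar>p z\<bar>)" using p by simp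
  have f': "integrable torus (\<lambda>x. \<bar>f x\<bar>)" "lattice_periodic (\<lambda>x. \<bar>f x\<bar>)" "lattice_periodic (\<lambda>x. (f x)\<^sup>2)"
    using torus_L2_integrable[OF f] torus_L2_periodic[OF f] by (auto intro: lattice_periodic_compose)
  show ?thesis
    using AE_integrable_conv[OF p' f'(1,2)] AE_integrable_conv[OF p' torus_L2_square[OF f] f'(3)]
  proof eventually_elim
    case (elim x)
    have "\<bar>conv p f x\<bar> \<le> (\<integral>z. \<bar>p z * \<mu> x (x - z) * f (x - z)\<bar> \<partial>lborel)"
      by (simp add: conv_def)
    also have "\<dots> = (\<integral>z. \<bar>p z\<bar> * \<mu> x (x - z) * \<bar>f (x - z)\<bar> \<partial>lborel)"
      by (simp add: abs_mult abs_mu)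
    finally have "\<bar>conv p f x\<bar> \<le> (\<integral>z. \<bar>p z\<bar> * \<mu> x (x - z) * \<bar>f (x - z)\<bar> \<partial>lborel)" .
    from power_mono[OF this abs_ge_zero, of 2]
    have "(conv p f x)\<^sup>2 \<le> (\<integral>z. \<bar>p z\<bar> * \<mu> x (x - z) * \<bar>f (x - z)\<bar> \<partial>lborel)\<^sup>2"
      by (simp only: power2_abs)
    also have "\<dots> \<le> (\<integral>z. \<bar>p z\<bar> * \<mu> x (x - z) \<partial>lborel) * (\<integral>z. \<bar>p z\<bar> * \<mu> x (x - z) * \<bar>f (x - z)\<bar>\<^sup>2 \<partial>lborel)"
      using integrable_kernel[OF p', of x] elim by (intro weighted_Cauchy_Schwarz) (auto simp: less_imp_le[OF mu_pos])
    also have "\<dots> \<le> (\<alpha>2 * (\<integral>z. \<bar>p z\<bar> \<partial>lborel)) * (\<integral>z. \<bar>p z\<bar> * \<mu> x (x - z) * \<bar>f (x - z)\<bar>\<^sup>2 \<partial>lborel)"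
      using abs_conv_1_le[OF p', of x]
      by (intro mult_right_mono) (auto simp: conv_def less_imp_le[OF mu_pos] intro!: integral_nonneg_AE)
    finally show ?case by (simp add: conv_def)
  qed
qed

text \<open>Integrating means pairing with 1, and by the kernel swap the adjoint of
  \<open>conv p\<close> is \<open>conv\<close> of the reflected kernel.\<close>

lemma integral_conv:
  assumes p: "integrable lborel p" and f: "integrable torus f" "lattice_periodic f"
  shows "integrable torus (conv p f)"
    and "(\<integral>x. conv p f x \<partial>torus) = (\<integral>x. f x * conv (\<lambda>z. p (- z)) (\<lambda>_. 1) x \<partial>torus)"
proof -
  have [measurable]: "p \<in> borel_measurable borel" "f \<in> borel_measurable borel"
    using p f by (auto dest: borel_measurable_integrable)
  have p': "integrable lborel (\<lambda>z. p (- z))"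
    using lborel_integrable_reflect_iff[of p 0] p by simp
  show "integrable torus (conv p f)"
    using torus_lborel.integrable_fst[OF integrable_kernel_snd[OF p f]] by (simp add: conv_def[abs_def])
  have "(\<integral>x. conv p f x \<partial>torus) = (\<integral>(x, z). p z * \<mu> x (x - z) * f (x - z) \<partial>(torus \<Otimes>\<^sub>M lborel))"
    using torus_lborel.integral_fst[OF integrable_kernel_snd[OF p f]] by (simp add: conv_def)
  also have "\<dots> = (\<integral>(x, z). p (- z) * \<mu> x (x - z) * f x \<partial>(torus \<Otimes>\<^sub>M lborel))"
    using integral_kernel_swap[of "\<lambda>z. p (- z)" "\<lambda>x y. f x"] f(2) by (simp add: lattice_periodic_def)
  also have "\<dots> = (\<integral>x. \<integral>z. p (- z) * \<mu> x (x - z) * f x \<partial>lborel \<partial>torus)"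
    using torus_lborel.integral_fst[OF integrable_kernel_fst[OF p' f(1)]] by simp
  finally show "(\<integral>x. conv p f x \<partial>torus) = (\<integral>x. f x * conv (\<lambda>z. p (- z)) (\<lambda>_. 1) x \<partial>torus)"
    by (simp add: conv_def mult.commute)
qed

text \<open>Second half of the Schur test: the pointwise bound is integrated, and the adjoint
  applied to 1 is bounded by the same constant \<open>C\<close>, because reflection preserves the L1
  norm of \<open>p\<close>. The two factors \<open>C\<close> give \<open>C\<close> for the
  norm.\<close>

lemma
  assumes p: "integrable lborel p" and f: "torus_L2 f"
  shows torus_L2_conv: "torus_L2 (conv p f)"
    and torus_norm_conv: "torus_norm (conv p f) \<le> \<alpha>2 * (\<integral>z. \<bar>p z\<bar> \<partial>lborel) * torus_norm f"
proof -
  define C where "C = \<alpha>2 * (\<integral>z. \<bar>p z\<bar> \<partial>lborel)"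
  have C: "C \<ge> 0" using alpha2_pos by (simp add: C_def)
  have [measurable]: "p \<in> borel_measurable borel" "f \<in> borel_measurable borel"
    using p f by (auto dest: borel_measurable_integrable torus_L2_measurable)
  have p': "integrable lborel (\<lambda>z. \<bar>p z\<bar>)" using p by simp
  have p'': "integrable lborel (\<lambda>z. \<bar>p (- z)\<bar>)"
    using lborel_integrable_reflect_iff[of "\<lambda>z. \<bar>p z\<bar>" 0] p by simp
  have mass: "(\<integral>z. \<bar>p (- z)\<bar> \<partial>lborel) = (\<integral>z. \<bar>p z\<bar> \<partial>lborel)"
    using lborel_integral_reflect[of "\<lambda>z. \<bar>p z\<bar>" 0] by simp
  have f': "lattice_periodic (\<lambda>x. (f x)\<^sup>2)"
    using torus_L2_periodic[OF f] by (auto intro: lattice_periodic_compose)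
  note I = integral_conv[OF p' torus_L2_square[OF f] f']
  have bd: "AE x in torus. (conv p f x)\<^sup>2 \<le> C * conv (\<lambda>z. \<bar>p z\<bar>) (\<lambda>x. (f x)\<^sup>2) x"
    using conv_square_le[OF p f] by (simp add: C_def)
  have int: "integrable torus (\<lambda>x. (conv p f x)\<^sup>2)"
  proof (rule Bochner_Integration.integrable_bound)
    show "integrable torus (\<lambda>x. C * conv (\<lambda>z. \<bar>p z\<bar>) (\<lambda>x. (f x)\<^sup>2) x)" using I(1) by simp
    show "AE x in torus. norm ((conv p f x)\<^sup>2) \<le> norm (C * conv (\<lambda>z. \<bar>p z\<bar>) (\<lambda>x. (f x)\<^sup>2) x)"
      using bd by eventually_elim (simp add: abs_le_iff)
  qed measurable
  thus "torus_L2 (conv p f)"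
    using conv_periodic[OF torus_L2_periodic[OF f]] by (simp add: torus_L2_iff)
  have "(\<integral>x. (conv p f x)\<^sup>2 \<partial>torus) \<le> (\<integral>x. C * conv (\<lambda>z. \<bar>p z\<bar>) (\<lambda>x. (f x)\<^sup>2) x \<partial>torus)"
    using int I(1) bd by (intro integral_mono_AE) auto
  also have "\<dots> = C * (\<integral>x. (f x)\<^sup>2 * conv (\<lambda>z. \<bar>p (- z)\<bar>) (\<lambda>_. 1) x \<partial>torus)" using I(2) by simp
  also have "\<dots> \<le> C * (\<integral>x. (f x)\<^sup>2 * C \<partial>torus)"
  proof (rule mult_left_mono[OF _ C], rule integral_mono)
    have bd2: "\<bar>conv (\<lambda>z. \<bar>p (- z)\<bar>) (\<lambda>_. 1) x\<bar> \<le> C" for x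
      using abs_conv_1_le[OF p'', of x] by (simp add: mass C_def)
    show "integrable torus (\<lambda>x. (f x)\<^sup>2 * C)" using torus_L2_square[OF f] by simp
    show "(f x)\<^sup>2 * conv (\<lambda>z. \<bar>p (- z)\<bar>) (\<lambda>_. 1) x \<le> (f x)\<^sup>2 * C" for x
      using bd2[of x] by (intro mult_left_mono) auto
    have "integrable torus (\<lambda>x. f x * (conv (\<lambda>z. \<bar>p (- z)\<bar>) (\<lambda>_. 1) x * f x))"
      using f bd2 by (intro torus_L2_mult torus_L2_bounded_mult[of f _ C] conv_periodic) (auto simp: lattice_periodic_def)
    thus "integrable torus (\<lambda>x. (f x)\<^sup>2 * conv (\<lambda>z. \<bar>p (- z)\<bar>) (\<lambda>_. 1) x)"
      by (simp add: power2_eq_square mult_ac)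
  qed
  also have "\<dots> = C * ((\<integral>x. (f x)\<^sup>2 \<partial>torus) * C)" by simp
  also have "\<dots> = (C * torus_norm f)\<^sup>2"
    unfolding torus_norm_square[symmetric] by (simp add: power2_eq_square)
  finally have "torus_norm (conv p f) \<le> C * torus_norm f"
    using C by (rule_tac power2_le_imp_le) (auto simp: torus_norm_square)
  thus "torus_norm (conv p f) \<le> \<alpha>2 * (\<integral>z. \<bar>p z\<bar> \<partial>lborel) * torus_norm f" by (simp add: C_def)
qed

text \<open>Outflow from \<open>x\<close> minus inflow into \<open>x\<close> for the density
  \<open>v\<close>, so that an invariant density is a solution of
  \<open>gen p v = 0\<close>.\<close>

definition gen :: "(real ^ 'n \<Rightarrow> real) \<Rightarrow> (real ^ 'n \<Rightarrow> real) \<Rightarrow> real ^ 'n \<Rightarrow> real" where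
  "gen p v x = v x * conv p (\<lambda>_. 1) x - conv (\<lambda>z. p (- z)) v x"

lemma integrable_reflect: "integrable lborel p \<Longrightarrow> integrable lborel (\<lambda>z. p (- z))"
  for p :: "real ^ 'n \<Rightarrow> real"
  using lborel_integrable_reflect_iff[of p 0] by (auto dest: borel_measurable_integrable)

text \<open>The two terms of \<open>gen\<close> have norm at most \<alpha>2 times the L1 norm of
  \<open>p\<close> each. The mean vanishes because outflow and inflow have the same total; the range
  thus lies in the mean-zero functions, where solutions are sought.\<close>

lemma
  assumes p: "integrable lborel p" and v: "torus_L2 v"
  shows torus_L2_gen: "torus_L2 (gen p v)"
    and torus_norm_gen: "torus_norm (gen p v) \<le> 2 * \<alpha>2 * (\<integral>z. \<bar>p z\<bar> \<partial>lborel) * torus_norm v"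
    and integral_gen: "(\<integral>x. gen p v x \<partial>torus) = 0"
proof -
  define C where "C = \<alpha>2 * (\<integral>z. \<bar>p z\<bar> \<partial>lborel)"
  have C: "C \<ge> 0" using alpha2_pos by (simp add: C_def)
  have [measurable]: "p \<in> borel_measurable borel" "v \<in> borel_measurable borel"
    using p v by (auto dest: borel_measurable_integrable torus_L2_measurable)
  have mass: "(\<integral>z. \<bar>p (- z)\<bar> \<partial>lborel) = (\<integral>z. \<bar>p z\<bar> \<partial>lborel)"
    using lborel_integral_reflect[of "\<lambda>z. \<bar>p z\<bar>" 0] by simp
  have L2a: "torus_L2 (\<lambda>x. conv p (\<lambda>_. 1) x * v x)"
    using v abs_conv_1_le[OF p] by (intro torus_L2_bounded_mult[of v _ C] conv_periodic) (auto simp: lattice_periodic_def C_def)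
  have L2b: "torus_L2 (conv (\<lambda>z. p (- z)) v)" by (rule torus_L2_conv[OF integrable_reflect[OF p] v])
  show "torus_L2 (gen p v)"
    using torus_L2_diff[OF L2a L2b] by (simp add: gen_def[abs_def] mult.commute)
  have "torus_norm (\<lambda>x. conv p (\<lambda>_. 1) x * v x) \<le> C * torus_norm v"
  proof (rule power2_le_imp_le)
    have "(torus_norm (\<lambda>x. conv p (\<lambda>_. 1) x * v x))\<^sup>2 \<le> (\<integral>x. C\<^sup>2 * (v x)\<^sup>2 \<partial>torus)"
      unfolding torus_norm_square
    proof (rule integral_mono)
      show "integrable torus (\<lambda>x. (conv p (\<lambda>_. 1) x * v x)\<^sup>2)" by (rule torus_L2_square[OF L2a])
      show "integrable torus (\<lambda>x. C\<^sup>2 * (v x)\<^sup>2)" using torus_L2_square[OF v] by simp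
      have "(conv p (\<lambda>_. 1) x)\<^sup>2 \<le> C\<^sup>2" for x
        using power_mono[OF abs_conv_1_le[OF p, of x] abs_ge_zero, of 2] by (simp only: power2_abs C_def)
      thus "(conv p (\<lambda>_. 1) x * v x)\<^sup>2 \<le> C\<^sup>2 * (v x)\<^sup>2" for x
        by (simp add: power_mult_distrib mult_right_mono)
    qed
    thus "(torus_norm (\<lambda>x. conv p (\<lambda>_. 1) x * v x))\<^sup>2 \<le> (C * torus_norm v)\<^sup>2"
      by (simp add: power_mult_distrib torus_norm_square)
  qed (use C in simp)
  moreover have "torus_norm (conv (\<lambda>z. p (- z)) v) \<le> C * torus_norm v"
    using torus_norm_conv[OF integrable_reflect[OF p] v] by (simp add: mass C_def)
  ultimately show "torus_norm (gen p v) \<le> 2 * \<alpha>2 * (\<integral>z. \<bar>p z\<bar> \<partial>lborel) * torus_norm v"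
    using torus_norm_diff[OF L2a L2b] by (simp add: gen_def[abs_def] mult.commute C_def)
  show "(\<integral>x. gen p v x \<partial>torus) = 0"
    using integral_conv(2)[OF integrable_reflect[OF p] torus_L2_integrable[OF v] torus_L2_periodic[OF v]]
      torus_L2_integrable[OF L2a] torus_L2_integrable[OF L2b]
    by (simp add: gen_def mult.commute)
qed

lemma gen_add_cmult:
  assumes p: "integrable lborel p" and f: "torus_L2 f" and g: "torus_L2 g"
  shows "AE x in torus. gen p (\<lambda>x. f x + c * g x) x = gen p f x + c * gen p g x"
  using conv_add_cmult[OF integrable_reflect[OF p] torus_L2_integrable[OF f] torus_L2_periodic[OF f]
      torus_L2_integrable[OF g] torus_L2_periodic[OF g], of c]
  by eventually_elim (simp add: gen_def algebra_simps)

lemma gen_add_kernel: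
  assumes p: "integrable lborel p" and q: "integrable lborel q" and f: "torus_L2 f"
  shows "AE x in torus. gen (\<lambda>z. p z + q z) f x = gen p f x + gen q f x"
  using conv_add_kernel[OF integrable_reflect[OF p] integrable_reflect[OF q] torus_L2_integrable[OF f] torus_L2_periodic[OF f]]
  by eventually_elim (simp add: gen_def algebra_simps conv_add_kernel_1[OF p q])

lemma gen_const: "gen p (\<lambda>_. c) x = c * conv p (\<lambda>_. 1) x - c * conv (\<lambda>z. p (- z)) (\<lambda>_. 1) x"
  by (simp add: gen_def conv_def)

definition incr :: "(real ^ 'n \<Rightarrow> real) \<Rightarrow> real ^ 'n \<Rightarrow> real" where
  "incr v z = (\<integral>x. (v x - v (x - z))\<^sup>2 \<partial>torus)"

lemma incr_nonneg [simp]: "incr v z \<ge> 0"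
  by (simp add: incr_def)

text \<open>For an even kernel the quadratic form of \<open>gen p\<close> is the Dirichlet form,
  half of the integral of \<open>p z * \<mu> x (x - z)\<close> times the squared increment of
  \<open>v\<close>; replacing \<mu> by its lower bound leaves \<open>incr\<close>.\<close>

lemma gen_energy:
  assumes p: "integrable lborel p" "\<And>z. 0 \<le> p z" and even: "\<And>z. p (- z) = p z" and v: "torus_L2 v"
  shows "integrable lborel (\<lambda>z. p z * incr v z)"
    and "\<alpha>1 / 2 * (\<integral>z. p z * incr v z \<partial>lborel) \<le> (\<integral>x. v x * gen p v x \<partial>torus)"
proof -
  have [measurable]: "p \<in> borel_measurable borel" "v \<in> borel_measurable borel"
    using p v by (auto dest: borel_measurable_integrable torus_L2_measurable)
  let ?M = "torus \<Otimes>\<^sub>M (lborel :: (real ^ 'n) measure)"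
  have v2: "lattice_periodic (\<lambda>x. (v x)\<^sup>2)"
    using torus_L2_periodic[OF v] by (auto intro: lattice_periodic_compose)
  note vp = torus_L2_periodic[OF v, unfolded lattice_periodic_def]
  \<comment> \<open>The square expands as \<open>A + B - 2 * D\<close>. The quadratic form of
    \<open>gen p\<close> yields only \<open>A - D\<close>; evenness of \<open>p\<close> makes the
    integrals of \<open>A\<close> and \<open>B\<close> equal, which supplies the missing
    symmetry.\<close>
  define A B D where "A = (\<lambda>(x, z). p z * \<mu> x (x - z) * (v x)\<^sup>2)"
    and "B = (\<lambda>(x, z). p z * \<mu> x (x - z) * (v (x - z))\<^sup>2)"
    and "D = (\<lambda>(x, z). p z * \<mu> x (x - z) * (v x * v (x - z)))"
  have A: "integrable ?M A" unfolding A_def by (rule integrable_kernel_fst[OF p(1) torus_L2_square[OF v]])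
  have B: "integrable ?M B" unfolding B_def by (rule integrable_kernel_snd[OF p(1) torus_L2_square[OF v] v2])
  have AB: "integral\<^sup>L ?M A = integral\<^sup>L ?M B"
    using integral_kernel_swap[of p "\<lambda>x y. (v x)\<^sup>2"] vp by (simp add: even A_def B_def)
  have D: "integrable ?M D"
  proof (rule Bochner_Integration.integrable_bound)
    show "integrable ?M (\<lambda>w. A w + B w)" using A B by simp
    show "D \<in> borel_measurable ?M" unfolding D_def by measurable
    have "\<bar>a * b\<bar> \<le> a\<^sup>2 + b\<^sup>2" for a b :: real
      using zero_le_power2[of "\<bar>a\<bar> - \<bar>b\<bar>"] mult_nonneg_nonneg[of "\<bar>a\<bar>" "\<bar>b\<bar>"]
      unfolding power2_diff abs_mult power2_abs by linarith
    hence "p z * \<mu> x (x - z) * \<bar>v x * v (x - z)\<bar> \<le> p z * \<mu> x (x - z) * ((v x)\<^sup>2 + (v (x - z))\<^sup>2)" for x z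
      using p(2) mu_pos by (intro mult_left_mono) (auto simp: less_imp_le)
    thus "AE w in ?M. norm (D w) \<le> norm (A w + B w)"
      using p(2) mu_pos by (auto simp: A_def B_def D_def abs_mult abs_mu distrib_left[symmetric] abs_of_nonneg)
  qed
  have Dx: "(\<integral>z. D (x, z) \<partial>lborel) = v x * conv p v x" for x
  proof -
    have "(\<integral>z. D (x, z) \<partial>lborel) = (\<integral>z. v x * (p z * \<mu> x (x - z) * v (x - z)) \<partial>lborel)"
      unfolding D_def by (intro Bochner_Integration.integral_cong) auto
    thus ?thesis by (simp only: integral_mult_right_zero conv_def)
  qed
  have Ax: "(\<integral>z. A (x, z) \<partial>lborel) = (v x)\<^sup>2 * conv p (\<lambda>_. 1) x" for x
    by (simp add: A_def conv_def)
  have Dv: "(\<integral>x. v x * conv p v x \<partial>torus) = integral\<^sup>L ?M D"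
    using torus_lborel.integral_fst'[OF D] by (simp add: Dx)
  have Av: "(\<integral>x. (v x)\<^sup>2 * conv p (\<lambda>_. 1) x \<partial>torus) = integral\<^sup>L ?M A"
    using torus_lborel.integral_fst'[OF A] by (simp add: Ax)
  have bd: "\<bar>conv p (\<lambda>_. 1) x\<bar> \<le> \<alpha>2 * (\<integral>z. \<bar>p z\<bar> \<partial>lborel)" for x by (rule abs_conv_1_le[OF p(1)])
  have intA: "integrable torus (\<lambda>x. (v x)\<^sup>2 * conv p (\<lambda>_. 1) x)"
    using torus_lborel.integrable_fst'[OF A] by (simp add: Ax)
  have intD: "integrable torus (\<lambda>x. v x * conv p v x)"
    by (intro torus_L2_mult v torus_L2_conv p)
  have "(\<integral>x. v x * gen p v x \<partial>torus) = integral\<^sup>L ?M A - integral\<^sup>L ?M D"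
    unfolding Av[symmetric] Dv[symmetric] Bochner_Integration.integral_diff[OF intA intD, symmetric]
    by (intro Bochner_Integration.integral_cong) (auto simp: gen_def even algebra_simps power2_eq_square)
  also have "\<dots> = 1 / 2 * (\<integral>w. A w + B w - 2 * D w \<partial>?M)"
    using A B D AB by simp
  finally have E: "(\<integral>x. v x * gen p v x \<partial>torus) = 1 / 2 * (\<integral>w. A w + B w - 2 * D w \<partial>?M)" .
  define F where "F = (\<lambda>x z. p z * (v x - v (x - z))\<^sup>2)"
  have F_le: "\<alpha>1 * F x z \<le> A (x, z) + B (x, z) - 2 * D (x, z)" for x z
  proof -
    have "\<alpha>1 * F x z \<le> \<mu> x (x - z) * F x z"
      using mu_ge p(2) by (intro mult_right_mono) (auto simp: F_def)
    also have "\<dots> = A (x, z) + B (x, z) - 2 * D (x, z)"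
      by (simp add: A_def B_def D_def F_def power2_diff algebra_simps)
    finally show ?thesis .
  qed
  have F: "integrable ?M (\<lambda>(x, z). F x z)"
  proof (rule Bochner_Integration.integrable_bound)
    show "integrable ?M (\<lambda>w. (A w + B w - 2 * D w) / \<alpha>1)" using A B D by simp
    show "(\<lambda>(x, z). F x z) \<in> borel_measurable ?M" unfolding F_def by measurable
    have "0 \<le> F x z" for x z using p(2) by (simp add: F_def)
    thus "AE w in ?M. norm (case w of (x, z) \<Rightarrow> F x z) \<le> norm ((A w + B w - 2 * D w) / \<alpha>1)"
      using F_le alpha1_pos by (auto simp: field_simps intro!: order.trans[OF _ abs_ge_self])
  qed
  have inner: "(\<integral>x. F x z \<partial>torus) = p z * incr v z" for z by (simp add: F_def incr_def)
  show "integrable lborel (\<lambda>z. p z * incr v z)"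
    using torus_lborel.integrable_snd[OF F] by (simp add: inner)
  have "\<alpha>1 * (\<integral>z. p z * incr v z \<partial>lborel) = (\<integral>(x, z). \<alpha>1 * F x z \<partial>?M)"
    using torus_lborel.integral_snd[OF F] by (simp add: inner case_prod_unfold)
  also have "\<dots> \<le> (\<integral>w. A w + B w - 2 * D w \<partial>?M)"
    using F A B D F_le by (intro integral_mono) (auto simp: case_prod_unfold)
  finally show "\<alpha>1 / 2 * (\<integral>z. p z * incr v z \<partial>lborel) \<le> (\<integral>x. v x * gen p v x \<partial>torus)"
    unfolding E by simp
qed

end

section \<open>The Poincare inequality\<close>

lemma lborel_translate:
  fixes f :: "'a :: euclidean_space \<Rightarrow> 'b :: {banach, second_countable_topology}"
  assumes [measurable]: "f \<in> borel_measurable borel"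
  shows lborel_integral_minus: "(\<integral>x. f (x - c) \<partial>lborel) = (\<integral>x. f x \<partial>lborel)"
    and lborel_integrable_minus_iff: "integrable lborel (\<lambda>x. f (x - c)) \<longleftrightarrow> integrable lborel f"
proof -
  have [simp]: "distr lborel borel (\<lambda>x. x - c) = (lborel :: 'a measure)"
    using lborel_distr_plus_right[of "- c"] by simp
  show "(\<integral>x. f (x - c) \<partial>lborel) = (\<integral>x. f x \<partial>lborel)"
    using integral_distr[of "\<lambda>x. x - c" lborel borel f] by simp
  show "integrable lborel (\<lambda>x. f (x - c)) \<longleftrightarrow> integrable lborel f"
    using integrable_distr_eq[of "\<lambda>x. x - c" lborel borel f] by simp
qed

context periodic_coefficient
begin

text \<open>Translating the base point by \<open>u'\<close> turns the increment along
  \<open>u - u'\<close> into the difference of the increments along \<open>u\<close> and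
  \<open>u'\<close> from a common point.\<close>

lemma incr_diff_le:
  assumes v: "torus_L2 v"
  shows "incr v (u - u') \<le> 2 * incr v u + 2 * incr v u'"
proof -
  note [measurable] = torus_L2_measurable[OF v]
  have L2: "torus_L2 (\<lambda>x. v x - v (x - z))" for z by (intro torus_L2_diff torus_L2_translate v)
  define h where "h = (\<lambda>x. (v x - v (x - (u - u')))\<^sup>2)"
  have h: "h \<in> borel_measurable borel" unfolding h_def by measurable
  have h': "lattice_periodic h"
    unfolding h_def by (rule lattice_periodic_compose[OF torus_L2_periodic[OF L2]])
  have "incr v (u - u') = (\<integral>x. h (x + - u') \<partial>torus)"
    using integral_torus_translate[OF h h', of "- u'"] by (simp add: incr_def h_def)
  also have "\<dots> = (\<integral>x. ((v x - v (x - u)) - (v x - v (x - u')))\<^sup>2 \<partial>torus)"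
    by (intro Bochner_Integration.integral_cong) (auto simp: h_def algebra_simps power2_commute)
  also have "\<dots> \<le> (\<integral>x. 2 * (v x - v (x - u))\<^sup>2 + 2 * (v x - v (x - u'))\<^sup>2 \<partial>torus)"
  proof (rule integral_mono)
    show "integrable torus (\<lambda>x. ((v x - v (x - u)) - (v x - v (x - u')))\<^sup>2)"
      by (rule torus_L2_square[OF torus_L2_diff[OF L2 L2]])
    show "integrable torus (\<lambda>x. 2 * (v x - v (x - u))\<^sup>2 + 2 * (v x - v (x - u'))\<^sup>2)"
      using torus_L2_square[OF L2] by simp
    have "(p - q)\<^sup>2 \<le> 2 * p\<^sup>2 + 2 * q\<^sup>2" for p q :: real
      using zero_le_power2[of "p + q"] unfolding power2_sum power2_diff by linarith
    thus "((v x - v (x - u)) - (v x - v (x - u')))\<^sup>2 \<le> 2 * (v x - v (x - u))\<^sup>2 + 2 * (v x - v (x - u'))\<^sup>2" for x .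
  qed
  also have "\<dots> = 2 * incr v u + 2 * incr v u'"
    using torus_L2_square[OF L2] by (simp add: incr_def)
  finally show ?thesis .
qed

lemma incr_0 [simp]: "incr v 0 = 0"
  by (simp add: incr_def)

text \<open>Doubling is the difference of a vector and its negative, at cost 2 + 2 * 2 = 6, since
  the negative is in turn a difference from 0.\<close>

lemma incr_doubling:
  assumes v: "torus_L2 v"
  shows "incr v (2 ^ n *\<^sub>R h) \<le> 6 ^ n * incr v h"
proof (induction n)
  case (Suc n)
  let ?g = "2 ^ n *\<^sub>R h"
  have "2 ^ Suc n *\<^sub>R h = ?g - - ?g" by (simp add: scaleR_2[symmetric])
  hence "incr v (2 ^ Suc n *\<^sub>R h) \<le> 2 * incr v ?g + 2 * incr v (- ?g)"
    using incr_diff_le[OF v, of ?g "- ?g"] by simp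
  moreover have "incr v (- ?g) \<le> 2 * incr v ?g" using incr_diff_le[OF v, of 0 ?g] by simp
  ultimately show ?case using Suc by simp
qed simp

text \<open>The average of \<open>incr v (- h)\<close> over all \<open>h\<close> is exactly twice
  the squared norm: the autocorrelation of \<open>v\<close> integrates to the square of its mean,
  which is 0.\<close>

lemma torus_norm_le_incr:
  assumes v: "torus_L2 v" and mean: "(\<integral>x. v x \<partial>torus) = 0"
    and bd: "\<And>h. h \<in> cbox 0 1 \<Longrightarrow> incr v (- h) \<le> C"
  shows "2 * (torus_norm v)\<^sup>2 \<le> C"
proof -
  note [measurable] = torus_L2_measurable[OF v]
  interpret TT: pair_sigma_finite "torus :: (real ^ 'n) measure" "torus :: (real ^ 'n) measure" ..
  have vt: "torus_L2 (\<lambda>x. v (x + h))" for h using torus_L2_translate[OF v, of "- h"] by simp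
  have per: "lattice_periodic v" "lattice_periodic (\<lambda>x. \<bar>v x\<bar>)" "lattice_periodic (\<lambda>x. (v x)\<^sup>2)"
    using torus_L2_periodic[OF v] by (auto intro: lattice_periodic_compose)
  have int: "integrable (torus \<Otimes>\<^sub>M torus) (\<lambda>(x, h). v x * v (x + h))"
  proof (rule TT.Fubini_integrable)
    have "(\<integral>h. norm (v x * v (x + h)) \<partial>torus) = \<bar>v x\<bar> * (\<integral>h. \<bar>v h\<bar> \<partial>torus)" for x
      using integral_torus_translate[OF _ per(2), of x] by (simp add: abs_mult add.commute)
    thus "integrable torus (\<lambda>x. \<integral>h. norm (case (x, h) of (x, h) \<Rightarrow> v x * v (x + h)) \<partial>torus)"
      using torus_L2_integrable[OF v] by simp
    have "integrable torus (\<lambda>h. v (h + x))" for x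
      using torus_L2_integrable[OF vt] .
    thus "AE x in torus. integrable torus (\<lambda>h. case (x, h) of (x, h) \<Rightarrow> v x * v (x + h))"
      by (simp add: add.commute)
  qed measurable
  have "(\<integral>h. \<integral>x. v x * v (x + h) \<partial>torus \<partial>torus) = (\<integral>x. \<integral>h. v x * v (x + h) \<partial>torus \<partial>torus)"
    by (rule TT.Fubini_integral[OF int])
  also have "\<dots> = (\<integral>x. v x * (\<integral>h. v (h + x) \<partial>torus) \<partial>torus)" by (simp add: add.commute)
  also have "\<dots> = 0" using integral_torus_translate[OF _ per(1)] mean by simp
  finally have cor: "(\<integral>h. \<integral>x. v x * v (x + h) \<partial>torus \<partial>torus) = 0" .
  have incr_eq: "incr v (- h) = 2 * (torus_norm v)\<^sup>2 - 2 * (\<integral>x. v x * v (x + h) \<partial>torus)" for h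
  proof -
    have "incr v (- h) = (\<integral>x. (v x)\<^sup>2 + (v (x + h))\<^sup>2 - 2 * (v x * v (x + h)) \<partial>torus)"
      unfolding incr_def by (intro Bochner_Integration.integral_cong) (auto simp: power2_diff)
    also have "\<dots> = (\<integral>x. (v x)\<^sup>2 \<partial>torus) + (\<integral>x. (v (x + h))\<^sup>2 \<partial>torus) - 2 * (\<integral>x. v x * v (x + h) \<partial>torus)"
      using torus_L2_square[OF v] torus_L2_square[OF vt] torus_L2_mult[OF v vt] by simp
    also have "(\<integral>x. (v (x + h))\<^sup>2 \<partial>torus) = (\<integral>x. (v x)\<^sup>2 \<partial>torus)"
      using integral_torus_translate[OF _ per(3)] by simp
    finally show ?thesis by (simp add: torus_norm_square)
  qed
  have int2: "integrable torus (\<lambda>h. \<integral>x. v x * v (x + h) \<partial>torus)"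
    by (rule TT.integrable_snd[OF int])
  hence int3: "integrable torus (\<lambda>h. incr v (- h))" unfolding incr_eq by simp
  have "2 * (torus_norm v)\<^sup>2 = (\<integral>h. incr v (- h) \<partial>torus)"
    unfolding incr_eq using int2 cor by simp
  also have "\<dots> \<le> (\<integral>h. C \<partial>(torus :: (real ^ 'n) measure))"
  proof (rule integral_mono_AE[OF int3])
    have "AE h in torus. h \<in> cbox 0 (1 :: real ^ 'n)"
      unfolding torus_def by (subst AE_density) (auto split: split_indicator_asm)
    thus "AE h in torus. incr v (- h) \<le> C" by eventually_elim (rule bd)
  qed simp
  finally show ?thesis by simp
qed

text \<open>
  Steinhaus' argument: if \<open>U \<supseteq> K\<close> is open with \<open>|U| \<le> 3/2 |K|\<close>, then \<open>K \<union> (K + h) \<subseteq> U\<close> for small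
  \<open>h\<close>, which forces \<open>|K \<inter> (K + h)| \<ge> |K|/2\<close>.
\<close>
lemma kernel_overlap:
  assumes a: "integrable lborel a" "\<And>z. 0 \<le> a z" "(\<integral>z. a z \<partial>lborel) > 0"
  obtains K :: "(real ^ 'n) set" and \<delta> \<epsilon> m :: real where
    "K \<in> sets borel" "\<delta> > 0" "\<epsilon> > 0" "m > 0" "\<And>z. z \<in> K \<Longrightarrow> \<delta> \<le> a z"
    "\<And>h. norm h < \<epsilon> \<Longrightarrow> emeasure lborel {u. u \<in> K \<and> u - h \<in> K} < \<infinity>"
    "\<And>h. norm h < \<epsilon> \<Longrightarrow> m \<le> measure lborel {u. u \<in> K \<and> u - h \<in> K}"
proof -
  have [measurable]: "a \<in> borel_measurable borel"
    using a by (auto dest: borel_measurable_integrable)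
  have "\<exists>n. emeasure lborel {z. 1 / Suc n \<le> a z} > 0"
  proof (rule ccontr)
    assume "\<not> ?thesis"
    hence "\<forall>n. AE z in lborel. \<not> 1 / Suc n \<le> a z"
      by (subst AE_iff_measurable[OF _ refl]) (auto simp: not_less)
    hence "AE z in lborel. \<forall>n. \<not> 1 / Suc n \<le> a z" by (simp add: AE_all_countable)
    hence "AE z in lborel. a z = 0"
    proof eventually_elim
      case (elim z)
      show ?case
      proof (rule ccontr)
        assume "a z \<noteq> 0"
        with a(2)[of z] have "0 < a z" by simp
        then obtain n where "1 / Suc n < a z" using nat_approx_posE by blast
        with elim show False by (meson less_imp_le)
      qed
    qed
    hence "(\<integral>z. a z \<partial>lborel) = 0" by (rule integral_eq_zero_AE)
    with a(3) show False by simp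
  qed
  then obtain n where n: "emeasure lborel {z. 1 / Suc n \<le> a z} > 0" ..
  define \<delta> where "\<delta> = 1 / Suc n"
  define A where "A = {z. \<delta> \<le> a z}"
  have A [measurable]: "A \<in> sets borel" unfolding A_def by measurable
  have \<delta>: "\<delta> > 0" by (simp add: \<delta>_def)
  \<comment> \<open>Inner regularity is applied to this finite measure instead of Lebesgue measure.
    Since \<open>a\<close> is at least \<open>\<delta>\<close> on \<open>A\<close>, a subset of
    \<open>A\<close> that is null for one is null for the other.\<close>
  define N where "N = density lborel (\<lambda>z. ennreal (a z))"
  have N_sets: "sets N = sets borel" by (simp add: N_def)
  have "emeasure N (space N) \<noteq> \<infinity>"
    using a by (simp add: N_def emeasure_density nn_integral_eq_integral)
  have N_A: "emeasure N A \<noteq> 0"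
  proof
    assume "emeasure N A = 0"
    hence "AE z in lborel. ennreal (a z) * indicator A z = 0"
      by (simp add: N_def emeasure_density nn_integral_0_iff_AE)
    hence "AE z in lborel. z \<notin> A"
      by eventually_elim (use \<delta> in \<open>auto simp: A_def split: split_indicator_asm\<close>)
    hence "emeasure lborel A = 0" by (subst (asm) AE_iff_measurable[of A]) auto
    with n show False by (simp add: A_def \<delta>_def)
  qed
  have "emeasure N A = (SUP K\<in>{K. K \<subseteq> A \<and> compact K}. emeasure N K)"
    by (rule inner_regular) (use N_sets A \<open>emeasure N (space N) \<noteq> \<infinity>\<close> in auto)
  moreover have "(SUP K\<in>{K. K \<subseteq> A \<and> compact K}. emeasure N K) \<le> 0"
    if "\<And>K. K \<subseteq> A \<Longrightarrow> compact K \<Longrightarrow> emeasure N K = 0"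
    by (rule SUP_least) (simp add: that)
  ultimately obtain K where K: "K \<subseteq> A" "compact K" "emeasure N K \<noteq> 0"
    using N_A by (metis le_zero_eq)
  have K_borel [measurable]: "K \<in> sets borel" using K by (simp add: borel_compact)
  have K_fin: "emeasure lborel K < \<infinity>" using emeasure_bounded_finite[OF compact_imp_bounded[OF K(2)]] by simp
  have "emeasure lborel K \<noteq> 0"
  proof
    assume "emeasure lborel K = 0"
    hence "emeasure N K = 0"
      unfolding N_def by (subst emeasure_density) (auto intro!: nn_integral_null_set simp: null_sets_def)
    with K show False by simp
  qed
  hence mK: "measure lborel K > 0" using K_fin
    by (simp add: measure_def enn2real_positive_iff zero_less_iff_neq_zero)
  obtain U where U: "open U" "K \<subseteq> U" "emeasure lborel (U - K) < ennreal (measure lborel K / 2)"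
    using outer_regular_lborel[OF K_borel, of "measure lborel K / 2"] mK by auto
  have [measurable]: "U \<in> sets borel" using U by simp
  have UK: "emeasure lborel (U - K) < \<infinity>" using U(3) by (rule less_trans) simp
  have "measure lborel (U - K) \<le> measure lborel K / 2"
    using U(3) mK unfolding measure_def[of lborel "U - K"] by (intro enn2real_leI) (auto intro: less_imp_le)
  moreover have U_fin: "emeasure lborel U < \<infinity>"
  proof -
    have "emeasure lborel (K \<union> (U - K)) \<le> emeasure lborel K + emeasure lborel (U - K)"
      by (rule emeasure_subadditive) auto
    also have "\<dots> < \<infinity>" using K_fin UK by simp
    finally show ?thesis using U(2) by (simp add: Un_absorb1)
  qed
  ultimately have mU: "measure lborel U \<le> 3 / 2 * measure lborel K"
    using measure_Diff[of lborel U K] U(2) by (simp add: less_top[symmetric])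
  obtain \<epsilon> where \<epsilon>: "\<epsilon> > 0" "(\<Union>x\<in>K. ball x \<epsilon>) \<subseteq> U"
    using compact_subset_open_imp_ball_epsilon_subset[OF K(2) U(1,2)] by blast
  show ?thesis
  proof (rule that[OF K_borel \<delta> \<epsilon>(1), of "measure lborel K / 2"])
    show "\<delta> \<le> a z" if "z \<in> K" for z using K that by (auto simp: A_def)
    fix h :: "real ^ 'n" assume h: "norm h < \<epsilon>"
    define S where "S = {u. u \<in> K \<and> u - h \<in> K}"
    have [measurable]: "S \<in> sets borel" unfolding S_def by measurable
    have "emeasure lborel S \<le> emeasure lborel K" by (rule emeasure_mono) (auto simp: S_def)
    thus S_fin: "emeasure lborel {u. u \<in> K \<and> u - h \<in> K} < \<infinity>" using K_fin by (simp add: S_def)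
    have indK: "integrable lborel (indicator K :: _ \<Rightarrow> real)" using K_fin by simp
    have indK': "integrable lborel (\<lambda>u. indicator K (u - h) :: real)"
      using lborel_integrable_minus_iff[of "indicator K :: _ \<Rightarrow> real" h] indK by simp
    have "2 * measure lborel K = (\<integral>u. indicator K u + indicator K (u - h) \<partial>lborel)"
      using indK indK' lborel_integral_minus[of "indicator K :: _ \<Rightarrow> real" h] by simp
    also have "\<dots> \<le> (\<integral>u. indicator U u + indicator S u \<partial>lborel)"
    proof (rule integral_mono)
      show "integrable lborel (\<lambda>u. indicator U u + indicator S u :: real)"
        using U_fin S_fin by (simp add: S_def)
      have "u \<in> U" if "u - h \<in> K" for u
        using that \<epsilon>(2) h by (force simp: dist_norm)
      thus "indicator K u + indicator K (u - h) \<le> (indicator U u + indicator S u :: real)" for u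
        using U(2) by (auto simp: S_def split: split_indicator)
    qed (use indK indK' in simp)
    also have "\<dots> = measure lborel U + measure lborel S"
      using U_fin S_fin by (simp add: S_def)
    finally show "measure lborel K / 2 \<le> measure lborel {u. u \<in> K \<and> u - h \<in> K}"
      using mU by (simp add: S_def)
  qed (use mK in simp)
qed

lemma gen_coercive:
  assumes a: "integrable lborel a" "\<And>z. 0 \<le> a z" "(\<integral>z. a z \<partial>lborel) > 0" and even: "\<And>z. a (- z) = a z"
  obtains c where "c > 0"
    "\<And>v. torus_L2 v \<Longrightarrow> (\<integral>x. v x \<partial>torus) = 0 \<Longrightarrow> c * (torus_norm v)\<^sup>2 \<le> (\<integral>x. v x * gen a v x \<partial>torus)"
proof -
  obtain K \<delta> \<epsilon> m where K [measurable]: "K \<in> sets borel" and pos: "\<delta> > 0" "\<epsilon> > 0" "m > 0"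
    and a_ge: "\<And>z. z \<in> K \<Longrightarrow> \<delta> \<le> a z"
    and fin: "\<And>h. norm h < \<epsilon> \<Longrightarrow> emeasure lborel {u. u \<in> K \<and> u - h \<in> K} < \<infinity>"
    and m: "\<And>h. norm h < \<epsilon> \<Longrightarrow> m \<le> measure lborel {u. u \<in> K \<and> u - h \<in> K}"
    by (rule kernel_overlap[OF a]) (rule that)
  obtain M where M: "\<And>h. h \<in> cbox 0 (1 :: real ^ 'n) \<Longrightarrow> norm h \<le> M"
    using bounded_cbox[of 0 "1 :: real ^ 'n"] unfolding bounded_iff by blast
  \<comment> \<open>After \<open>N\<close> halvings every vector of the unit cube is shorter than
    \<open>\<epsilon>\<close>, so \<open>N\<close> doublings extend the bound on short increments to
    the whole cube.\<close>
  obtain N :: nat where N: "M / \<epsilon> < 2 ^ N" using real_arch_pow[of 2 "M / \<epsilon>"] by auto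
  \<comment> \<open>The factors come from the \<open>N\<close> doublings, from averaging over the
    overlap of \<open>K\<close> with its translate, and from the passage from increments to the
    quadratic form.\<close>
  define C where "C = 6 ^ N * (4 / (\<delta> * m)) * (2 / \<alpha>1)"
  have C: "C > 0" using pos alpha1_pos by (simp add: C_def)
  show ?thesis
  proof (rule that[of "2 / C"])
    show "2 / C > 0" using C by simp
    fix v :: "real ^ 'n \<Rightarrow> real" assume v: "torus_L2 v" and mean: "(\<integral>x. v x \<partial>torus) = 0"
    note [measurable] = torus_L2_measurable[OF v]
    have [measurable]: "a \<in> borel_measurable borel" "incr v \<in> borel_measurable borel"
      using a by (auto dest: borel_measurable_integrable simp: incr_def[abs_def])
    define I where "I = (\<integral>z. a z * incr v z \<partial>lborel)"
    note energy = gen_energy[OF a(1,2) even v]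
    define g where "g = (\<lambda>u. indicator K u * incr v u)"
    have g_le: "g u \<le> a u * incr v u / \<delta>" for u
    proof (cases "u \<in> K")
      case True
      hence "\<delta> * incr v u \<le> a u * incr v u" using a_ge by (intro mult_right_mono) auto
      thus ?thesis using True pos by (simp add: g_def field_simps)
    qed (use a(2) pos in \<open>simp add: g_def\<close>)
    have g: "integrable lborel g"
    proof (rule Bochner_Integration.integrable_bound)
      show "integrable lborel (\<lambda>u. a u * incr v u / \<delta>)" using energy(1) by simp
      show "g \<in> borel_measurable lborel" unfolding g_def by measurable
      have "0 \<le> g u" for u by (simp add: g_def)
      hence "norm (g u) \<le> norm (a u * incr v u / \<delta>)" for u
        using g_le[of u] unfolding real_norm_def by (metis abs_ge_self abs_of_nonneg order.trans)
      thus "AE u in lborel. norm (g u) \<le> norm (a u * incr v u / \<delta>)" by simp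
    qed
    have g': "integrable lborel (\<lambda>u. g (u - h))" for h
      using lborel_integrable_minus_iff[of g h] g by (auto dest: borel_measurable_integrable)
    have g_int: "(\<integral>u. g u \<partial>lborel) \<le> I / \<delta>"
      using integral_mono[OF g _ g_le] energy(1) by (simp add: I_def)
    \<comment> \<open>Each \<open>u\<close> in \<open>S\<close> writes \<open>h\<close> as the
      difference of two points \<open>u\<close> and \<open>u - h\<close> of \<open>K\<close>. The
      bound of \<open>incr_diff_le\<close> is integrated over \<open>S\<close>, which has measure at
      least \<open>m\<close>.\<close>
    have small: "incr v h \<le> 4 / (\<delta> * m) * I" if h: "norm h < \<epsilon>" for h
    proof -
      define S where "S = {u. u \<in> K \<and> u - h \<in> K}"
      have [measurable]: "S \<in> sets borel" unfolding S_def by measurable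
      have "m * incr v h \<le> measure lborel S * incr v h"
        using m[OF h] by (intro mult_right_mono) (auto simp: S_def)
      also have "\<dots> = (\<integral>u. indicator S u * incr v h \<partial>lborel)" by simp
      also have "\<dots> \<le> (\<integral>u. 2 * g u + 2 * g (u - h) \<partial>lborel)"
      proof (rule integral_mono)
        show "integrable lborel (\<lambda>u. indicator S u * incr v h)" using fin[OF h] by (simp add: S_def)
        show "integrable lborel (\<lambda>u. 2 * g u + 2 * g (u - h))" using g g' by simp
        show "indicator S u * incr v h \<le> 2 * g u + 2 * g (u - h)" for u
          using incr_diff_le[OF v, of u "u - h"] by (auto simp: S_def g_def split: split_indicator)
      qed
      also have "\<dots> = 4 * (\<integral>u. g u \<partial>lborel)"
        using g g' lborel_integral_minus[of g h] by (simp add: borel_measurable_integrable)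
      finally have "m * incr v h \<le> 4 * (I / \<delta>)" using g_int by linarith
      thus ?thesis using pos by (simp add: field_simps)
    qed
    have "incr v (- h) \<le> 6 ^ N * (4 / (\<delta> * m) * I)" if h: "h \<in> cbox 0 1" for h
    proof -
      have "norm (- h /\<^sub>R 2 ^ N) \<le> M / 2 ^ N" using M[OF h] by (simp add: field_simps)
      also have "\<dots> < \<epsilon>" using N pos by (simp add: field_simps)
      finally have *: "incr v (- h /\<^sub>R 2 ^ N) \<le> 4 / (\<delta> * m) * I" by (rule small)
      have "incr v (- h) = incr v (2 ^ N *\<^sub>R (- h /\<^sub>R 2 ^ N))" by simp
      also have "\<dots> \<le> 6 ^ N * incr v (- h /\<^sub>R 2 ^ N)" by (rule incr_doubling[OF v])
      also have "\<dots> \<le> 6 ^ N * (4 / (\<delta> * m) * I)" using * by (intro mult_left_mono) auto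
      finally show ?thesis .
    qed
    from torus_norm_le_incr[OF v mean this]
    have "2 * (torus_norm v)\<^sup>2 \<le> 6 ^ N * (4 / (\<delta> * m)) * I" by simp
    also have "\<dots> \<le> 6 ^ N * (4 / (\<delta> * m)) * (2 / \<alpha>1 * (\<integral>x. v x * gen a v x \<partial>torus))"
      using energy(2) alpha1_pos pos by (intro mult_left_mono) (auto simp: I_def field_simps)
    also have "\<dots> = C * (\<integral>x. v x * gen a v x \<partial>torus)" by (simp add: C_def)
    finally show "2 / C * (torus_norm v)\<^sup>2 \<le> (\<integral>x. v x * gen a v x \<partial>torus)"
      using C by (simp add: field_simps)
  qed
qed

end

section \<open>Coercive operators\<close>

lemma torus_L1_le_norm:
  assumes "torus_L2 f"
  shows "(\<integral>x. \<bar>f x\<bar> \<partial>torus) \<le> torus_norm f"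
  using torus_L1_le_L2[OF assms] by (rule_tac power2_le_imp_le) (auto simp: torus_norm_square)

lemma abs_integral_le_torus_norm:
  assumes "torus_L2 f"
  shows "\<bar>\<integral>x. f x \<partial>torus\<bar> \<le> torus_norm f"
  using torus_L1_le_norm[OF assms] integral_abs_bound[of torus f] by linarith

text \<open>Riesz-Fischer for geometrically decaying increments. As the torus has mass 1, the
  increments also sum up in L1, so the sequence converges at almost every point; Fatou's lemma then
  gives convergence in norm.\<close>

lemma torus_L2_complete:
  fixes F :: "nat \<Rightarrow> real ^ 'n \<Rightarrow> real"
  assumes F: "\<And>n. torus_L2 (F n)" and r: "0 \<le> r" "r < 1"
    and step: "\<And>n. torus_norm (\<lambda>x. F (Suc n) x - F n x) \<le> C * r ^ n"
  obtains f where "torus_L2 f" "(\<lambda>n. torus_norm (\<lambda>x. f x - F n x)) \<longlonglongrightarrow> 0"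
proof -
  have FL2: "torus_L2 (\<lambda>x. F m x - F n x)" for m n by (intro torus_L2_diff F)
  note [measurable] = F[THEN torus_L2_measurable]
  have C: "C \<ge> 0" using order.trans[OF torus_norm_nonneg step[of 0]] by simp
  have tail: "torus_norm (\<lambda>x. F (n + k) x - F n x) \<le> C / (1 - r) * r ^ n" for n k
  proof -
    \<comment> \<open>The induction needs the exact geometric sum; the bound \<open>tail\<close>
      itself is not preserved by adding a term.\<close>
    have "torus_norm (\<lambda>x. F (n + k) x - F n x) \<le> C / (1 - r) * (r ^ n - r ^ (n + k))"
    proof (induction k)
      case 0
      show ?case by (simp add: torus_norm_def)
    next
      case (Suc k)
      have "torus_norm (\<lambda>x. F (n + Suc k) x - F n x)
          \<le> torus_norm (\<lambda>x. F (Suc (n + k)) x - F (n + k) x) + torus_norm (\<lambda>x. F (n + k) x - F n x)"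
        using torus_norm_add[OF FL2 FL2, of "Suc (n + k)" "n + k" "n + k" n] by simp
      also have "\<dots> \<le> C * r ^ (n + k) + C / (1 - r) * (r ^ n - r ^ (n + k))"
        by (intro add_mono step Suc)
      also have "\<dots> = C / (1 - r) * (r ^ n - r ^ (n + Suc k))"
        using r by (simp add: field_simps)
      finally show ?case .
    qed
    also have "\<dots> \<le> C / (1 - r) * r ^ n" using C r by (intro mult_left_mono) auto
    finally show ?thesis .
  qed
  \<comment> \<open>\<open>lim\<close> is a total function, so \<open>f\<close> is Borel and
    periodic at every point, including those where the sequence diverges.\<close>
  define f where "f = (\<lambda>x. lim (\<lambda>n. F n x))"
  have f_meas [measurable]: "f \<in> borel_measurable borel" unfolding f_def by measurable
  have f_per: "lattice_periodic f"
    using F[THEN torus_L2_periodic] by (simp add: f_def lattice_periodic_def)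
  have nn_step: "(\<integral>\<^sup>+x. ennreal \<bar>F (Suc n) x - F n x\<bar> \<partial>torus) \<le> ennreal (C * r ^ n)" for n
  proof -
    have "(\<integral>\<^sup>+x. ennreal \<bar>F (Suc n) x - F n x\<bar> \<partial>torus) = ennreal (\<integral>x. \<bar>F (Suc n) x - F n x\<bar> \<partial>torus)"
      using torus_L2_integrable[OF FL2] by (intro nn_integral_eq_integral) auto
    also have "\<dots> \<le> ennreal (C * r ^ n)"
      by (intro ennreal_leI order.trans[OF torus_L1_le_norm[OF FL2] step])
    finally show ?thesis .
  qed
  have "(\<integral>\<^sup>+x. (\<Sum>n. ennreal \<bar>F (Suc n) x - F n x\<bar>) \<partial>torus) = (\<Sum>n. \<integral>\<^sup>+x. ennreal \<bar>F (Suc n) x - F n x\<bar> \<partial>torus)"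
    by (rule nn_integral_suminf) measurable
  also have "\<dots> \<le> (\<Sum>n. ennreal (C * r ^ n))" by (intro suminf_le nn_step) auto
  also have "\<dots> = ennreal (\<Sum>n. C * r ^ n)"
    using C r by (intro suminf_ennreal2) (auto intro: summable_mult summable_geometric)
  also have "\<dots> < \<infinity>" by simp
  finally have "(\<integral>\<^sup>+x. (\<Sum>n. ennreal \<bar>F (Suc n) x - F n x\<bar>) \<partial>torus) \<noteq> \<infinity>" by simp
  hence "AE x in torus. (\<Sum>n. ennreal \<bar>F (Suc n) x - F n x\<bar>) \<noteq> \<infinity>"
    by (intro nn_integral_PInf_AE) measurable
  hence conv: "AE x in torus. (\<lambda>n. F n x) \<longlonglongrightarrow> f x"
  proof eventually_elim
    case (elim x)
    hence "summable (\<lambda>n. \<bar>F (Suc n) x - F n x\<bar>)"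
      by (intro summable_suminf_not_top) auto
    hence "summable (\<lambda>n. F (Suc n) x - F n x)" by (rule summable_rabs_cancel)
    then obtain s where "(\<lambda>n. \<Sum>i<n. F (Suc i) x - F i x) \<longlonglongrightarrow> s"
      by (auto simp: summable_def sums_def)
    hence "(\<lambda>n. F n x - F 0 x) \<longlonglongrightarrow> s" by (simp only: sum_lessThan_telescope[of "\<lambda>n. F n x"])
    from tendsto_add[OF this tendsto_const[of "F 0 x"]] have "convergent (\<lambda>n. F n x)"
      by (auto simp: convergent_def)
    thus ?case by (simp add: f_def convergent_LIMSEQ_iff)
  qed
  define D where "D = C / (1 - r)"
  have D: "D \<ge> 0" using C r by (simp add: D_def)
  \<comment> \<open>Fatou's lemma along \<open>n + k\<close>, with the uniform bound
    \<open>tail\<close>; square integrability of \<open>f\<close> is a by-product.\<close>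
  have fF: "(\<integral>\<^sup>+x. ennreal ((f x - F n x)\<^sup>2) \<partial>torus) \<le> ennreal ((D * r ^ n)\<^sup>2)" for n
  proof -
    have "(\<integral>\<^sup>+x. ennreal ((f x - F n x)\<^sup>2) \<partial>torus) = (\<integral>\<^sup>+x. liminf (\<lambda>k. ennreal ((F (n + k) x - F n x)\<^sup>2)) \<partial>torus)"
    proof (rule nn_integral_cong_AE)
      show "AE x in torus. ennreal ((f x - F n x)\<^sup>2) = liminf (\<lambda>k. ennreal ((F (n + k) x - F n x)\<^sup>2))"
        using conv
      proof eventually_elim
        case (elim x)
        have "(\<lambda>k. F (k + n) x) \<longlonglongrightarrow> f x" by (rule LIMSEQ_ignore_initial_segment[OF elim])
        hence "(\<lambda>k. ennreal ((F (n + k) x - F n x)\<^sup>2)) \<longlonglongrightarrow> ennreal ((f x - F n x)\<^sup>2)"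
          by (intro tendsto_intros) (simp add: add.commute)
        from lim_imp_Liminf[OF _ this] show ?case by simp
      qed
    qed
    also have "\<dots> \<le> liminf (\<lambda>k. \<integral>\<^sup>+x. ennreal ((F (n + k) x - F n x)\<^sup>2) \<partial>torus)"
      by (rule nn_integral_liminf) measurable
    also have "\<dots> \<le> ennreal ((D * r ^ n)\<^sup>2)"
    proof (rule Liminf_le, simp, intro always_eventually allI)
      fix k
      have "(\<integral>\<^sup>+x. ennreal ((F (n + k) x - F n x)\<^sup>2) \<partial>torus) = ennreal ((torus_norm (\<lambda>x. F (n + k) x - F n x))\<^sup>2)"
        using torus_L2_square[OF FL2] unfolding torus_norm_square by (intro nn_integral_eq_integral) auto
      also have "\<dots> \<le> ennreal ((D * r ^ n)\<^sup>2)"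
        using tail[of n k] by (intro ennreal_leI power_mono) (auto simp: D_def)
      finally show "(\<integral>\<^sup>+x. ennreal ((F (n + k) x - F n x)\<^sup>2) \<partial>torus) \<le> ennreal ((D * r ^ n)\<^sup>2)" .
    qed
    finally show ?thesis .
  qed
  have fF_int: "integrable torus (\<lambda>x. (f x - F n x)\<^sup>2)" for n
  proof (rule integrableI_bounded)
    show "(\<integral>\<^sup>+x. ennreal (norm ((f x - F n x)\<^sup>2)) \<partial>torus) < \<infinity>"
      using order_le_less_trans[OF fF[of n]] by simp
  qed measurable
  have "lattice_periodic (\<lambda>x. f x - F n x)" for n
    using f_per F[THEN torus_L2_periodic] by (simp add: lattice_periodic_def)
  with fF_int have fFL2: "torus_L2 (\<lambda>x. f x - F n x)" for n
    by (simp add: torus_L2_iff)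
  show ?thesis
  proof (rule that)
    show "torus_L2 f" using torus_L2_add[OF fFL2[of 0] F[of 0]] by simp
    have "torus_norm (\<lambda>x. f x - F n x) \<le> D * r ^ n" for n
    proof (rule power2_le_imp_le)
      have "ennreal ((torus_norm (\<lambda>x. f x - F n x))\<^sup>2) = (\<integral>\<^sup>+x. ennreal ((f x - F n x)\<^sup>2) \<partial>torus)"
        unfolding torus_norm_square using fF_int by (intro nn_integral_eq_integral[symmetric]) auto
      also have "\<dots> \<le> ennreal ((D * r ^ n)\<^sup>2)" by (rule fF)
      finally show "(torus_norm (\<lambda>x. f x - F n x))\<^sup>2 \<le> (D * r ^ n)\<^sup>2" by (simp add: ennreal_le_iff)
    qed (use D r in simp)
    moreover have "(\<lambda>n. D * r ^ n) \<longlonglongrightarrow> 0"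
      using r by (intro tendsto_mult_right_zero LIMSEQ_realpow_zero) auto
    ultimately show "(\<lambda>n. torus_norm (\<lambda>x. f x - F n x)) \<longlonglongrightarrow> 0"
      by (rule_tac tendsto_sandwich[OF _ _ tendsto_const]) auto
  qed
qed

text \<open>The Lax-Milgram theorem by relaxation,
  \<open>F (n + 1) = F n - \<tau> (B (F n) - g)\<close>, without symmetry of \<open>B\<close>. Since
  \<open>B\<close> acts on functions and is linear only almost everywhere, the increments of one
  sequence are estimated directly rather than through a contraction on a quotient space.\<close>

lemma coercive_imp_solvable:
  fixes B :: "(real ^ 'n \<Rightarrow> real) \<Rightarrow> real ^ 'n \<Rightarrow> real"
  assumes B_L2: "\<And>f. torus_L2 f \<Longrightarrow> torus_L2 (B f)"
    and B_lin: "\<And>f g c. torus_L2 f \<Longrightarrow> torus_L2 g \<Longrightarrow> AE x in torus. B (\<lambda>x. f x + c * g x) x = B f x + c * B g x"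
    and B_bd: "\<And>f. torus_L2 f \<Longrightarrow> torus_norm (B f) \<le> \<Lambda> * torus_norm f"
    and B_mean: "\<And>f. torus_L2 f \<Longrightarrow> (\<integral>x. B f x \<partial>torus) = 0"
    and coercive: "\<And>f. torus_L2 f \<Longrightarrow> (\<integral>x. f x \<partial>torus) = 0 \<Longrightarrow> c * (torus_norm f)\<^sup>2 \<le> (\<integral>x. f x * B f x \<partial>torus)"
    and c: "c > 0" and g: "torus_L2 g" "(\<integral>x. g x \<partial>torus) = 0"
  obtains f where "torus_L2 f" "(\<integral>x. f x \<partial>torus) = 0" "AE x in torus. B f x = g x"
proof -
  \<comment> \<open>The second argument of the maximum ensures \<open>c < M\<close>, so that the
    contraction factor \<open>q\<close> lies between 0 and 1.\<close>
  define M where "M = max \<Lambda> (2 * c)"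
  have M: "M > 0" "c < M" using c by (auto simp: M_def)
  have B_M: "torus_norm (B f) \<le> M * torus_norm f" if "torus_L2 f" for f
    using B_bd[OF that] mult_right_mono[OF max.cobounded1 torus_norm_nonneg] unfolding M_def by (rule order.trans)
  \<comment> \<open>This step size minimises
    \<open>1 - 2 * \<tau> * c + \<tau>\<^sup>2 * M\<^sup>2\<close>, and the minimum is
    \<open>1 - (c / M)\<^sup>2\<close>, named \<open>q\<close> below.\<close>
  define \<tau> where "\<tau> = c / M\<^sup>2"
  have \<tau>: "\<tau> > 0" using c M by (simp add: \<tau>_def)
  define F where "F = rec_nat (\<lambda>_. 0) (\<lambda>_ f x. f x - \<tau> * (B f x - g x))"
  have F_0: "F 0 = (\<lambda>_. 0)" and F_Suc: "F (Suc n) = (\<lambda>x. F n x - \<tau> * (B (F n) x - g x))" for n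
    by (simp_all add: F_def)
  have FL2: "torus_L2 (F n)" for n
    by (induction n) (auto simp: F_0 F_Suc intro!: torus_L2_diff torus_L2_cmult B_L2 g)
  \<comment> \<open>The iterates stay in the mean-zero functions, the only place where coercivity is
    available.\<close>
  have F_mean: "(\<integral>x. F n x \<partial>torus) = 0" for n
    using B_mean[OF FL2] g(2) torus_L2_integrable[OF FL2] torus_L2_integrable[OF B_L2[OF FL2]] torus_L2_integrable[OF g(1)]
    by (induction n) (auto simp: F_0 F_Suc)
  define d where "d = (\<lambda>n x. F (Suc n) x - F n x)"
  have dL2: "torus_L2 (d n)" for n unfolding d_def by (intro torus_L2_diff FL2)
  have d_eq: "d n x = - \<tau> * (B (F n) x - g x)" for n x by (simp add: d_def F_Suc)
  have d_mean: "(\<integral>x. d n x \<partial>torus) = 0" for n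
    using F_mean torus_L2_integrable[OF FL2] by (simp add: d_def)
  define q where "q = 1 - (c / M)\<^sup>2"
  have q: "0 \<le> q" "q < 1" using c M by (auto simp: q_def power_le_one_iff abs_le_iff)
  have contr: "torus_norm (d (Suc n)) \<le> sqrt q * torus_norm (d n)" for n
  proof -
    have L2: "torus_L2 (B (d n))" "torus_L2 (\<lambda>x. d n x - \<tau> * B (d n) x)"
      by (intro torus_L2_diff torus_L2_cmult B_L2 dL2)+
    have "AE x in torus. d (Suc n) x = d n x - \<tau> * B (d n) x"
      using B_lin[OF FL2[of n] dL2[of n], of 1]
    proof eventually_elim
      case (elim x)
      have "(\<lambda>x. F n x + 1 * d n x) = F (Suc n)" by (simp add: d_def)
      with elim have "B (F (Suc n)) x = B (F n) x + B (d n) x" by simp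
      thus ?case by (simp add: d_eq algebra_simps)
    qed
    hence "torus_norm (d (Suc n)) = torus_norm (\<lambda>x. d n x - \<tau> * B (d n) x)"
      by (rule torus_norm_cong_AE[OF dL2 L2(2)])
    also have "\<dots> \<le> sqrt q * torus_norm (d n)"
    proof (rule power2_le_imp_le)
      have "(torus_norm (\<lambda>x. d n x - \<tau> * B (d n) x))\<^sup>2
          = (\<integral>x. (d n x)\<^sup>2 - 2 * \<tau> * (d n x * B (d n) x) + \<tau>\<^sup>2 * (B (d n) x)\<^sup>2 \<partial>torus)"
        unfolding torus_norm_square
        by (intro Bochner_Integration.integral_cong) (auto simp: power2_diff power_mult_distrib)
      also have "\<dots> = (torus_norm (d n))\<^sup>2 - 2 * \<tau> * (\<integral>x. d n x * B (d n) x \<partial>torus) + \<tau>\<^sup>2 * (torus_norm (B (d n)))\<^sup>2"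
        using torus_L2_square[OF dL2] torus_L2_square[OF L2(1)] torus_L2_mult[OF dL2 L2(1)]
        by (simp add: torus_norm_square)
      also have "\<dots> \<le> (torus_norm (d n))\<^sup>2 - 2 * \<tau> * (c * (torus_norm (d n))\<^sup>2) + \<tau>\<^sup>2 * (M * torus_norm (d n))\<^sup>2"
        using coercive[OF dL2 d_mean, of n] B_M[OF dL2, of n] \<tau>
        by (intro add_mono diff_mono mult_left_mono power_mono) auto
      also have "\<dots> = q * (torus_norm (d n))\<^sup>2"
        using M by (simp add: q_def \<tau>_def power_mult_distrib power_divide field_simps power2_eq_square)
      also have "\<dots> = (sqrt q * torus_norm (d n))\<^sup>2" using q by (simp add: power_mult_distrib)
      finally show "(torus_norm (\<lambda>x. d n x - \<tau> * B (d n) x))\<^sup>2 \<le> (sqrt q * torus_norm (d n))\<^sup>2" .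
    qed (use q in simp)
    finally show ?thesis .
  qed
  have geom: "torus_norm (d n) \<le> torus_norm (d 0) * sqrt q ^ n" for n
  proof (induction n)
    case (Suc n)
    have "torus_norm (d (Suc n)) \<le> sqrt q * torus_norm (d n)" by (rule contr)
    also have "\<dots> \<le> sqrt q * (torus_norm (d 0) * sqrt q ^ n)" using Suc q by (intro mult_left_mono) auto
    finally show ?case by (simp add: mult_ac)
  qed simp
  have sq: "0 \<le> sqrt q" "sqrt q < 1" using q by (auto simp: real_sqrt_lt_1_iff)
  obtain f where f: "torus_L2 f" "(\<lambda>n. torus_norm (\<lambda>x. f x - F n x)) \<longlonglongrightarrow> 0"
    by (rule torus_L2_complete[OF FL2 sq geom[unfolded d_def]]) (rule that)
  have d_lim: "(\<lambda>n. torus_norm (d n)) \<longlonglongrightarrow> 0"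
  proof (rule tendsto_sandwich[OF _ _ tendsto_const])
    show "(\<lambda>n. torus_norm (d 0) * sqrt q ^ n) \<longlonglongrightarrow> 0"
      using sq by (intro tendsto_mult_right_zero LIMSEQ_realpow_zero) auto
  qed (use geom in auto)
  have fFL2: "torus_L2 (\<lambda>x. f x - F n x)" for n by (intro torus_L2_diff f FL2)
  have BgL2: "torus_L2 (\<lambda>x. B f x - g x)" by (intro torus_L2_diff B_L2 f g)
  \<comment> \<open>The residual of \<open>F n\<close> is \<open>- d n / \<tau>\<close>, so the
    residual of \<open>f\<close> is \<open>B\<close> applied to \<open>f - F n\<close> minus
    \<open>d n / \<tau>\<close>; both terms tend to 0.\<close>
  have bound: "torus_norm (\<lambda>x. B f x - g x) \<le> M * torus_norm (\<lambda>x. f x - F n x) + 1 / \<tau> * torus_norm (d n)" for n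
  proof -
    have L2: "torus_L2 (B (\<lambda>x. f x - F n x))" "torus_L2 (\<lambda>x. (1 / \<tau>) * d n x)"
      by (intro B_L2 fFL2 torus_L2_cmult dL2)+
    have "AE x in torus. B f x - g x = B (\<lambda>x. f x - F n x) x - (1 / \<tau>) * d n x"
      using B_lin[OF f(1) FL2[of n], of "-1"] by eventually_elim (use \<tau> in \<open>simp add: d_eq\<close>)
    hence "torus_norm (\<lambda>x. B f x - g x) = torus_norm (\<lambda>x. B (\<lambda>x. f x - F n x) x - (1 / \<tau>) * d n x)"
      by (rule torus_norm_cong_AE[OF BgL2 torus_L2_diff[OF L2]])
    also have "\<dots> \<le> torus_norm (B (\<lambda>x. f x - F n x)) + torus_norm (\<lambda>x. (1 / \<tau>) * d n x)"
      by (rule torus_norm_diff[OF L2])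
    also have "\<dots> \<le> M * torus_norm (\<lambda>x. f x - F n x) + 1 / \<tau> * torus_norm (d n)"
      unfolding torus_norm_cmult using B_M[OF fFL2, of n] \<tau> by simp
    finally show ?thesis .
  qed
  have "(\<lambda>n. M * torus_norm (\<lambda>x. f x - F n x) + 1 / \<tau> * torus_norm (d n)) \<longlonglongrightarrow> M * 0 + 1 / \<tau> * 0"
    by (intro tendsto_intros f d_lim)
  from LIMSEQ_le_const[OF this] bound have "torus_norm (\<lambda>x. B f x - g x) \<le> 0" by auto
  hence "torus_norm (\<lambda>x. B f x - g x) = 0" using torus_norm_nonneg by (rule antisym)
  hence "AE x in torus. B f x - g x = 0" by (simp add: torus_norm_eq_0_iff[OF BgL2])
  hence sol: "AE x in torus. B f x = g x" by eventually_elim simp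
  have "\<bar>\<integral>x. f x \<partial>torus\<bar> \<le> torus_norm (\<lambda>x. f x - F n x)" for n
    using abs_integral_le_torus_norm[OF fFL2, of n] F_mean torus_L2_integrable[OF f(1)] torus_L2_integrable[OF FL2]
    by simp
  hence "\<bar>\<integral>x. f x \<partial>torus\<bar> \<le> 0" by (intro LIMSEQ_le_const[OF f(2)]) auto
  hence "(\<integral>x. f x \<partial>torus) = 0" by simp
  with f sol show ?thesis by (intro that)
qed

section \<open>Density corrections\<close>

lemma AE_torus_eq_iff:
  assumes "lattice_periodic f" "lattice_periodic g"
  shows "(AE x in torus. f x = g x) \<longleftrightarrow> (AE x in lborel. f x = g x)"
  using AE_lborel_if_AE_torus[of "\<lambda>x. f x = g x"] AE_torus_if_AE_lborel[of "\<lambda>x. f x = g x"] assms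
  by (auto simp: lattice_periodic_def)

lemma torus_norm_1: "torus_norm (\<lambda>_. 1 :: real) = 1"
  by (simp add: torus_norm_def)

context periodic_coefficient
begin

lemma gen_periodic: "lattice_periodic v \<Longrightarrow> lattice_periodic (gen p v)"
  using conv_periodic[of v "\<lambda>z. p (- z)"] conv_periodic[of "\<lambda>_. 1" p]
  by (simp add: gen_def lattice_periodic_def)

lemma conv_eq:
  assumes [measurable]: "p \<in> borel_measurable borel" "f \<in> borel_measurable borel"
  shows "(\<integral>q. p (x - q) * \<mu> x q * f q \<partial>lborel) = conv p f x"
  using lborel_integral_reflect[of "\<lambda>z. p z * \<mu> x (x - z) * f (x - z)" x] by (simp add: conv_def)

lemma conv_1_eq:
  assumes "p \<in> borel_measurable borel"
  shows "(\<integral>q. p (x - q) * \<mu> x q \<partial>lborel) = conv p (\<lambda>_. 1) x"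
  using conv_eq[OF assms, of "\<lambda>_. 1"] by simp

lemma is_invariant_density_iff:
  assumes p: "integrable lborel p"
  shows "is_invariant_density p \<mu> v \<longleftrightarrow>
    torus_L2 v \<and> (\<integral>x. v x \<partial>torus) = 1 \<and> (AE x in torus. gen p v x = 0)"
proof (cases "torus_L2 v")
  case True
  have meas [measurable]: "p \<in> borel_measurable borel" "v \<in> borel_measurable borel"
    using p True by (auto dest: borel_measurable_integrable torus_L2_measurable)
  have 1: "(\<integral>q. p (x - q) * \<mu> x q \<partial>lborel) = conv p (\<lambda>_. 1) x" for x by (rule conv_1_eq) measurable
  have 2: "(\<integral>q. p (q - x) * \<mu> q x * v q \<partial>lborel) = conv (\<lambda>z. p (- z)) v x" for x
    using conv_eq[of "\<lambda>z. p (- z)" v x] by (simp add: mu_sym[of _ x])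
  have "(AE x in torus. gen p v x = 0) \<longleftrightarrow> (AE x in lborel. gen p v x = 0)"
    using gen_periodic[OF torus_L2_periodic[OF True]] by (intro AE_torus_eq_iff) (auto simp: lattice_periodic_def)
  also have "\<dots> \<longleftrightarrow> (AE x in lborel. conv (\<lambda>z. p (- z)) v x = v x * conv p (\<lambda>_. 1) x)"
    by (intro AE_cong) (auto simp: gen_def)
  finally show ?thesis
    using True by (simp add: is_invariant_density_def torus_integral_eq 1 2)
qed (simp add: is_invariant_density_def)

text \<open>For an even kernel the outflow and inflow integrals use the same kernel and combine into
  one integral of differences, the form in which the equations for the correction and the corrector
  are stated. It can be split only where the inflow integral exists, hence almost
  everywhere.\<close>

lemma
  assumes p: "integrable lborel p" and even: "\<And>z. p (- z) = p z" and v: "torus_L2 v"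
  shows AE_integrable_diff: "AE x in lborel. integrable lborel (\<lambda>q. p (x - q) * \<mu> x q * (v q - v x))"
    and AE_integral_diff_eq_gen: "AE x in lborel. (\<integral>q. p (x - q) * \<mu> x q * (v q - v x) \<partial>lborel) = - gen p v x"
proof -
  have [measurable]: "p \<in> borel_measurable borel" "v \<in> borel_measurable borel"
    using p v by (auto dest: borel_measurable_integrable torus_L2_measurable)
  have ae: "AE x in lborel. integrable lborel (\<lambda>z. p z * \<mu> x (x - z) * v (x - z))"
  proof (rule AE_lborel_if_AE_torus[OF AE_integrable_conv[OF p torus_L2_integrable[OF v] torus_L2_periodic[OF v]]])
    fix k x :: "real ^ 'n" assume "k \<in> int_lattice" and *: "integrable lborel (\<lambda>z. p z * \<mu> (x + k) (x + k - z) * v (x + k - z))"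
    thus "integrable lborel (\<lambda>z. p z * \<mu> x (x - z) * v (x - z))"
      using mu_shift[of k x "x - _"] torus_L2_periodic[OF v]
      by (simp add: lattice_periodic_def diff_add_eq[symmetric])
  qed
  have split: "p z * \<mu> x (x - z) * (v (x - z) - v x) = p z * \<mu> x (x - z) * v (x - z) - p z * \<mu> x (x - z) * v x" for x z
    by (simp add: right_diff_distrib)
  show "AE x in lborel. integrable lborel (\<lambda>q. p (x - q) * \<mu> x q * (v q - v x))"
    using ae
  proof eventually_elim
    case (elim x)
    hence "integrable lborel (\<lambda>z. p z * \<mu> x (x - z) * (v (x - z) - v x))"
      using integrable_kernel[OF p, of x] by (simp add: split)
    thus ?case
      using lborel_integrable_reflect_iff[of "\<lambda>z. p z * \<mu> x (x - z) * (v (x - z) - v x)" x] by simp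
  qed
  show "AE x in lborel. (\<integral>q. p (x - q) * \<mu> x q * (v q - v x) \<partial>lborel) = - gen p v x"
    using ae
  proof eventually_elim
    case (elim x)
    have "(\<integral>q. p (x - q) * \<mu> x q * (v q - v x) \<partial>lborel) = (\<integral>z. p z * \<mu> x (x - z) * (v (x - z) - v x) \<partial>lborel)"
      using lborel_integral_reflect[of "\<lambda>z. p z * \<mu> x (x - z) * (v (x - z) - v x)" x] by simp
    also have "\<dots> = - gen p v x"
      using elim integrable_kernel[OF p, of x] by (simp add: split gen_def even conv_def)
    finally show ?case .
  qed
qed

end

section \<open>The even kernel: coercivity, perturbation and solvability\<close>

locale symmetric_kernel = periodic_coefficient \<mu> \<alpha>1 \<alpha>2
  for \<mu> :: "real ^ 'n \<Rightarrow> real ^ 'n \<Rightarrow> real" and \<alpha>1 \<alpha>2 :: real +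
  fixes a :: "real ^ 'n \<Rightarrow> real"
  assumes a_integrable: "integrable lborel a" and a_nonneg: "0 \<le> a z"
    and a_pos: "(\<integral>z. a z \<partial>lborel) > 0" and a_even: "a (- z) = a z"
    and a_moment2: "integrable lborel (\<lambda>z. (norm z)\<^sup>2 * a z)"
begin

text \<open>One coercivity constant is fixed once for the given \<open>a\<close> and \<mu>, so that
  all later bounds are uniform in the perturbation.\<close>

definition gap :: real where
  "gap = (SOME c. c > 0 \<and> (\<forall>v. torus_L2 v \<longrightarrow> (\<integral>x. v x \<partial>torus) = 0 \<longrightarrow>
     c * (torus_norm v)\<^sup>2 \<le> (\<integral>x. v x * gen a v x \<partial>torus)))"

lemma gap_pos: "gap > 0"
  and gap_coercive: "torus_L2 v \<Longrightarrow> (\<integral>x. v x \<partial>torus) = 0 \<Longrightarrow>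
     gap * (torus_norm v)\<^sup>2 \<le> (\<integral>x. v x * gen a v x \<partial>torus)"
proof -
  have "gap > 0 \<and> (\<forall>v. torus_L2 v \<longrightarrow> (\<integral>x. v x \<partial>torus) = 0 \<longrightarrow>
     gap * (torus_norm v)\<^sup>2 \<le> (\<integral>x. v x * gen a v x \<partial>torus))"
    unfolding gap_def
    by (rule someI_ex, rule gen_coercive[OF a_integrable a_nonneg a_pos a_even]) blast
  thus "gap > 0" and "torus_L2 v \<Longrightarrow> (\<integral>x. v x \<partial>torus) = 0 \<Longrightarrow>
     gap * (torus_norm v)\<^sup>2 \<le> (\<integral>x. v x * gen a v x \<partial>torus)" by blast+
qed

lemma a_measurable [measurable]: "a \<in> borel_measurable borel"
  using a_integrable by (auto dest: borel_measurable_integrable)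

lemma a_moment1: "integrable lborel (\<lambda>z. norm z * a z)"
proof (rule Bochner_Integration.integrable_bound)
  show "integrable lborel (\<lambda>z. a z + (norm z)\<^sup>2 * a z)" using a_integrable a_moment2 by simp
  have "norm z \<le> 1 + (norm z)\<^sup>2" for z :: "real ^ 'n"
    using zero_le_power2[of "norm z - 1"] norm_ge_zero[of z] unfolding power2_diff power_one by linarith
  hence "norm z * a z \<le> (1 + (norm z)\<^sup>2) * a z" for z
    using a_nonneg by (intro mult_right_mono) auto
  thus "AE z in lborel. norm (norm z * a z) \<le> norm (a z + (norm z)\<^sup>2 * a z)"
    using a_nonneg by (simp add: abs_mult distrib_right)
qed measurable

text \<open>Cauchy-Schwarz bounds the quadratic form by the product of the two norms, and one factor
  \<open>torus_norm v\<close> cancels. All a priori estimates take this form.\<close>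

lemma coercive_norm_le:
  assumes v: "torus_L2 v" and p: "integrable lborel p"
    and coercive: "c * (torus_norm v)\<^sup>2 \<le> (\<integral>x. v x * gen p v x \<partial>torus)"
  shows "c * torus_norm v \<le> torus_norm (gen p v)"
proof (cases "torus_norm v = 0")
  case False
  hence pos: "torus_norm v > 0" using torus_norm_nonneg[of v] by linarith
  have "(c * torus_norm v) * torus_norm v \<le> torus_norm (gen p v) * torus_norm v"
    using coercive torus_inner_le_norm[OF v torus_L2_gen[OF p v]]
    by (simp add: power2_eq_square mult_ac)
  thus ?thesis using pos by simp
qed simp

text \<open>The quadratic form of \<open>gen e\<close> is at most 2 \<alpha>2 times the L1 norm of
  \<open>e\<close> times the squared norm of \<open>v\<close>, which the smallness condition keeps
  below half of the gap.\<close>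

lemma perturbed_coercive:
  assumes e: "integrable lborel e" and small: "4 * \<alpha>2 * (\<integral>z. \<bar>e z\<bar> \<partial>lborel) \<le> gap"
    and v: "torus_L2 v" "(\<integral>x. v x \<partial>torus) = 0"
  shows "gap / 2 * (torus_norm v)\<^sup>2 \<le> (\<integral>x. v x * gen (\<lambda>z. a z + e z) v x \<partial>torus)"
proof -
  have ae: "integrable lborel (\<lambda>z. a z + e z)" using a_integrable e by simp
  note L2 = torus_L2_gen[OF e v(1)] torus_L2_gen[OF a_integrable v(1)] torus_L2_gen[OF ae v(1)]
  note [measurable] = v(1)[THEN torus_L2_measurable] L2[THEN torus_L2_measurable]
  have "(\<integral>x. v x * gen (\<lambda>z. a z + e z) v x \<partial>torus) = (\<integral>x. v x * gen a v x + v x * gen e v x \<partial>torus)"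
  proof (rule integral_cong_AE)
    show "AE x in torus. v x * gen (\<lambda>z. a z + e z) v x = v x * gen a v x + v x * gen e v x"
      using gen_add_kernel[OF a_integrable e v(1)] by eventually_elim (simp add: distrib_left)
  qed measurable
  also have "\<dots> = (\<integral>x. v x * gen a v x \<partial>torus) + (\<integral>x. v x * gen e v x \<partial>torus)"
    using torus_L2_mult[OF v(1) L2(1)] torus_L2_mult[OF v(1) L2(2)] by simp
  finally have eq: "(\<integral>x. v x * gen (\<lambda>z. a z + e z) v x \<partial>torus) =
    (\<integral>x. v x * gen a v x \<partial>torus) + (\<integral>x. v x * gen e v x \<partial>torus)" .
  have "\<bar>\<integral>x. v x * gen e v x \<partial>torus\<bar> \<le> torus_norm v * torus_norm (gen e v)"
    by (rule torus_inner_le_norm[OF v(1) L2(1)])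
  also have "\<dots> \<le> torus_norm v * (2 * \<alpha>2 * (\<integral>z. \<bar>e z\<bar> \<partial>lborel) * torus_norm v)"
    by (intro mult_left_mono torus_norm_gen[OF e v(1)]) simp
  also have "\<dots> = 2 * \<alpha>2 * (\<integral>z. \<bar>e z\<bar> \<partial>lborel) * (torus_norm v)\<^sup>2"
    by (simp add: power2_eq_square)
  also have "\<dots> \<le> gap / 2 * (torus_norm v)\<^sup>2" using small by (intro mult_right_mono) auto
  finally show ?thesis using gap_coercive[OF v] unfolding eq by linarith
qed

lemma gen_solvable:
  assumes e: "integrable lborel e" and small: "4 * \<alpha>2 * (\<integral>z. \<bar>e z\<bar> \<partial>lborel) \<le> gap"
    and g: "torus_L2 g" "(\<integral>x. g x \<partial>torus) = 0"
  obtains v where "torus_L2 v" "(\<integral>x. v x \<partial>torus) = 0" "AE x in torus. gen (\<lambda>z. a z + e z) v x = g x"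
proof -
  have ae: "integrable lborel (\<lambda>z. a z + e z)" using a_integrable e by simp
  show ?thesis
    by (rule coercive_imp_solvable[OF torus_L2_gen[OF ae] gen_add_cmult[OF ae] torus_norm_gen[OF ae]
      integral_gen[OF ae] perturbed_coercive[OF e small] _ g]) (use gap_pos that in auto)
qed

text \<open>The adjoint identity sends the mean to its own negative. This is the compatibility
  condition that makes the correction equation solvable, and also the reason why the even kernel has
  no drift.\<close>

lemma conv_odd_mean:
  assumes p: "integrable lborel p" and odd: "\<And>z. p (- z) = - p z"
  shows "(\<integral>x. conv p (\<lambda>_. 1) x \<partial>torus) = 0"
  using integral_conv(2)[OF p, of "\<lambda>_. 1"] by (simp add: odd conv_uminus_kernel lattice_periodic_def)

text \<open>Equation (B) for one component of \<open>c\<close>; its left-hand side is \<open>- gen a \<psi>\<close>, whence the sign.\<close>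
definition is_corr :: "(real ^ 'n \<Rightarrow> real) \<Rightarrow> (real ^ 'n \<Rightarrow> real) \<Rightarrow> bool" where
  "is_corr e \<psi> \<longleftrightarrow> torus_L2 \<psi> \<and> (\<integral>x. \<psi> x \<partial>torus) = 0 \<and>
     (AE x in torus. gen a \<psi> x = - 2 * conv e (\<lambda>_. 1) x)"

lemma is_corr_ex:
  assumes e: "integrable lborel e" and odd: "\<And>z. e (- z) = - e z"
  shows "\<exists>\<psi>. is_corr e \<psi>"
proof -
  have L2: "torus_L2 (\<lambda>x. - 2 * conv e (\<lambda>_. 1) x)" by (intro torus_L2_cmult torus_L2_conv_1 e)
  have mean: "(\<integral>x. - 2 * conv e (\<lambda>_. 1) x \<partial>torus) = 0" using conv_odd_mean[OF e odd] by simp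
  show ?thesis
    by (rule gen_solvable[of "\<lambda>_. 0", OF _ _ L2 mean]) (use gap_pos in \<open>auto simp: is_corr_def\<close>)
qed

lemma gen_diff:
  assumes p: "integrable lborel p" and f: "torus_L2 f" and g: "torus_L2 g"
  shows "AE x in torus. gen p (\<lambda>x. f x - g x) x = gen p f x - gen p g x"
  using gen_add_cmult[OF p f g, of "-1"] by simp

lemma gap_norm_le:
  assumes "torus_L2 v" "(\<integral>x. v x \<partial>torus) = 0"
  shows "gap * torus_norm v \<le> torus_norm (gen a v)"
  by (rule coercive_norm_le[OF assms(1) a_integrable gap_coercive[OF assms]])

lemma torus_norm_conv_1:
  assumes "integrable lborel e"
  shows "torus_norm (conv e (\<lambda>_. 1)) \<le> \<alpha>2 * (\<integral>z. \<bar>e z\<bar> \<partial>lborel)"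
  using torus_norm_conv[OF assms, of "\<lambda>_. 1"] by (simp add: torus_norm_1)

text \<open>Corrections depend linearly on the kernel. This serves twice: to assemble the correction
  for \<open>l \<bullet> c\<close> from those of the components of \<open>c\<close>, and to compare
  the corrections for two kernels.\<close>

lemma is_corr_diff:
  assumes e: "integrable lborel e" "integrable lborel e'" and psi: "is_corr e \<psi>" "is_corr e' \<psi>'"
  shows "is_corr (\<lambda>z. e z - e' z) (\<lambda>x. \<psi> x - \<psi>' x)"
proof -
  have L2: "torus_L2 \<psi>" "torus_L2 \<psi>'" using psi by (auto simp: is_corr_def)
  have *: "AE x in torus. gen a \<psi> x = - 2 * conv e (\<lambda>_. 1) x" "AE x in torus. gen a \<psi>' x = - 2 * conv e' (\<lambda>_. 1) x"
    using psi by (auto simp: is_corr_def)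
  have **: "conv (\<lambda>z. e z - e' z) (\<lambda>_. 1) x = conv e (\<lambda>_. 1) x - conv e' (\<lambda>_. 1) x" for x
    using conv_add_kernel_1[of e "\<lambda>z. - e' z" x] e by (simp add: conv_uminus_kernel)
  have "AE x in torus. gen a (\<lambda>x. \<psi> x - \<psi>' x) x = - 2 * conv (\<lambda>z. e z - e' z) (\<lambda>_. 1) x"
    using gen_diff[OF a_integrable L2] * by eventually_elim (simp add: **)
  thus ?thesis using psi L2[THEN torus_L2_integrable] by (simp add: is_corr_def torus_L2_diff)
qed

lemma is_corr_cmult:
  assumes psi: "is_corr e \<psi>"
  shows "is_corr (\<lambda>z. c * e z) (\<lambda>x. c * \<psi> x)"
proof -
  have L2: "torus_L2 \<psi>" using psi by (auto simp: is_corr_def)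
  have "AE x in torus. gen a \<psi> x = - 2 * conv e (\<lambda>_. 1) x" using psi by (auto simp: is_corr_def)
  \<comment> \<open>Homogeneity is additivity with first summand the constant 0.\<close>
  moreover have "AE x in torus. gen a (\<lambda>x. c * \<psi> x) x = c * gen a \<psi> x"
    using gen_add_cmult[OF a_integrable torus_L2_const L2, of 0 c] by (simp add: gen_const)
  ultimately have "AE x in torus. gen a (\<lambda>x. c * \<psi> x) x = - 2 * conv (\<lambda>z. c * e z) (\<lambda>_. 1) x"
    by eventually_elim (simp add: conv_cmult_kernel)
  thus ?thesis using psi L2 by (simp add: is_corr_def torus_L2_cmult)
qed

lemma is_corr_add:
  assumes e: "integrable lborel e" "integrable lborel e'" and psi: "is_corr e \<psi>" "is_corr e' \<psi>'"
  shows "is_corr (\<lambda>z. e z + e' z) (\<lambda>x. \<psi> x + \<psi>' x)"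
  using is_corr_diff[OF e(1) _ psi(1) is_corr_cmult[OF psi(2), of "-1"]] e(2) by simp

lemma is_corr_zero: "is_corr (\<lambda>_. 0) (\<lambda>_. 0)"
  by (simp add: is_corr_def gen_const conv_def)

lemma is_corr_sum:
  assumes "\<And>j. j \<in> J \<Longrightarrow> integrable lborel (e j)" "\<And>j. j \<in> J \<Longrightarrow> is_corr (e j) (\<psi> j)"
  shows "is_corr (\<lambda>z. \<Sum>j\<in>J. e j z) (\<lambda>x. \<Sum>j\<in>J. \<psi> j x)"
  using assms
proof (induction J rule: infinite_finite_induct)
  case (insert j J)
  have "is_corr (\<lambda>z. e j z + (\<Sum>j\<in>J. e j z)) (\<lambda>x. \<psi> j x + (\<Sum>j\<in>J. \<psi> j x))"
    using insert by (intro is_corr_add) auto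
  thus ?case using insert by simp
qed (simp_all add: is_corr_zero)

text \<open>The a priori estimate applied to a right-hand side of size 2 \<alpha>2 times the L1 norm
  of \<open>e\<close>. Together with linearity it gives uniqueness, and continuity of the correction
  in the kernel.\<close>

lemma is_corr_norm_le:
  assumes e: "integrable lborel e" and psi: "is_corr e \<psi>"
  shows "gap * torus_norm \<psi> \<le> 2 * \<alpha>2 * (\<integral>z. \<bar>e z\<bar> \<partial>lborel)"
proof -
  have psi': "torus_L2 \<psi>" "(\<integral>x. \<psi> x \<partial>torus) = 0" "AE x in torus. gen a \<psi> x = - 2 * conv e (\<lambda>_. 1) x"
    using psi by (auto simp: is_corr_def)
  have "gap * torus_norm \<psi> \<le> torus_norm (gen a \<psi>)" by (rule gap_norm_le[OF psi'(1,2)])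
  also have "\<dots> = torus_norm (\<lambda>x. - 2 * conv e (\<lambda>_. 1) x)"
    by (rule torus_norm_cong_AE[OF torus_L2_gen[OF a_integrable psi'(1)] torus_L2_cmult[OF torus_L2_conv_1[OF e]] psi'(3)])
  also have "\<dots> \<le> 2 * \<alpha>2 * (\<integral>z. \<bar>e z\<bar> \<partial>lborel)"
    unfolding torus_norm_cmult using torus_norm_conv_1[OF e] by simp
  finally show ?thesis .
qed

lemma is_corr_unique:
  assumes e: "integrable lborel e" and psi: "is_corr e \<psi>" "is_corr e \<psi>'"
  shows "AE x in torus. \<psi> x = \<psi>' x"
proof -
  have L2: "torus_L2 (\<lambda>x. \<psi> x - \<psi>' x)" using psi by (auto simp: is_corr_def intro: torus_L2_diff)
  have "gap * torus_norm (\<lambda>x. \<psi> x - \<psi>' x) \<le> 0"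
    using is_corr_norm_le[OF _ is_corr_diff[OF e e psi]] by simp
  hence "torus_norm (\<lambda>x. \<psi> x - \<psi>' x) = 0"
    using gap_pos torus_norm_nonneg[of "\<lambda>x. \<psi> x - \<psi>' x"] by (simp add: mult_le_0_iff)
  hence "AE x in torus. \<psi> x - \<psi>' x = 0" using torus_norm_eq_0_iff[OF L2] by simp
  thus ?thesis by eventually_elim simp
qed

lemma is_density_correction_iff:
  assumes c: "\<And>i. integrable lborel (\<lambda>z. c z $ i)"
  shows "is_density_correction a \<mu> c \<phi> \<longleftrightarrow> (\<forall>i. is_corr (\<lambda>z. c z $ i) (\<lambda>x. \<phi> x $ i))"
proof -
  have "(torus_L2 (\<lambda>x. \<phi> x $ i) \<and>
      (AE x in lborel. (\<integral>q. a (x - q) * \<mu> x q * (\<phi> q $ i - \<phi> x $ i) \<partial>lborel) = 2 * (\<integral>q. c (x - q) $ i * \<mu> x q \<partial>lborel)) \<and>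
      torus_integral (\<lambda>x. \<phi> x $ i) = 0) \<longleftrightarrow> is_corr (\<lambda>z. c z $ i) (\<lambda>x. \<phi> x $ i)" for i
  proof (cases "torus_L2 (\<lambda>x. \<phi> x $ i)")
    case L2: True
    define f where "f = (\<lambda>x. \<phi> x $ i)"
    have f: "torus_L2 f" using L2 by (simp add: f_def)
    note [measurable] = torus_L2_measurable[OF f]
    have [measurable]: "(\<lambda>z. c z $ i) \<in> borel_measurable borel"
      using c[of i] by (auto dest: borel_measurable_integrable)
    have ti: "torus_integral f = (\<integral>x. f x \<partial>torus)" by (simp add: torus_integral_eq)
    have eq: "(\<integral>q. c (x - q) $ i * \<mu> x q \<partial>lborel) = conv (\<lambda>z. c z $ i) (\<lambda>_. 1) x" for x
      using conv_1_eq[of "\<lambda>z. c z $ i" x] by simp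
    have "(AE x in torus. gen a f x = - 2 * conv (\<lambda>z. c z $ i) (\<lambda>_. 1) x) \<longleftrightarrow>
          (AE x in lborel. gen a f x = - 2 * conv (\<lambda>z. c z $ i) (\<lambda>_. 1) x)"
      using gen_periodic[OF torus_L2_periodic[OF f]] conv_periodic[of "\<lambda>_. 1" "\<lambda>z. c z $ i"]
      by (intro AE_torus_eq_iff) (auto simp: lattice_periodic_def)
    also have "\<dots> \<longleftrightarrow> (AE x in lborel. (\<integral>q. a (x - q) * \<mu> x q * (f q - f x) \<partial>lborel) = 2 * conv (\<lambda>z. c z $ i) (\<lambda>_. 1) x)"
      (is "?A \<longleftrightarrow> ?B")
    proof
      assume ?A
      with AE_integral_diff_eq_gen[OF a_integrable a_even f] show ?B by eventually_elim simp
    next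
      assume ?B
      with AE_integral_diff_eq_gen[OF a_integrable a_even f] show ?A by eventually_elim simp
    qed
    finally show ?thesis using f ti by (auto simp: is_corr_def f_def eq)
  qed (simp add: is_corr_def)
  thus ?thesis by (simp add: is_density_correction_def)
qed

end

section \<open>Expansion of the drift and the effective matrix\<close>

lemma borel_measurable_vec_nth [measurable (raw)]:
  fixes f :: "'a \<Rightarrow> real ^ 'n"
  assumes "f \<in> borel_measurable M"
  shows "(\<lambda>x. f x $ i) \<in> borel_measurable M"
  by (rule measurable_compose[OF assms]) (intro borel_measurable_continuous_onI continuous_intros)

lemma integrable_vecI:
  fixes f :: "'a \<Rightarrow> real ^ 'n"
  assumes "\<And>i. integrable M (\<lambda>x. f x $ i)"
  shows "integrable M f"
proof -
  have "f = (\<lambda>x. \<Sum>i\<in>UNIV. (f x $ i) *\<^sub>R axis i 1)"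
    by (simp add: fun_eq_iff scalar_mult_eq_scaleR[symmetric] basis_expansion)
  moreover have "integrable M (\<lambda>x. \<Sum>i\<in>UNIV. (f x $ i) *\<^sub>R (axis i 1 :: real ^ 'n))"
    using assms by (intro Bochner_Integration.integrable_sum integrable_scaleR_left) auto
  ultimately show ?thesis by simp
qed

lemma integral_vec_nth:
  fixes f :: "'a \<Rightarrow> real ^ 'n"
  assumes "integrable M f"
  shows "(\<integral>x. f x \<partial>M) $ i = (\<integral>x. f x $ i \<partial>M)"
  using integral_bounded_linear[OF bounded_linear_vec_nth assms, of i] by simp

lemma
  fixes p :: "real ^ 'n \<Rightarrow> real"
  assumes p: "integrable lborel (\<lambda>z. norm z * p z)" and [measurable]: "p \<in> borel_measurable borel"
  shows integrable_component: "integrable lborel (\<lambda>z. z $ i * p z)"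
    and integral_component_le: "(\<integral>z. \<bar>z $ i * p z\<bar> \<partial>lborel) \<le> (\<integral>z. \<bar>norm z * p z\<bar> \<partial>lborel)"
proof -
  have le: "\<bar>z $ i * p z\<bar> \<le> \<bar>norm z * p z\<bar>" for z
    using component_le_norm_cart[of z i] by (simp add: abs_mult mult_right_mono)
  show int: "integrable lborel (\<lambda>z. z $ i * p z)"
    by (rule Bochner_Integration.integrable_bound[OF p]) (use le in auto)
  show "(\<integral>z. \<bar>z $ i * p z\<bar> \<partial>lborel) \<le> (\<integral>z. \<bar>norm z * p z\<bar> \<partial>lborel)"
    by (intro integral_mono integrable_abs int p le)
qed

context periodic_coefficient
begin

text \<open>Taking a component of a vector-valued integral requires integrability: the first moment
  supplies it for the inner integral, and square integrability of the density against a bounded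
  local drift for the outer one.\<close>

lemma effective_drift_eq:
  assumes p: "integrable lborel p" "integrable lborel (\<lambda>z. norm z * p z)"
    and v: "torus_L2 (invariant_density p \<mu>)"
  shows "effective_drift p \<mu> $ i = (\<integral>x. invariant_density p \<mu> x * conv (\<lambda>z. z $ i * p z) (\<lambda>_. 1) x \<partial>torus)"
proof -
  define v where "v = invariant_density p \<mu>"
  have [measurable]: "p \<in> borel_measurable borel" "v \<in> borel_measurable borel"
    using p assms(3) by (auto dest: borel_measurable_integrable torus_L2_measurable simp: v_def)
  define V where "V = (\<lambda>x. \<integral>q. (p (x - q) * \<mu> x q * v x) *\<^sub>R (x - q) \<partial>lborel)"
  have [measurable]: "V \<in> borel_measurable borel" unfolding V_def by measurable
  have V_nth: "V x $ i = v x * conv (\<lambda>z. z $ i * p z) (\<lambda>_. 1) x" for x i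
  proof -
    define f where "f = (\<lambda>z. (p z * \<mu> x (x - z) * v x) *\<^sub>R z)"
    have [measurable]: "f \<in> borel_measurable borel" unfolding f_def by measurable
    have "V x = (\<integral>z. f z \<partial>lborel)"
      using lborel_integral_reflect[of f x] by (simp add: V_def f_def)
    moreover have "integrable lborel f"
    proof (rule integrable_vecI)
      fix i
      have "integrable lborel (\<lambda>z. (z $ i * p z) * \<mu> x (x - z) * v x)"
        by (intro integrable_mult_left integrable_kernel integrable_component p) measurable
      thus "integrable lborel (\<lambda>z. f z $ i)" by (simp add: f_def mult_ac)
    qed
    ultimately have "V x $ i = (\<integral>z. f z $ i \<partial>lborel)" by (simp add: integral_vec_nth)
    also have "\<dots> = (\<integral>z. v x * (z $ i * p z * \<mu> x (x - z)) \<partial>lborel)"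
      by (intro Bochner_Integration.integral_cong) (auto simp: f_def)
    finally show ?thesis by (simp only: integral_mult_right_zero conv_def mult_1_right)
  qed
  have "integrable torus V"
  proof (rule integrable_vecI)
    fix i
    show "integrable torus (\<lambda>x. V x $ i)" unfolding V_nth
      by (intro torus_L2_mult torus_L2_conv_1 integrable_component p) (use assms(3) in \<open>simp_all add: v_def\<close>)
  qed
  thus ?thesis
    by (simp add: effective_drift_def torus_integral_eq v_def[symmetric] V_def[symmetric] integral_vec_nth V_nth)
qed

lemma integral_kernel_fst:
  assumes p: "integrable lborel p" and f: "torus_L2 f"
  shows "(\<integral>z. torus_integral (\<lambda>x. p z * \<mu> x (x - z) * f x) \<partial>lborel) = (\<integral>x. f x * conv p (\<lambda>_. 1) x \<partial>torus)"
proof -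
  have [measurable]: "p \<in> borel_measurable borel" "f \<in> borel_measurable borel"
    using p f by (auto dest: borel_measurable_integrable torus_L2_measurable)
  have "(\<integral>z. torus_integral (\<lambda>x. p z * \<mu> x (x - z) * f x) \<partial>lborel) = (\<integral>z. \<integral>x. p z * \<mu> x (x - z) * f x \<partial>torus \<partial>lborel)"
    by (intro Bochner_Integration.integral_cong torus_integral_eq) auto
  also have "\<dots> = (\<integral>x. \<integral>z. p z * \<mu> x (x - z) * f x \<partial>lborel \<partial>torus)"
    by (rule torus_lborel.Fubini_integral[OF integrable_kernel_fst[OF p torus_L2_integrable[OF f]]])
  finally show ?thesis by (simp add: conv_def mult.commute)
qed

lemma conv_1_pairing_le:
  assumes p: "integrable lborel p" and f: "torus_L2 f"
  shows "\<bar>\<integral>x. f x * conv p (\<lambda>_. 1) x \<partial>torus\<bar> \<le> torus_norm f * (\<alpha>2 * (\<integral>z. \<bar>p z\<bar> \<partial>lborel))"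
  using torus_inner_le_norm[OF f torus_L2_conv_1[OF p]] torus_norm_conv[OF p, of "\<lambda>_. 1"]
  by (force simp: torus_norm_1 intro: order.trans mult_left_mono)

end

context symmetric_kernel
begin

text \<open>The density is sought as \<open>w + 1\<close>; \<open>gen p\<close> of the constant 1
  has mean zero, so the equation for \<open>w\<close> is solvable. Existence makes the choice behind
  \<open>invariant_density\<close> meaningful.\<close>

lemma invariant_density:
  assumes e: "integrable lborel e" and small: "4 * \<alpha>2 * (\<integral>z. \<bar>e z\<bar> \<partial>lborel) \<le> gap"
  defines "p \<equiv> \<lambda>z. a z + e z"
  shows "is_invariant_density p \<mu> (invariant_density p \<mu>)"
proof -
  have p: "integrable lborel p" using a_integrable e by (simp add: p_def)
  have L2: "torus_L2 (\<lambda>x. - gen p (\<lambda>_. 1) x)" by (intro torus_L2_uminus torus_L2_gen p) simp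
  have mean: "(\<integral>x. - gen p (\<lambda>_. 1) x \<partial>torus) = 0" using integral_gen[OF p, of "\<lambda>_. 1"] by simp
  obtain w where w: "torus_L2 w" "(\<integral>x. w x \<partial>torus) = 0" "AE x in torus. gen p w x = - gen p (\<lambda>_. 1) x"
    by (rule gen_solvable[OF e small L2 mean]) (simp add: p_def)
  have "AE x in torus. gen p (\<lambda>x. w x + 1) x = 0"
    using gen_add_cmult[OF p w(1) torus_L2_const, of 1 1] w(3) by eventually_elim simp
  moreover have "(\<integral>x. w x + 1 \<partial>torus) = 1" using w torus_L2_integrable[OF w(1)] by simp
  ultimately have "is_invariant_density p \<mu> (\<lambda>x. w x + 1)"
    unfolding is_invariant_density_iff[OF p] using w by (auto intro: torus_L2_add)
  thus ?thesis unfolding invariant_density_def by (rule someI[of "is_invariant_density p \<mu>"])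
qed

text \<open>The bound is quadratic in \<open>e\<close>. Its first summand estimates the error
  \<open>u\<close> of the correction against the local drift of \<open>a\<close>, its second the
  product of the density perturbation \<open>w\<close> with the local drift of
  \<open>e\<close>.\<close>

lemma drift_expansion:
  assumes e: "integrable lborel e" "integrable lborel (\<lambda>z. norm z * e z)" and odd: "\<And>z. e (- z) = - e z"
    and small: "4 * \<alpha>2 * (\<integral>z. \<bar>e z\<bar> \<partial>lborel) \<le> gap" and psi: "is_corr e \<psi>"
  shows "\<bar>effective_drift (\<lambda>z. a z + e z) \<mu> $ i -
      ((\<integral>x. conv (\<lambda>z. z $ i * e z) (\<lambda>_. 1) x \<partial>torus) + (\<integral>x. \<psi> x * conv (\<lambda>z. z $ i * a z) (\<lambda>_. 1) x \<partial>torus))\<bar>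
    \<le> 4 * \<alpha>2\<^sup>2 / gap * (\<integral>z. \<bar>e z\<bar> \<partial>lborel) *
      (2 * \<alpha>2 / gap * (\<integral>z. \<bar>norm z * a z\<bar> \<partial>lborel) * (\<integral>z. \<bar>e z\<bar> \<partial>lborel) + (\<integral>z. \<bar>norm z * e z\<bar> \<partial>lborel))"
proof -
  define p where "p = (\<lambda>z. a z + e z)"
  define v where "v = invariant_density p \<mu>"
  define w where "w = (\<lambda>x. v x - 1)"
  define E where "E = (\<integral>z. \<bar>e z\<bar> \<partial>lborel)"
  have E: "E \<ge> 0" by (simp add: E_def)
  have [measurable]: "e \<in> borel_measurable borel" using e by (auto dest: borel_measurable_integrable)
  have p: "integrable lborel p" "integrable lborel (\<lambda>z. norm z * p z)"
    using a_integrable a_moment1 e by (simp_all add: p_def distrib_left)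
  have v: "torus_L2 v" "(\<integral>x. v x \<partial>torus) = 1" "AE x in torus. gen p v x = 0"
    using invariant_density[OF e(1) small] is_invariant_density_iff[OF p(1)] by (auto simp: p_def v_def)
  have w: "torus_L2 w" "(\<integral>x. w x \<partial>torus) = 0"
    using v torus_L2_integrable[OF v(1)] by (auto simp: w_def intro: torus_L2_diff)
  have gen_w: "AE x in torus. gen p w x = - 2 * conv e (\<lambda>_. 1) x"
    using gen_diff[OF p(1) v(1) torus_L2_const, of 1] v(3)
  proof eventually_elim
    case (elim x)
    \<comment> \<open>Reflection changes only the sign of \<open>e\<close>, so in
      \<open>gen p\<close> of the constant 1 the even part cancels and the odd part doubles. This is
      the origin of the factor 2 in the correction equation.\<close>
    have "conv (\<lambda>z. p (- z)) (\<lambda>_. 1) x = conv a (\<lambda>_. 1) x - conv e (\<lambda>_. 1) x"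
      using conv_add_kernel_1[OF a_integrable, of "\<lambda>z. - e z" x] e
      by (simp add: p_def a_even odd conv_uminus_kernel)
    moreover have "conv p (\<lambda>_. 1) x = conv a (\<lambda>_. 1) x + conv e (\<lambda>_. 1) x"
      unfolding p_def by (rule conv_add_kernel_1[OF a_integrable e(1)])
    ultimately show ?case using elim by (simp add: w_def gen_const)
  qed
  \<comment> \<open>Only half of the gap is available for the perturbed kernel, whence the constant
    4 where \<open>is_corr_norm_le\<close> has 2.\<close>
  have "gap / 2 * torus_norm w \<le> torus_norm (gen p w)"
    using perturbed_coercive[OF e(1) small w] by (intro coercive_norm_le w p) (simp add: p_def)
  also have "\<dots> = torus_norm (\<lambda>x. - 2 * conv e (\<lambda>_. 1) x)"
    by (rule torus_norm_cong_AE[OF torus_L2_gen[OF p(1) w(1)] torus_L2_cmult[OF torus_L2_conv_1[OF e(1)]] gen_w])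
  also have "\<dots> \<le> 2 * (\<alpha>2 * E)"
    unfolding torus_norm_cmult E_def using torus_norm_conv_1[OF e(1)] by simp
  finally have w_norm: "torus_norm w \<le> 4 * \<alpha>2 / gap * E" using gap_pos by (simp add: field_simps)
  define u where "u = (\<lambda>x. w x - \<psi> x)"
  have psi': "torus_L2 \<psi>" "(\<integral>x. \<psi> x \<partial>torus) = 0" "AE x in torus. gen a \<psi> x = - 2 * conv e (\<lambda>_. 1) x"
    using psi by (auto simp: is_corr_def)
  have u: "torus_L2 u" "(\<integral>x. u x \<partial>torus) = 0"
    using w psi' torus_L2_integrable[OF w(1)] torus_L2_integrable[OF psi'(1)] by (auto simp: u_def intro: torus_L2_diff)
  have gen_u: "AE x in torus. gen a u x = - gen e w x"
    using gen_diff[OF a_integrable w(1) psi'(1)] gen_add_kernel[OF a_integrable e(1) w(1)] gen_w psi'(3)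
    by eventually_elim (simp add: u_def p_def)
  have "gap * torus_norm u \<le> torus_norm (gen a u)" by (rule gap_norm_le[OF u])
  also have "\<dots> = torus_norm (\<lambda>x. - gen e w x)"
    by (rule torus_norm_cong_AE[OF torus_L2_gen[OF a_integrable u(1)] torus_L2_uminus[OF torus_L2_gen[OF e(1) w(1)]] gen_u])
  also have "\<dots> = torus_norm (gen e w)" by (simp add: torus_norm_def)
  also have "\<dots> \<le> 2 * \<alpha>2 * E * torus_norm w" unfolding E_def by (rule torus_norm_gen[OF e(1) w(1)])
  also have "\<dots> \<le> 2 * \<alpha>2 * E * (4 * \<alpha>2 / gap * E)"
    using E alpha2_pos by (intro mult_left_mono w_norm) auto
  finally have "gap * torus_norm u \<le> 8 * \<alpha>2\<^sup>2 / gap * E\<^sup>2" by (simp add: power2_eq_square mult_ac)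
  hence u_norm: "torus_norm u \<le> 8 * \<alpha>2\<^sup>2 / gap\<^sup>2 * E\<^sup>2"
    using gap_pos by (simp add: field_simps power2_eq_square)
  define A where "A = conv (\<lambda>z. z $ i * a z) (\<lambda>_. 1)"
  define B where "B = conv (\<lambda>z. z $ i * e z) (\<lambda>_. 1)"
  have ints: "integrable lborel (\<lambda>z. z $ i * a z)" "integrable lborel (\<lambda>z. z $ i * e z)"
    by (intro integrable_component a_moment1 e; measurable)+
  have AB: "torus_L2 A" "torus_L2 B" unfolding A_def B_def by (intro torus_L2_conv_1 ints)+
  have A_mean: "(\<integral>x. A x \<partial>torus) = 0"
    unfolding A_def by (rule conv_odd_mean[OF ints(1)]) (simp add: a_even)
  have "conv (\<lambda>z. z $ i * p z) (\<lambda>_. 1) x = A x + B x" for x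
    using conv_add_kernel_1[OF ints, of x] by (simp add: A_def B_def p_def distrib_left)
  hence "effective_drift p \<mu> $ i = (\<integral>x. v x * (A x + B x) \<partial>torus)"
    using effective_drift_eq[OF p v(1)[unfolded v_def], of i] by (simp add: v_def)
  \<comment> \<open>Of the four terms of \<open>(1 + w) * (A + B)\<close>, the first has mean zero,
    \<open>B\<close> and \<open>w * A\<close> are of first order, and \<open>w * B\<close> is of
    second order. Replacing \<open>w\<close> by \<open>\<psi>\<close> in \<open>w * A\<close> leaves
    the error \<open>u * A\<close>.\<close>
  also have "\<dots> = (\<integral>x. A x + B x + (w x * A x + w x * B x) \<partial>torus)"
    by (intro Bochner_Integration.integral_cong) (auto simp: w_def algebra_simps)
  also have "\<dots> = (\<integral>x. B x \<partial>torus) + (\<integral>x. w x * A x \<partial>torus) + (\<integral>x. w x * B x \<partial>torus)"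
    using AB[THEN torus_L2_integrable] torus_L2_mult[OF w(1) AB(1)] torus_L2_mult[OF w(1) AB(2)] A_mean by simp
  finally have "effective_drift p \<mu> $ i - ((\<integral>x. B x \<partial>torus) + (\<integral>x. \<psi> x * A x \<partial>torus))
      = (\<integral>x. u x * A x \<partial>torus) + (\<integral>x. w x * B x \<partial>torus)"
    using torus_L2_mult[OF w(1) AB(1)] torus_L2_mult[OF psi'(1) AB(1)] by (simp add: u_def left_diff_distrib)
  moreover have "\<bar>\<integral>x. u x * A x \<partial>torus\<bar> \<le> (8 * \<alpha>2\<^sup>2 / gap\<^sup>2 * E\<^sup>2) * (\<alpha>2 * (\<integral>z. \<bar>norm z * a z\<bar> \<partial>lborel))"
    unfolding A_def using alpha2_pos u_norm integral_component_le[OF a_moment1, of i] gap_pos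
    by (intro order.trans[OF conv_1_pairing_le[OF ints(1) u(1)]] mult_mono) auto
  moreover have "\<bar>\<integral>x. w x * B x \<partial>torus\<bar> \<le> (4 * \<alpha>2 / gap * E) * (\<alpha>2 * (\<integral>z. \<bar>norm z * e z\<bar> \<partial>lborel))"
    unfolding B_def using alpha2_pos w_norm integral_component_le[OF e(2), of i] gap_pos E
    by (intro order.trans[OF conv_1_pairing_le[OF ints(2) w(1)]] mult_mono) auto
  ultimately have "\<bar>effective_drift p \<mu> $ i - ((\<integral>x. B x \<partial>torus) + (\<integral>x. \<psi> x * A x \<partial>torus))\<bar> \<le>
      (8 * \<alpha>2\<^sup>2 / gap\<^sup>2 * E\<^sup>2) * (\<alpha>2 * (\<integral>z. \<bar>norm z * a z\<bar> \<partial>lborel)) +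
      (4 * \<alpha>2 / gap * E) * (\<alpha>2 * (\<integral>z. \<bar>norm z * e z\<bar> \<partial>lborel))" by linarith
  also have "\<dots> = 4 * \<alpha>2\<^sup>2 / gap * E * (2 * \<alpha>2 / gap * (\<integral>z. \<bar>norm z * a z\<bar> \<partial>lborel) * E + (\<integral>z. \<bar>norm z * e z\<bar> \<partial>lborel))"
    by (simp add: power2_eq_square algebra_simps)
  finally show ?thesis unfolding A_def B_def E_def p_def .
qed

text \<open>The expansion with \<open>e = 0\<close>, where the error bound is 0.\<close>

lemma effective_drift_0: "effective_drift a \<mu> = 0"
proof -
  have "effective_drift a \<mu> $ i = 0" for i
    using drift_expansion[of "\<lambda>_. 0" "\<lambda>_. 0" i] gap_pos by (simp add: is_corr_zero conv_def)
  thus ?thesis by (simp add: vec_eq_iff)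
qed

text \<open>The constant 1 is annihilated by \<open>gen a\<close>, so the density minus 1 is a
  correction for the kernel 0 and vanishes by uniqueness. The chosen representative is 1 only almost
  everywhere.\<close>

lemma invariant_density_eq_1: "AE x in torus. invariant_density a \<mu> x = 1"
proof -
  have "is_invariant_density a \<mu> (invariant_density a \<mu>)"
    using invariant_density[of "\<lambda>_. 0"] gap_pos by simp
  then obtain v where v: "v = invariant_density a \<mu>" "torus_L2 v" "(\<integral>x. v x \<partial>torus) = 1" "AE x in torus. gen a v x = 0"
    using is_invariant_density_iff[OF a_integrable] by blast
  have "AE x in torus. gen a (\<lambda>x. v x - 1) x = 0"
    using gen_diff[OF a_integrable v(2) torus_L2_const, of 1] v(4)
    by eventually_elim (simp add: gen_const a_even)
  moreover have "(\<integral>x. v x - 1 \<partial>torus) = 0" using v(3) torus_L2_integrable[OF v(2)] by simp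
  ultimately have "is_corr (\<lambda>_. 0) (\<lambda>x. v x - 1)"
    using torus_L2_diff[OF v(2) torus_L2_const, of 1] by (simp add: is_corr_def conv_def)
  from is_corr_unique[OF _ this is_corr_zero] have "AE x in torus. v x - 1 = 0" by simp
  thus ?thesis unfolding v(1) by eventually_elim simp
qed

lemma position_integrable: "integrable lborel (\<lambda>z. z $ i * a z)"
  by (intro integrable_component a_moment1) measurable

lemma position_mean: "(\<integral>x. conv (\<lambda>z. z $ i * a z) (\<lambda>_. 1) x \<partial>torus) = 0"
  by (rule conv_odd_mean[OF position_integrable]) (simp add: a_even)

text \<open>As the drift of \<open>a\<close> is 0, the components of the corrector equation are
  correction equations up to a factor 2 and the normalisation of the mean.\<close>

lemma is_first_corrector_iff:
  "is_first_corrector a \<mu> \<kappa> \<longleftrightarrow> (\<forall>i. torus_L2 (\<lambda>x. \<kappa> x $ i) \<and>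
     (AE x in torus. gen a (\<lambda>x. \<kappa> x $ i) x = - conv (\<lambda>z. z $ i * a z) (\<lambda>_. 1) x))"
proof (cases "\<forall>i. torus_L2 (\<lambda>x. \<kappa> x $ i)")
  case True
  hence L2: "torus_L2 (\<lambda>x. \<kappa> x $ i)" for i by blast
  note [measurable] = L2[THEN torus_L2_measurable]
  have AE1: "AE x in lborel. \<forall>i. (\<integral>q. (a (x - q) * \<mu> x q) *\<^sub>R (\<kappa> q - \<kappa> x) \<partial>lborel) $ i = - gen a (\<lambda>x. \<kappa> x $ i) x"
  proof -
    have "AE x in lborel. \<forall>i. integrable lborel (\<lambda>q. a (x - q) * \<mu> x q * (\<kappa> q $ i - \<kappa> x $ i))"
      by (intro eventually_all_finite AE_integrable_diff[OF a_integrable a_even L2])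
    moreover have "AE x in lborel. \<forall>i. (\<integral>q. a (x - q) * \<mu> x q * (\<kappa> q $ i - \<kappa> x $ i) \<partial>lborel) = - gen a (\<lambda>x. \<kappa> x $ i) x"
      by (intro eventually_all_finite AE_integral_diff_eq_gen[OF a_integrable a_even L2])
    ultimately show ?thesis
    proof eventually_elim
      case (elim x)
      have "integrable lborel (\<lambda>q. (a (x - q) * \<mu> x q) *\<^sub>R (\<kappa> q - \<kappa> x))"
        using elim(1) by (intro integrable_vecI) simp
      thus ?case using elim(2) by (simp add: integral_vec_nth)
    qed
  qed
  have eq2: "(\<integral>q. (a (x - q) * \<mu> x q) *\<^sub>R (x - q) \<partial>lborel) $ i = conv (\<lambda>z. z $ i * a z) (\<lambda>_. 1) x" for x i
  proof -
    define f where "f = (\<lambda>z. (a z * \<mu> x (x - z)) *\<^sub>R z)"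
    have [measurable]: "f \<in> borel_measurable borel" unfolding f_def by measurable
    have "(\<integral>q. (a (x - q) * \<mu> x q) *\<^sub>R (x - q) \<partial>lborel) = (\<integral>z. f z \<partial>lborel)"
      using lborel_integral_reflect[of f x] by (simp add: f_def)
    moreover have "integrable lborel f"
      using integrable_kernel[OF position_integrable, of _ x] by (intro integrable_vecI) (simp add: f_def mult_ac)
    ultimately show ?thesis by (simp add: integral_vec_nth f_def conv_def mult_ac)
  qed
  have "is_first_corrector a \<mu> \<kappa> \<longleftrightarrow> (AE x in lborel. \<forall>i. gen a (\<lambda>x. \<kappa> x $ i) x = - conv (\<lambda>z. z $ i * a z) (\<lambda>_. 1) x)"
    (is "_ \<longleftrightarrow> ?R")
  proof
    assume "is_first_corrector a \<mu> \<kappa>"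
    hence "AE x in lborel. (\<integral>q. (a (x - q) * \<mu> x q) *\<^sub>R (\<kappa> q - \<kappa> x) \<partial>lborel) = (\<integral>q. (a (x - q) * \<mu> x q) *\<^sub>R (x - q) \<partial>lborel)"
      by (simp add: is_first_corrector_def effective_drift_0)
    with AE1 show ?R
    proof eventually_elim
      case (elim x)
      show ?case
      proof
        fix i
        from elim show "gen a (\<lambda>x. \<kappa> x $ i) x = - conv (\<lambda>z. z $ i * a z) (\<lambda>_. 1) x"
          unfolding eq2[of x i, symmetric] elim(2)[symmetric] by simp
      qed
    qed
  next
    assume ?R
    with AE1 have "AE x in lborel. (\<integral>q. (a (x - q) * \<mu> x q) *\<^sub>R (\<kappa> q - \<kappa> x) \<partial>lborel) = (\<integral>q. (a (x - q) * \<mu> x q) *\<^sub>R (x - q) \<partial>lborel)"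
      by eventually_elim (simp add: vec_eq_iff eq2)
    thus "is_first_corrector a \<mu> \<kappa>" using L2 by (simp add: is_first_corrector_def effective_drift_0)
  qed
  also have "?R \<longleftrightarrow> (\<forall>i. AE x in lborel. gen a (\<lambda>x. \<kappa> x $ i) x = - conv (\<lambda>z. z $ i * a z) (\<lambda>_. 1) x)"
    by (auto intro: eventually_all_finite elim: eventually_mono)
  also have "\<dots> \<longleftrightarrow> (\<forall>i. AE x in torus. gen a (\<lambda>x. \<kappa> x $ i) x = - conv (\<lambda>z. z $ i * a z) (\<lambda>_. 1) x)"
  proof -
    have per: "lattice_periodic (\<lambda>x. - conv (\<lambda>z. z $ i * a z) (\<lambda>_. 1) x)" for i
      using conv_periodic[of "\<lambda>_. 1" "\<lambda>z. z $ i * a z"] by (simp add: lattice_periodic_def)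
    show ?thesis unfolding AE_torus_eq_iff[OF gen_periodic[OF torus_L2_periodic[OF L2]] per] ..
  qed
  finally show ?thesis using L2 by simp
qed (auto simp: is_first_corrector_def)

lemma is_first_corrector: "is_first_corrector a \<mu> (first_corrector a \<mu>)"
proof -
  \<comment> \<open>The factor 1/2 offsets the 2 on the right-hand side in
    \<open>is_corr\<close>.\<close>
  have "\<exists>\<psi>. is_corr (\<lambda>z. 1 / 2 * (z $ i * a z)) \<psi>" for i
    using position_integrable[of i] by (intro is_corr_ex) (auto simp: a_even)
  then obtain \<psi> where psi: "\<And>i. is_corr (\<lambda>z. 1 / 2 * (z $ i * a z)) (\<psi> i)" by metis
  have "is_first_corrector a \<mu> (\<lambda>x. \<chi> i. \<psi> i x)"
    using psi unfolding is_first_corrector_iff is_corr_def conv_cmult_kernel by simp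
  thus ?thesis unfolding first_corrector_def by (rule someI[of "is_first_corrector a \<mu>"])
qed

text \<open>The right-hand side is the coefficient of \<open>l $ j\<close> in the linear part of the
  drift for the kernel \<open>a z *\<^sub>R z\<close>: this is the Einstein relation before the
  cut-off is introduced.\<close>

lemma effective_matrix_eq:
  assumes psi: "is_corr (\<lambda>z. z $ j * a z) \<psi>"
  shows "2 * effective_matrix a \<mu> $ i $ j =
    (\<integral>x. conv (\<lambda>z. z $ i * (z $ j * a z)) (\<lambda>_. 1) x \<partial>torus) + (\<integral>x. \<psi> x * conv (\<lambda>z. z $ i * a z) (\<lambda>_. 1) x \<partial>torus)"
proof -
  define k where "k = (\<lambda>x. first_corrector a \<mu> x $ j)"
  define v where "v = invariant_density a \<mu>"
  define A where "A = conv (\<lambda>z. z $ i * a z) (\<lambda>_. 1)"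
  define M where "M = conv (\<lambda>z. z $ i * (z $ j * a z)) (\<lambda>_. 1)"
  have k: "torus_L2 k" "AE x in torus. gen a k x = - conv (\<lambda>z. z $ j * a z) (\<lambda>_. 1) x"
    using is_first_corrector unfolding is_first_corrector_iff by (auto simp: k_def)
  have v: "torus_L2 v" "AE x in torus. v x = 1"
    using invariant_density[of "\<lambda>_. 0"] gap_pos invariant_density_eq_1
    by (auto simp: v_def is_invariant_density_def)
  note [measurable] = k(1)[THEN torus_L2_measurable] v(1)[THEN torus_L2_measurable]
  have zz: "integrable lborel (\<lambda>z. z $ i * (z $ j * a z))"
  proof (rule Bochner_Integration.integrable_bound[OF a_moment2])
    have "\<bar>z $ i\<bar> * (\<bar>z $ j\<bar> * \<bar>a z\<bar>) \<le> norm z * (norm z * \<bar>a z\<bar>)" for z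
      by (intro mult_mono component_le_norm_cart) auto
    thus "AE z in lborel. norm (z $ i * (z $ j * a z)) \<le> norm ((norm z)\<^sup>2 * a z)"
      by (simp add: abs_mult power2_eq_square mult.assoc)
  qed measurable
  have L2: "torus_L2 A" "torus_L2 M" "torus_L2 (conv (\<lambda>z. z $ i * a z) k)"
    unfolding A_def M_def by (intro torus_L2_conv_1 torus_L2_conv position_integrable zz k)+
  note [measurable] = L2[THEN torus_L2_measurable]
  define J where "J = (\<lambda>x. \<integral>q. a (x - q) * \<mu> x q * (1 / 2 * (x - q) $ i * (x - q) $ j - (x - q) $ i * k q) * v x \<partial>lborel)"
  have [measurable]: "J \<in> borel_measurable borel" unfolding J_def by measurable
  have "AE x in torus. J x = 1 / 2 * M x - conv (\<lambda>z. z $ i * a z) k x"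
    using AE_integrable_conv[OF position_integrable[of i] torus_L2_integrable[OF k(1)] torus_L2_periodic[OF k(1)]] v(2)
  proof eventually_elim
    case (elim x)
    have "J x = (\<integral>z. a z * \<mu> x (x - z) * (1 / 2 * z $ i * z $ j - z $ i * k (x - z)) \<partial>lborel)"
      using lborel_integral_reflect[of "\<lambda>z. a z * \<mu> x (x - z) * (1 / 2 * z $ i * z $ j - z $ i * k (x - z))" x] elim(2)
      by (simp add: J_def)
    also have "\<dots> = (\<integral>z. 1 / 2 * (z $ i * (z $ j * a z) * \<mu> x (x - z)) - z $ i * a z * \<mu> x (x - z) * k (x - z) \<partial>lborel)"
      by (intro Bochner_Integration.integral_cong) (auto simp: algebra_simps)
    also have "\<dots> = 1 / 2 * (\<integral>z. z $ i * (z $ j * a z) * \<mu> x (x - z) \<partial>lborel) - (\<integral>z. z $ i * a z * \<mu> x (x - z) * k (x - z) \<partial>lborel)"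
      using elim(1) integrable_kernel[OF zz, of x]
      by (subst Bochner_Integration.integral_diff) auto
    finally show ?case by (simp add: M_def conv_def)
  qed
  hence "(\<integral>x. J x \<partial>torus) = (\<integral>x. 1 / 2 * M x - conv (\<lambda>z. z $ i * a z) k x \<partial>torus)"
    by (intro integral_cong_AE) measurable
  also have "\<dots> = 1 / 2 * (\<integral>x. M x \<partial>torus) - (\<integral>x. conv (\<lambda>z. z $ i * a z) k x \<partial>torus)"
    using L2(2,3)[THEN torus_L2_integrable] by simp
  \<comment> \<open>The kernel \<open>z $ i * a z\<close> is odd, so passing to the adjoint changes
    the sign. This turns the minus in front of the corrector in the effective matrix into the plus
    of the drift expansion.\<close>
  also have "(\<integral>x. conv (\<lambda>z. z $ i * a z) k x \<partial>torus) = - (\<integral>x. k x * A x \<partial>torus)"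
    using integral_conv(2)[OF position_integrable[of i] torus_L2_integrable[OF k(1)] torus_L2_periodic[OF k(1)]]
    by (simp add: a_even conv_uminus_kernel A_def)
  finally have J: "(\<integral>x. J x \<partial>torus) = 1 / 2 * (\<integral>x. M x \<partial>torus) + (\<integral>x. k x * A x \<partial>torus)" by simp
  have Theta: "effective_matrix a \<mu> $ i $ j = (\<integral>x. J x \<partial>torus)"
  proof -
    have "effective_matrix a \<mu> $ i $ j = torus_integral J"
      unfolding J_def k_def v_def by (simp add: effective_matrix_def effective_drift_0)
    thus ?thesis by (simp add: torus_integral_eq)
  qed
  \<comment> \<open>The chosen corrector has an arbitrary mean. Subtracting it gives the normalised
    correction, and the mean itself contributes nothing, because \<open>A\<close> has mean
    zero.\<close>
  define m where "m = (\<integral>x. k x \<partial>torus)"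
  have "is_corr (\<lambda>z. 1 / 2 * (z $ j * a z)) (\<lambda>x. k x - m)"
  proof -
    have "AE x in torus. gen a (\<lambda>x. k x - m) x = - 2 * conv (\<lambda>z. 1 / 2 * (z $ j * a z)) (\<lambda>_. 1) x"
      using gen_diff[OF a_integrable k(1) torus_L2_const, of m] k(2) unfolding conv_cmult_kernel
      by eventually_elim (simp add: gen_const a_even)
    thus ?thesis using torus_L2_integrable[OF k(1)] k(1) by (simp add: is_corr_def torus_L2_diff m_def)
  qed
  moreover have "is_corr (\<lambda>z. 1 / 2 * (z $ j * a z)) (\<lambda>x. 1 / 2 * \<psi> x)" by (rule is_corr_cmult[OF psi])
  ultimately have "AE x in torus. k x - m = 1 / 2 * \<psi> x"
    using position_integrable[of j] by (intro is_corr_unique) auto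
  hence keq: "AE x in torus. k x * A x = 1 / 2 * (\<psi> x * A x) + m * A x"
  proof eventually_elim
    case (elim x)
    hence "k x = 1 / 2 * \<psi> x + m" by linarith
    thus ?case by (simp add: algebra_simps)
  qed
  have psiL2: "torus_L2 \<psi>" using psi by (simp add: is_corr_def)
  note [measurable] = torus_L2_measurable[OF psiL2]
  have "(\<integral>x. k x * A x \<partial>torus) = (\<integral>x. 1 / 2 * (\<psi> x * A x) + m * A x \<partial>torus)"
    using keq by (intro integral_cong_AE) measurable
  also have "\<dots> = 1 / 2 * (\<integral>x. \<psi> x * A x \<partial>torus) + m * (\<integral>x. A x \<partial>torus)"
    using torus_L2_mult[OF psiL2 L2(1)] torus_L2_integrable[OF L2(1)] by simp
  also have "(\<integral>x. A x \<partial>torus) = 0" unfolding A_def by (rule position_mean)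
  finally show ?thesis using J unfolding Theta A_def M_def by simp
qed

section \<open>The linear part of the drift and the quadratic remainder\<close>

lemma drift_linear_part_eq:
  assumes c: "\<And>j. integrable lborel (\<lambda>z. c z $ j)" "\<And>j. integrable lborel (\<lambda>z. norm z * c z $ j)"
    and phi: "\<And>j. torus_L2 (\<lambda>x. \<phi> x $ j)"
  shows "drift_linear_part a \<mu> c \<phi> l $ i = (\<Sum>j\<in>UNIV. l $ j *
    ((\<integral>x. conv (\<lambda>z. z $ i * c z $ j) (\<lambda>_. 1) x \<partial>torus) + (\<integral>x. \<phi> x $ j * conv (\<lambda>z. z $ i * a z) (\<lambda>_. 1) x \<partial>torus)))"
proof -
  have "integrable lborel (\<lambda>z. z $ i * c z $ j)" for j
    using c by (intro integrable_component) (auto dest: borel_measurable_integrable)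
  note * = integral_kernel_fst[OF this torus_L2_const, of _ 1]
  have **: "(\<integral>z. torus_integral (\<lambda>x. z $ i * a z * \<mu> x (x - z) * \<phi> x $ j) \<partial>lborel)
      = (\<integral>x. \<phi> x $ j * conv (\<lambda>z. z $ i * a z) (\<lambda>_. 1) x \<partial>torus)" for j
    by (rule integral_kernel_fst[OF position_integrable phi])
  show ?thesis using * by (simp add: drift_linear_part_def ** sum.distrib distrib_left)
qed

text \<open>The sum over components is pulled inside, which gives the shape of
  \<open>drift_expansion\<close> with \<open>e = l \<bullet> c\<close>. The unprimed form displays
  the coefficient of each \<open>l $ j\<close> and serves for derivatives along an axis.\<close>

lemma drift_linear_part_eq':
  assumes c: "\<And>j. integrable lborel (\<lambda>z. c z $ j)" "\<And>j. integrable lborel (\<lambda>z. norm z * c z $ j)"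
    and phi: "\<And>j. torus_L2 (\<lambda>x. \<phi> x $ j)"
  shows "drift_linear_part a \<mu> c \<phi> l $ i =
    (\<integral>x. conv (\<lambda>z. z $ i * (l \<bullet> c z)) (\<lambda>_. 1) x \<partial>torus) +
    (\<integral>x. (\<Sum>j\<in>UNIV. l $ j * \<phi> x $ j) * conv (\<lambda>z. z $ i * a z) (\<lambda>_. 1) x \<partial>torus)"
proof -
  have int: "integrable lborel (\<lambda>z. z $ i * c z $ j)" for j
    using c by (intro integrable_component) (auto dest: borel_measurable_integrable)
  have 1: "conv (\<lambda>z. z $ i * (l \<bullet> c z)) (\<lambda>_. 1) x = (\<Sum>j\<in>UNIV. l $ j * conv (\<lambda>z. z $ i * c z $ j) (\<lambda>_. 1) x)" for x
  proof -
    have "conv (\<lambda>z. z $ i * (l \<bullet> c z)) (\<lambda>_. 1) x = (\<integral>z. (\<Sum>j\<in>UNIV. l $ j * (z $ i * c z $ j * \<mu> x (x - z))) \<partial>lborel)"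
      unfolding conv_def inner_vec_def
      by (intro Bochner_Integration.integral_cong) (auto simp: sum_distrib_left sum_distrib_right mult_ac)
    also have "\<dots> = (\<Sum>j\<in>UNIV. l $ j * conv (\<lambda>z. z $ i * c z $ j) (\<lambda>_. 1) x)"
      using integrable_kernel[OF int, of _ x] by (subst Bochner_Integration.integral_sum) (auto simp: conv_def)
    finally show ?thesis .
  qed
  have L2: "torus_L2 (conv (\<lambda>z. z $ i * a z) (\<lambda>_. 1))" by (intro torus_L2_conv_1 position_integrable)
  have 2: "(\<integral>x. (\<Sum>j\<in>UNIV. l $ j * \<phi> x $ j) * conv (\<lambda>z. z $ i * a z) (\<lambda>_. 1) x \<partial>torus)
      = (\<Sum>j\<in>UNIV. l $ j * (\<integral>x. \<phi> x $ j * conv (\<lambda>z. z $ i * a z) (\<lambda>_. 1) x \<partial>torus))"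
  proof -
    have "(\<integral>x. (\<Sum>j\<in>UNIV. l $ j * \<phi> x $ j) * conv (\<lambda>z. z $ i * a z) (\<lambda>_. 1) x \<partial>torus)
      = (\<integral>x. (\<Sum>j\<in>UNIV. l $ j * (\<phi> x $ j * conv (\<lambda>z. z $ i * a z) (\<lambda>_. 1) x)) \<partial>torus)"
      by (simp add: sum_distrib_right mult.assoc)
    also have "\<dots> = (\<Sum>j\<in>UNIV. l $ j * (\<integral>x. \<phi> x $ j * conv (\<lambda>z. z $ i * a z) (\<lambda>_. 1) x \<partial>torus))"
      using torus_L2_mult[OF phi L2] by (subst Bochner_Integration.integral_sum) auto
    finally show ?thesis .
  qed
  have 3: "(\<integral>x. (\<Sum>j\<in>UNIV. l $ j * conv (\<lambda>z. z $ i * c z $ j) (\<lambda>_. 1) x) \<partial>torus)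
      = (\<Sum>j\<in>UNIV. l $ j * (\<integral>x. conv (\<lambda>z. z $ i * c z $ j) (\<lambda>_. 1) x \<partial>torus))"
    using torus_L2_integrable[OF torus_L2_conv_1[OF int]] by (subst Bochner_Integration.integral_sum) auto
  show ?thesis unfolding drift_linear_part_eq[OF c phi] 1 2 3 by (simp add: distrib_left sum.distrib)
qed

lemma density_correction_ex1:
  assumes c: "\<And>j. integrable lborel (\<lambda>z. c z $ j)" and odd: "\<And>z. c (- z) = - c z"
  shows "\<exists>\<phi>. is_density_correction a \<mu> c \<phi> \<and>
    (\<forall>\<psi>. is_density_correction a \<mu> c \<psi> \<longrightarrow> (AE x in lborel. \<psi> x = \<phi> x))"
proof -
  have "\<exists>\<psi>. is_corr (\<lambda>z. c z $ i) \<psi>" for i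
    using c by (intro is_corr_ex) (auto simp: odd)
  then obtain f where f: "\<And>i. is_corr (\<lambda>z. c z $ i) (f i)" by metis
  show ?thesis
  proof (intro exI[of _ "\<lambda>x. \<chi> i. f i x"] conjI allI impI)
    show "is_density_correction a \<mu> c (\<lambda>x. \<chi> i. f i x)"
      using f by (simp add: is_density_correction_iff[OF c])
    fix \<psi> assume "is_density_correction a \<mu> c \<psi>"
    hence psi: "is_corr (\<lambda>z. c z $ i) (\<lambda>x. \<psi> x $ i)" for i by (simp add: is_density_correction_iff[OF c])
    have "AE x in lborel. \<psi> x $ i = f i x" for i
      using is_corr_unique[OF c psi f] psi f
      by (subst AE_torus_eq_iff[symmetric]) (auto simp: is_corr_def torus_L2_periodic)
    hence "AE x in lborel. \<forall>i. \<psi> x $ i = f i x" by (intro eventually_all_finite)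
    thus "AE x in lborel. \<psi> x = (\<chi> i. f i x)" by eventually_elim (simp add: vec_eq_iff)
  qed
qed

lemma component_bound_integrable:
  fixes c :: "real ^ 'n \<Rightarrow> real ^ 'n"
  assumes [measurable]: "c \<in> borel_measurable borel" and bd: "\<And>z. norm (c z) \<le> k z"
    and k: "integrable lborel k" "integrable lborel (\<lambda>z. norm z * k z)"
  shows "integrable lborel (\<lambda>z. c z $ j)" "integrable lborel (\<lambda>z. norm z * c z $ j)"
proof -
  have k0: "k z \<ge> 0" for z using order.trans[OF norm_ge_zero bd] .
  have le: "\<bar>c z $ j\<bar> \<le> k z" for z using component_le_norm_cart[of "c z" j] bd[of z] by linarith
  show "integrable lborel (\<lambda>z. c z $ j)"
    by (rule Bochner_Integration.integrable_bound[OF k(1)]) (use le k0 in auto)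
  show "integrable lborel (\<lambda>z. norm z * c z $ j)"
    by (rule Bochner_Integration.integrable_bound[OF k(2)]) (use le k0 in \<open>auto simp: abs_mult intro!: mult_left_mono\<close>)
qed

text \<open>The family \<open>c l\<close> may depend on \<open>l\<close> as long as one majorant
  \<open>k\<close> with a first moment serves all \<open>l\<close>; fixed and cut-off kernels are
  thereby treated alike.\<close>

lemma drift_linear_approx:
  fixes c :: "real ^ 'n \<Rightarrow> real ^ 'n \<Rightarrow> real ^ 'n"
  assumes c_meas [measurable]: "\<And>l. c l \<in> borel_measurable borel" and odd: "\<And>l z. c l (- z) = - c l z"
    and bd: "\<And>l z. norm (c l z) \<le> k z"
    and k: "integrable lborel k" "integrable lborel (\<lambda>z. norm z * k z)"
    and phi: "\<And>l. is_density_correction a \<mu> (c l) (\<phi> l)"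
  shows "(\<lambda>l. effective_drift (\<lambda>z. a z + l \<bullet> c l z) \<mu> $ i - drift_linear_part a \<mu> (c l) (\<phi> l) l $ i)
    \<in> O[nhds 0](\<lambda>l. (norm l)\<^sup>2)"
proof -
  define N0 where "N0 = (\<integral>z. k z \<partial>lborel)"
  define N1 where "N1 = (\<integral>z. norm z * k z \<partial>lborel)"
  define M1 where "M1 = (\<integral>z. \<bar>norm z * a z\<bar> \<partial>lborel)"
  have k0: "k z \<ge> 0" for z using order.trans[OF norm_ge_zero bd] .
  have N: "N0 \<ge> 0" "N1 \<ge> 0" "M1 \<ge> 0" unfolding N0_def N1_def M1_def using k0 by (auto intro!: integral_nonneg_AE)
  \<comment> \<open>The bound of \<open>drift_expansion\<close> with \<open>norm l * N0\<close> for
    the L1 norm of \<open>e\<close> and \<open>norm l * N1\<close> for its first moment, after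
    taking out \<open>(norm l)\<^sup>2\<close>.\<close>
  define C where "C = 4 * \<alpha>2\<^sup>2 / gap * N0 * (2 * \<alpha>2 / gap * M1 * N0 + N1)"
  have main: "\<bar>effective_drift (\<lambda>z. a z + l \<bullet> c l z) \<mu> $ i - drift_linear_part a \<mu> (c l) (\<phi> l) l $ i\<bar> \<le> C * (norm l)\<^sup>2"
    if small: "4 * \<alpha>2 * (norm l * N0) \<le> gap" for l
  proof -
    define e where "e = (\<lambda>z. l \<bullet> c l z)"
    have [measurable]: "e \<in> borel_measurable borel" unfolding e_def by measurable
    have e_le: "\<bar>e z\<bar> \<le> norm l * k z" for z
      using Cauchy_Schwarz_ineq2[of l "c l z"] mult_left_mono[OF bd, of "norm l" l z] unfolding e_def by simp
    have e_le': "\<bar>norm z * e z\<bar> \<le> norm l * (norm z * k z)" for z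
      using mult_left_mono[OF e_le, of "norm z" z] by (simp add: abs_mult mult_ac)
    have e: "integrable lborel e"
      by (rule Bochner_Integration.integrable_bound[of _ "\<lambda>z. norm l * k z"]) (use k e_le k0 in auto)
    have e': "integrable lborel (\<lambda>z. norm z * e z)"
      by (rule Bochner_Integration.integrable_bound[of _ "\<lambda>z. norm l * (norm z * k z)"]) (use k e_le' k0 in auto)
    define E E' where "E = (\<integral>z. \<bar>e z\<bar> \<partial>lborel)" and "E' = (\<integral>z. \<bar>norm z * e z\<bar> \<partial>lborel)"
    have E: "E \<le> norm l * N0"
      using integral_mono[OF integrable_abs[OF e] _ e_le] k by (simp add: N0_def E_def)
    have E': "E' \<le> norm l * N1"
      using integral_mono[OF integrable_abs[OF e'] _ e_le'] k by (simp add: N1_def E'_def)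
    have E0: "E \<ge> 0" "E' \<ge> 0" by (auto simp: E_def E'_def)
    note cc = component_bound_integrable[OF c_meas bd k, of l]
    have corr: "is_corr (\<lambda>z. c l z $ j) (\<lambda>x. \<phi> l x $ j)" for j
      using phi[of l] by (simp add: is_density_correction_iff[OF cc(1)])
    define \<psi> where "\<psi> = (\<lambda>x. \<Sum>j\<in>UNIV. l $ j * \<phi> l x $ j)"
    have psi: "is_corr e \<psi>"
      using is_corr_sum[of UNIV "\<lambda>j z. l $ j * c l z $ j" "\<lambda>j x. l $ j * \<phi> l x $ j"] is_corr_cmult[OF corr] cc(1)
      by (simp add: e_def \<psi>_def inner_vec_def)
    have "4 * \<alpha>2 * E \<le> 4 * \<alpha>2 * (norm l * N0)" using E alpha2_pos by (intro mult_left_mono) auto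
    hence small': "4 * \<alpha>2 * (\<integral>z. \<bar>e z\<bar> \<partial>lborel) \<le> gap" using small by (simp add: E_def)
    have phiL2: "torus_L2 (\<lambda>x. \<phi> l x $ j)" for j using corr by (simp add: is_corr_def)
    have "\<bar>effective_drift (\<lambda>z. a z + e z) \<mu> $ i - drift_linear_part a \<mu> (c l) (\<phi> l) l $ i\<bar>
        \<le> 4 * \<alpha>2\<^sup>2 / gap * E * (2 * \<alpha>2 / gap * M1 * E + E')"
      using drift_expansion[OF e e' _ small' psi, of i]
      unfolding drift_linear_part_eq'[OF cc phiL2] E_def E'_def M1_def by (simp add: e_def \<psi>_def odd)
    also have "\<dots> \<le> 4 * \<alpha>2\<^sup>2 / gap * (norm l * N0) * (2 * \<alpha>2 / gap * M1 * (norm l * N0) + norm l * N1)"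
      using E E' E0 N alpha2_pos gap_pos by (intro mult_mono add_mono mult_left_mono order.refl) auto
    also have "\<dots> = C * (norm l)\<^sup>2" by (simp add: C_def power2_eq_square algebra_simps)
    finally show ?thesis by (simp add: e_def)
  qed
  have "\<forall>\<^sub>F l in nhds (0 :: real ^ 'n). 4 * \<alpha>2 * (norm l * N0) < gap"
  proof (rule order_tendstoD(2)[OF _ gap_pos])
    have "((\<lambda>l :: real ^ 'n. 4 * \<alpha>2 * (norm l * N0)) \<longlongrightarrow> 4 * \<alpha>2 * (norm (0 :: real ^ 'n) * N0)) (nhds 0)"
      by (intro tendsto_intros filterlim_ident)
    thus "((\<lambda>l :: real ^ 'n. 4 * \<alpha>2 * (norm l * N0)) \<longlongrightarrow> 0) (nhds 0)" by simp
  qed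
  thus ?thesis by (intro bigoI[of _ C], eventually_elim) (use main in simp)
qed

end

section \<open>The Einstein relation\<close>

lemma cutoff_measurable:
  assumes "cutoff \<omega>"
  shows "\<omega> \<in> borel_measurable borel"
proof -
  have "\<omega> differentiable (at s)" for s
    using assms unfolding cutoff_def by (metis funpow_0)
  hence "continuous_on UNIV \<omega>"
    by (intro continuous_at_imp_continuous_on ballI differentiable_imp_continuous_within)
  thus ?thesis by (rule borel_measurable_continuous_onI)
qed

text \<open>For fixed \<open>z\<close> the factor \<open>1 - \<omega>\<close> is 0 once
  \<open>\<bar>t\<bar> * norm z\<close> is below 1/4, and \<open>\<bar>h z\<bar>\<close> dominates.
  No rate is asserted, and none is needed for a limit of difference quotients.\<close>

lemma cutoff_tendsto:
  fixes h :: "real ^ 'n \<Rightarrow> real"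
  assumes \<omega>: "cutoff \<omega>" and h: "integrable lborel h"
  shows "((\<lambda>t. \<integral>z. (1 - \<omega> (\<bar>t\<bar> * norm z)) * \<bar>h z\<bar> \<partial>lborel) \<longlongrightarrow> 0) (at 0)"
  unfolding tendsto_at_iff_sequentially comp_def
proof (intro allI impI)
  note [measurable] = cutoff_measurable[OF \<omega>]
  have [measurable]: "h \<in> borel_measurable borel" using h by (auto dest: borel_measurable_integrable)
  have \<omega>': "0 \<le> \<omega> s" "\<omega> s \<le> 1" "0 \<le> s \<Longrightarrow> s \<le> 1 / 4 \<Longrightarrow> \<omega> s = 1" for s
    using \<omega> by (auto simp: cutoff_def)
  fix X :: "nat \<Rightarrow> real" assume X: "X \<longlonglongrightarrow> 0"
  have "(\<lambda>n. \<integral>z. (1 - \<omega> (\<bar>X n\<bar> * norm z)) * \<bar>h z\<bar> \<partial>lborel) \<longlonglongrightarrow> (\<integral>z. 0 \<partial>(lborel :: (real ^ 'n) measure))"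
  proof (rule integral_dominated_convergence[where w = "\<lambda>z. \<bar>h z\<bar>"])
    show "AE z in lborel. (\<lambda>n. (1 - \<omega> (\<bar>X n\<bar> * norm z)) * \<bar>h z\<bar>) \<longlonglongrightarrow> 0"
    proof (rule AE_I2)
      fix z :: "real ^ 'n"
      have "(\<lambda>n. \<bar>X n\<bar> * norm z) \<longlonglongrightarrow> 0 * norm z"
        using X by (intro tendsto_intros tendsto_rabs_zero)
      hence "\<forall>\<^sub>F n in sequentially. \<bar>X n\<bar> * norm z < 1 / 4"
        by (intro order_tendstoD(2)) auto
      hence "\<forall>\<^sub>F n in sequentially. (1 - \<omega> (\<bar>X n\<bar> * norm z)) * \<bar>h z\<bar> = 0"
        by eventually_elim (simp add: \<omega>'(3))
      thus "(\<lambda>n. (1 - \<omega> (\<bar>X n\<bar> * norm z)) * \<bar>h z\<bar>) \<longlonglongrightarrow> 0" by (rule tendsto_eventually)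
    qed
    show "AE z in lborel. norm ((1 - \<omega> (\<bar>X n\<bar> * norm z)) * \<bar>h z\<bar>) \<le> \<bar>h z\<bar>" for n
      using \<omega>' by (auto simp: abs_mult intro!: mult_left_le_one_le)
  qed (use h in auto)
  thus "(\<lambda>n. \<integral>z. (1 - \<omega> (\<bar>X n\<bar> * norm z)) * \<bar>h z\<bar> \<partial>lborel) \<longlonglongrightarrow> 0" by simp
qed

context symmetric_kernel
begin

lemma einstein_perturbation_measurable:
  assumes "cutoff \<omega>"
  shows "einstein_perturbation a \<omega> l \<in> borel_measurable borel"
proof -
  note [measurable] = cutoff_measurable[OF assms]
  show ?thesis unfolding einstein_perturbation_def by measurable
qed

lemma einstein_perturbation_odd: "einstein_perturbation a \<omega> l (- z) = - einstein_perturbation a \<omega> l z"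
  by (simp add: einstein_perturbation_def a_even)

lemma norm_einstein_perturbation_le:
  assumes "cutoff \<omega>"
  shows "norm (einstein_perturbation a \<omega> l z) \<le> norm z * a z"
proof -
  have "0 \<le> \<omega> s" "\<omega> s \<le> 1" for s using assms by (auto simp: cutoff_def)
  hence "a z * \<bar>\<omega> (norm l * norm z)\<bar> \<le> a z * 1" by (intro mult_left_mono a_nonneg) simp
  hence "norm z * (a z * \<bar>\<omega> (norm l * norm z)\<bar>) \<le> norm z * (a z * 1)"
    by (rule mult_left_mono) simp
  thus ?thesis
    using a_nonneg[of z] by (simp add: einstein_perturbation_def abs_mult mult.commute)
qed

lemma a_moment2': "integrable lborel (\<lambda>z. norm z * (norm z * a z))"
  using a_moment2 by (simp add: power2_eq_square mult.assoc)

text \<open>The quotient of the drift by \<open>t\<close> is \<open>g t\<close> up to an error of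
  order \<open>t\<close>, and \<open>g 0\<close> is twice the entry of the effective matrix. Since
  \<open>g\<close> still contains the cut-off, its continuity at 0 has to be proved.\<close>

lemma einstein_relation:
  assumes \<omega>: "cutoff \<omega>"
  shows "((\<lambda>t. effective_drift (\<lambda>z. a z + (t *\<^sub>R axis j 1) \<bullet> einstein_perturbation a \<omega> (t *\<^sub>R axis j 1) z) \<mu> $ i)
    has_real_derivative 2 * effective_matrix a \<mu> $ i $ j) (at 0)"
proof -
  define c where "c = einstein_perturbation a \<omega>"
  define T where "T = (\<lambda>t :: real. t *\<^sub>R (axis j 1 :: real ^ 'n))"
  define b where "b = (\<lambda>l. effective_drift (\<lambda>z. a z + l \<bullet> c l z) \<mu>)"
  have c [measurable]: "c l \<in> borel_measurable borel" for l
    unfolding c_def by (rule einstein_perturbation_measurable[OF \<omega>])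
  have odd: "c l (- z) = - c l z" for l z unfolding c_def by (rule einstein_perturbation_odd)
  have bd: "norm (c l z) \<le> norm z * a z" for l z unfolding c_def by (rule norm_einstein_perturbation_le[OF \<omega>])
  note cc = component_bound_integrable[OF c bd a_moment1 a_moment2']
  obtain \<phi> where phi: "\<And>l. is_density_correction a \<mu> (c l) (\<phi> l)"
    using density_correction_ex1[OF cc(1) odd] by metis
  have corr: "is_corr (\<lambda>z. c l z $ j) (\<lambda>x. \<phi> l x $ j)" for l j
    using phi[of l] by (simp add: is_density_correction_iff[OF cc(1)])
  have phiL2: "torus_L2 (\<lambda>x. \<phi> l x $ j)" for l j using corr by (simp add: is_corr_def)
  have c_T: "c (T t) z $ j = \<omega> (\<bar>t\<bar> * norm z) * (z $ j * a z)" for t z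
    by (simp add: c_def einstein_perturbation_def T_def norm_axis_1)
  \<comment> \<open>At parameter 0 the cut-off is identically 1, so \<open>c 0\<close> is the full
    kernel to which \<open>effective_matrix_eq\<close> applies.\<close>
  have "\<omega> 0 = 1" using \<omega> by (simp add: cutoff_def)
  hence c_0: "c 0 z $ j = z $ j * a z" for z using c_T[of 0 z] by (simp add: T_def)
  define A where "A = conv (\<lambda>z. z $ i * a z) (\<lambda>_. 1)"
  \<comment> \<open>Along the \<open>j\<close>-th axis only the \<open>j\<close>-th term of the sum
    survives; \<open>g t\<close> is its coefficient, computed with the kernel cut off at parameter
    \<open>t\<close>.\<close>
  define g where "g = (\<lambda>t. (\<integral>x. conv (\<lambda>z. z $ i * c (T t) z $ j) (\<lambda>_. 1) x \<partial>torus) + (\<integral>x. \<phi> (T t) x $ j * A x \<partial>torus))"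
  have lin: "drift_linear_part a \<mu> (c (T t)) (\<phi> (T t)) (T t) $ i = t * g t" for t
    unfolding drift_linear_part_eq[OF cc phiL2] g_def A_def
    by (simp add: T_def axis_def if_distrib if_distribR cong: if_cong)
  have g_0: "g 0 = 2 * effective_matrix a \<mu> $ i $ j"
    using effective_matrix_eq[of j "\<lambda>x. \<phi> 0 x $ j" i] corr[of 0 j] by (simp add: g_def A_def T_def c_0)
  have b_0: "b (T 0) $ i = 0" by (simp add: b_def T_def effective_drift_0)
  have "(\<lambda>l. b l $ i - drift_linear_part a \<mu> (c l) (\<phi> l) l $ i) \<in> O[nhds 0](\<lambda>l. (norm l)\<^sup>2)"
    unfolding b_def by (rule drift_linear_approx[OF c odd bd a_moment1 a_moment2' phi])
  then obtain C where C: "\<forall>\<^sub>F l in nhds 0. norm (b l $ i - drift_linear_part a \<mu> (c l) (\<phi> l) l $ i) \<le> C * norm ((norm l)\<^sup>2)"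
    by (rule landau_o.bigE)
  have "(T \<longlongrightarrow> T 0) (at 0)" unfolding T_def by (intro tendsto_intros)
  hence "filterlim T (nhds 0) (at 0)" by (simp add: T_def)
  from eventually_compose_filterlim[OF C this]
  have approx: "\<forall>\<^sub>F t in at 0. \<bar>b (T t) $ i - t * g t\<bar> \<le> C * t\<^sup>2"
  proof eventually_elim
    case (elim t)
    have "norm (T t) = \<bar>t\<bar>" by (simp add: T_def norm_axis_1)
    thus ?case using elim unfolding lin by simp
  qed
  have quot: "((\<lambda>t. b (T t) $ i / t - g t) \<longlongrightarrow> 0) (at 0)"
  proof (rule Lim_null_comparison)
    show "\<forall>\<^sub>F t in at 0. norm (b (T t) $ i / t - g t) \<le> C * \<bar>t\<bar>"
      using approx eventually_neq_at_within[of "0 :: real" 0 UNIV]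
    proof eventually_elim
      case (elim t)
      hence t: "t \<noteq> 0" by simp
      have "b (T t) $ i / t - g t = (b (T t) $ i - t * g t) / t"
        using t by (simp add: diff_divide_distrib)
      hence "norm (b (T t) $ i / t - g t) = \<bar>b (T t) $ i - t * g t\<bar> / \<bar>t\<bar>"
        by (simp only: real_norm_def abs_divide)
      also have "\<dots> \<le> C * t\<^sup>2 / \<bar>t\<bar>" using elim(1) by (intro divide_right_mono) auto
      also have "\<dots> = C * \<bar>t\<bar>" using t by (cases "t > 0") (auto simp: power2_eq_square)
      finally show ?case .
    qed
    show "((\<lambda>t. C * \<bar>t\<bar>) \<longlongrightarrow> 0) (at 0)"
      by (intro tendsto_mult_right_zero tendsto_rabs_zero tendsto_ident_at)
  qed
  have zj: "integrable lborel (\<lambda>z. z $ j * a z)" by (rule position_integrable)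
  have zij: "integrable lborel (\<lambda>z. z $ i * (z $ j * a z))"
    using integrable_component[OF cc(2)[of 0 j], of i] by (simp add: c_0)
  define D0 where "D0 = (\<lambda>t. \<integral>z. (1 - \<omega> (\<bar>t\<bar> * norm z)) * \<bar>z $ j * a z\<bar> \<partial>lborel)"
  define D1 where "D1 = (\<lambda>t. \<integral>z. (1 - \<omega> (\<bar>t\<bar> * norm z)) * \<bar>z $ i * (z $ j * a z)\<bar> \<partial>lborel)"
  have \<omega>_le: "\<omega> s \<le> 1" for s using \<omega> by (simp add: cutoff_def)
  have diff0: "\<bar>c (T t) z $ j - c 0 z $ j\<bar> = (1 - \<omega> (\<bar>t\<bar> * norm z)) * \<bar>z $ j * a z\<bar>" for t z
  proof -
    have "c (T t) z $ j - c 0 z $ j = - (1 - \<omega> (\<bar>t\<bar> * norm z)) * (z $ j * a z)"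
      unfolding c_T c_0 by (simp add: algebra_simps)
    thus ?thesis using \<omega>_le by (simp only: abs_mult abs_minus_cancel abs_of_nonneg diff_ge_0_iff_ge)
  qed
  define K where "K = \<alpha>2 * (\<integral>z. \<bar>z $ i * a z\<bar> \<partial>lborel)"
  have K: "K \<ge> 0" using alpha2_pos by (simp add: K_def)
  have L2A: "torus_L2 A" unfolding A_def by (intro torus_L2_conv_1 position_integrable)
  \<comment> \<open>By linearity the difference of the corrections is the correction for
    \<open>e\<close>, the part removed by the cut-off. Hence \<open>g\<close> changes by at most
    multiples of \<open>D0 t\<close>, the L1 norm of \<open>e\<close>, and \<open>D1 t\<close>, the
    L1 norm of \<open>z $ i * e z\<close>.\<close>
  have g_diff: "norm (g t - g 0) \<le> \<alpha>2 * D1 t + 2 * \<alpha>2 / gap * D0 t * K" for t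
  proof -
    define e where "e = (\<lambda>z. c (T t) z $ j - c 0 z $ j)"
    define \<psi> where "\<psi> = (\<lambda>x. \<phi> (T t) x $ j - \<phi> 0 x $ j)"
    have e: "integrable lborel e" unfolding e_def using cc(1) by simp
    have mom: "integrable lborel (\<lambda>z. z $ i * c l z $ j)" for l
      by (rule integrable_component[OF cc(2)]) measurable
    have mom_e: "integrable lborel (\<lambda>z. z $ i * e z)"
      using mom[of "T t"] mom[of 0] by (simp add: e_def right_diff_distrib)
    have psi: "is_corr e \<psi>" unfolding e_def \<psi>_def by (rule is_corr_diff[OF cc(1) cc(1) corr corr])
    have psiL2: "torus_L2 \<psi>" using psi by (simp add: is_corr_def)
    have D0: "(\<integral>z. \<bar>e z\<bar> \<partial>lborel) = D0 t" by (simp add: e_def D0_def diff0)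
    have "\<bar>z $ i * e z\<bar> = (1 - \<omega> (\<bar>t\<bar> * norm z)) * \<bar>z $ i * (z $ j * a z)\<bar>" for z
      unfolding e_def abs_mult[of "z $ i"] diff0 by simp
    hence D1: "(\<integral>z. \<bar>z $ i * e z\<bar> \<partial>lborel) = D1 t" by (simp add: D1_def)
    have "conv (\<lambda>z. z $ i * c (T t) z $ j) (\<lambda>_. 1) x = conv (\<lambda>z. z $ i * c 0 z $ j) (\<lambda>_. 1) x + conv (\<lambda>z. z $ i * e z) (\<lambda>_. 1) x" for x
      using conv_add_kernel_1[OF mom[of 0] mom_e, of x] by (simp add: e_def distrib_left[symmetric])
    hence 1: "(\<integral>x. conv (\<lambda>z. z $ i * c (T t) z $ j) (\<lambda>_. 1) x \<partial>torus) =
        (\<integral>x. conv (\<lambda>z. z $ i * c 0 z $ j) (\<lambda>_. 1) x \<partial>torus) + (\<integral>x. conv (\<lambda>z. z $ i * e z) (\<lambda>_. 1) x \<partial>torus)"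
      using torus_L2_conv_1[OF mom[of 0], THEN torus_L2_integrable] torus_L2_conv_1[OF mom_e, THEN torus_L2_integrable] by simp
    have 2: "(\<integral>x. \<phi> (T t) x $ j * A x \<partial>torus) = (\<integral>x. \<phi> 0 x $ j * A x \<partial>torus) + (\<integral>x. \<psi> x * A x \<partial>torus)"
      using torus_L2_mult[OF phiL2 L2A] by (simp add: \<psi>_def left_diff_distrib)
    have "g t - g 0 = (\<integral>x. conv (\<lambda>z. z $ i * e z) (\<lambda>_. 1) x \<partial>torus) + (\<integral>x. \<psi> x * A x \<partial>torus)"
      unfolding g_def 1 2 by (simp add: T_def)
    moreover have "\<bar>\<integral>x. conv (\<lambda>z. z $ i * e z) (\<lambda>_. 1) x \<partial>torus\<bar> \<le> \<alpha>2 * D1 t"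
      using conv_1_pairing_le[OF mom_e torus_L2_const, of 1] by (simp add: torus_norm_1 D1)
    moreover have "\<bar>\<integral>x. \<psi> x * A x \<partial>torus\<bar> \<le> torus_norm \<psi> * K"
      unfolding A_def K_def by (rule conv_1_pairing_le[OF position_integrable psiL2])
    moreover have "torus_norm \<psi> \<le> 2 * \<alpha>2 / gap * D0 t"
      using is_corr_norm_le[OF e psi] gap_pos by (simp add: D0 field_simps)
    hence "torus_norm \<psi> * K \<le> 2 * \<alpha>2 / gap * D0 t * K" using K by (rule mult_right_mono)
    ultimately show ?thesis unfolding real_norm_def by linarith
  qed
  have "((\<lambda>t. \<alpha>2 * D1 t + 2 * \<alpha>2 / gap * D0 t * K) \<longlongrightarrow> \<alpha>2 * 0 + 2 * \<alpha>2 / gap * 0 * K) (at 0)"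
    unfolding D0_def D1_def by (intro tendsto_intros cutoff_tendsto \<omega> zj zij)
  hence "((\<lambda>t. \<alpha>2 * D1 t + 2 * \<alpha>2 / gap * D0 t * K) \<longlongrightarrow> 0) (at 0)" by simp
  hence "((\<lambda>t. g t - g 0) \<longlongrightarrow> 0) (at 0)"
    by (rule Lim_null_comparison[OF always_eventually[OF allI[OF g_diff]]])
  from tendsto_add[OF tendsto_add[OF quot this] tendsto_const[of "g 0"]]
  have "((\<lambda>t. b (T t) $ i / t) \<longlongrightarrow> g 0) (at 0)" by simp
  hence "((\<lambda>t. b (T t) $ i) has_real_derivative g 0) (at 0)"
    using b_0 by (simp add: has_field_derivative_iff)
  thus ?thesis unfolding g_0 by (simp add: b_def T_def c_def)
qed

end

theorem lemma8p1:
  fixes \<mu> :: "real ^ 'n \<Rightarrow> real ^ 'n \<Rightarrow> real"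
    and a_sym :: "real ^ 'n \<Rightarrow> real"
    and \<alpha>1 \<alpha>2 :: real
  assumes mu_measurable: "case_prod \<mu> \<in> borel_measurable borel"
    and mu_periodic1: "\<And>\<eta>. lattice_periodic (\<lambda>\<xi>. \<mu> \<xi> \<eta>)"
    and mu_periodic2: "\<And>\<xi>. lattice_periodic (\<lambda>\<eta>. \<mu> \<xi> \<eta>)"
    and mu_symmetric: "\<And>\<xi> \<eta>. \<mu> \<xi> \<eta> = \<mu> \<eta> \<xi>"
    and mu_bounds: "0 < \<alpha>1" "\<And>\<xi> \<eta>. \<alpha>1 \<le> \<mu> \<xi> \<eta>" "\<And>\<xi> \<eta>. \<mu> \<xi> \<eta> \<le> \<alpha>2"
    and a_admissible: "admissible a_sym"
    and a_even: "\<And>z. a_sym (- z) = a_sym z"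
  shows
    "(\<forall>c :: real ^ 'n \<Rightarrow> real ^ 'n.
        (\<forall>z. c (- z) = - c z) \<and>
        integrable lborel c \<and>
        integrable lborel (\<lambda>z. (norm z)\<^sup>2 * norm (c z)) \<and>
        (\<forall>\<^sub>F l in nhds 0. admissible (\<lambda>z. a_sym z + l \<bullet> c z))
        \<longrightarrow>
        (\<exists>\<phi>. is_density_correction a_sym \<mu> c \<phi> \<and>
          (\<forall>\<psi>. is_density_correction a_sym \<mu> c \<psi> \<longrightarrow> (AE \<xi> in lborel. \<psi> \<xi> = \<phi> \<xi>))) \<and>
        (\<forall>\<phi>. is_density_correction a_sym \<mu> c \<phi> \<longrightarrow>
          (\<forall>i. (\<lambda>l. effective_drift (\<lambda>z. a_sym z + l \<bullet> c z) \<mu> $ i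
                  - drift_linear_part a_sym \<mu> c \<phi> l $ i)
               \<in> O[nhds 0](\<lambda>l. (norm l)\<^sup>2))))
     \<and>
     (\<forall>\<omega>. cutoff \<omega> \<longrightarrow>
        (let c = einstein_perturbation a_sym \<omega>;
             b = (\<lambda>l. effective_drift (\<lambda>z. a_sym z + l \<bullet> c l z) \<mu>)
         in
          (\<forall>l. \<exists>\<phi>. is_density_correction a_sym \<mu> (c l) \<phi> \<and>
            (\<forall>\<psi>. is_density_correction a_sym \<mu> (c l) \<psi> \<longrightarrow> (AE \<xi> in lborel. \<psi> \<xi> = \<phi> \<xi>))) \<and>
          (\<forall>\<phi>. (\<forall>l. is_density_correction a_sym \<mu> (c l) (\<phi> l)) \<longrightarrow>
            (\<forall>i. (\<lambda>l. b l $ i - drift_linear_part a_sym \<mu> (c l) (\<phi> l) l $ i)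
                 \<in> O[nhds 0](\<lambda>l. (norm l)\<^sup>2))) \<and>
          (\<forall>i j. ((\<lambda>t. b (t *\<^sub>R axis j 1) $ i)
                    has_real_derivative 2 * effective_matrix a_sym \<mu> $ i $ j) (at 0))))"
proof -
  interpret symmetric_kernel \<mu> \<alpha>1 \<alpha>2 a_sym
    using assms by unfold_locales (auto simp: admissible_def)
  have part1: "(\<exists>\<phi>. is_density_correction a_sym \<mu> c \<phi> \<and>
          (\<forall>\<psi>. is_density_correction a_sym \<mu> c \<psi> \<longrightarrow> (AE \<xi> in lborel. \<psi> \<xi> = \<phi> \<xi>))) \<and>
        (\<forall>\<phi>. is_density_correction a_sym \<mu> c \<phi> \<longrightarrow>
          (\<forall>i. (\<lambda>l. effective_drift (\<lambda>z. a_sym z + l \<bullet> c z) \<mu> $ i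
                  - drift_linear_part a_sym \<mu> c \<phi> l $ i)
               \<in> O[nhds 0](\<lambda>l. (norm l)\<^sup>2)))"
    if odd: "\<And>z. c (- z) = - c z" and c: "integrable lborel c" "integrable lborel (\<lambda>z. (norm z)\<^sup>2 * norm (c z))"
    for c :: "real ^ 'n \<Rightarrow> real ^ 'n"
  proof -
    have [measurable]: "c \<in> borel_measurable borel" using c by (auto dest: borel_measurable_integrable)
    have k: "integrable lborel (\<lambda>z. norm (c z))" using c by simp
    have k1: "integrable lborel (\<lambda>z. norm z * norm (c z))"
    proof (rule Bochner_Integration.integrable_bound)
      show "integrable lborel (\<lambda>z. norm (c z) + (norm z)\<^sup>2 * norm (c z))" using k c by simp
      have "norm z \<le> 1 + (norm z)\<^sup>2" for z :: "real ^ 'n"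
        using zero_le_power2[of "norm z - 1"] norm_ge_zero[of z] unfolding power2_diff power_one by linarith
      hence "norm z * norm (c z) \<le> (1 + (norm z)\<^sup>2) * norm (c z)" for z
        by (intro mult_right_mono) auto
      thus "AE z in lborel. norm (norm z * norm (c z)) \<le> norm (norm (c z) + (norm z)\<^sup>2 * norm (c z))"
        by (simp add: distrib_right)
    qed measurable
    have cc: "integrable lborel (\<lambda>z. c z $ j)" for j
      by (rule component_bound_integrable(1)[OF _ order.refl k k1]) measurable
    show ?thesis
    proof (intro conjI allI impI)
      \<comment> \<open>A fixed \<open>c\<close> is a constant family, with majorant
        \<open>norm (c z)\<close>.\<close>
      show "(\<lambda>l. effective_drift (\<lambda>z. a_sym z + l \<bullet> c z) \<mu> $ i - drift_linear_part a_sym \<mu> c \<phi> l $ i)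
          \<in> O[nhds 0](\<lambda>l. (norm l)\<^sup>2)" if "is_density_correction a_sym \<mu> c \<phi>" for \<phi> i
        by (rule drift_linear_approx[OF _ odd order.refl k k1 that]) measurable
    qed (rule density_correction_ex1[OF cc odd])
  qed
  show ?thesis
    unfolding Let_def
  proof (intro conjI allI impI)
    fix \<omega> assume \<omega>: "cutoff \<omega>"
    \<comment> \<open>The majorant of the cut-off kernels is \<open>norm z * a_sym z\<close>,
      independent of \<open>l\<close>; its first moment is the second moment of
      \<open>a_sym\<close>.\<close>
    note cc = einstein_perturbation_measurable[OF \<omega>] norm_einstein_perturbation_le[OF \<omega>]
    show "\<exists>\<phi>. is_density_correction a_sym \<mu> (einstein_perturbation a_sym \<omega> l) \<phi> \<and>
        (\<forall>\<psi>. is_density_correction a_sym \<mu> (einstein_perturbation a_sym \<omega> l) \<psi> \<longrightarrow> (AE \<xi> in lborel. \<psi> \<xi> = \<phi> \<xi>))" for l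
      by (rule density_correction_ex1[OF component_bound_integrable(1)[OF cc a_moment1 a_moment2'] einstein_perturbation_odd])
    show "(\<lambda>l. effective_drift (\<lambda>z. a_sym z + l \<bullet> einstein_perturbation a_sym \<omega> l z) \<mu> $ i
          - drift_linear_part a_sym \<mu> (einstein_perturbation a_sym \<omega> l) (\<phi> l) l $ i) \<in> O[nhds 0](\<lambda>l. (norm l)\<^sup>2)"
      if "\<forall>l. is_density_correction a_sym \<mu> (einstein_perturbation a_sym \<omega> l) (\<phi> l)" for \<phi> i
      using that by (intro drift_linear_approx[OF cc(1) einstein_perturbation_odd cc(2) a_moment1 a_moment2']) blast
    show "((\<lambda>t. effective_drift (\<lambda>z. a_sym z + (t *\<^sub>R axis j 1) \<bullet> einstein_perturbation a_sym \<omega> (t *\<^sub>R axis j 1) z) \<mu> $ i)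
        has_real_derivative 2 * effective_matrix a_sym \<mu> $ i $ j) (at 0)" for i j
      by (rule einstein_relation[OF \<omega>])
  qed (use part1 in blast)+
qed

end
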